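(* Assume (A0) and (A1), and let $T>0$. The unique viscosity solution $u$ of $u_t+H(x,u_x)=0$ on $J_T$ with $u(0,\cdot)=u_0$ satisfying $|u-u_0|\le C_T$ on $J_T$ for some constant $C_T$ is $u=u_{\mathrm{oc}}$, and moreover the Hopf–Lax type formula $$u_{\mathrm{oc}}(t,x)=\inf_{y\in J}\{u_0(y)+\mathcal{D}(0,y;t,x)\}$$ holds for all $(t,x)\in J_T$.
   Context: Junction: fix an integer $N\ge1$ and $N$ distinct unit vectors $e_1,\dots,e_N\in\mathbb{R}^2$. Set $J_i=[0,\infty)e_i$, $J_i^*=J_i\setminus\{0\}$, $J=\bigcup_{i=1}^NJ_i$, $I_N=\{1,\dots,N\}$. Each $x\in J_i$ is written $x=x_ie_i$, $x_i\ge0$. $J$ carries the geodesic distance $d(x,y)=|x-y|$ if $x,y$ lie in a common branch, $d(x,y)=|x|+|y|$ otherwise. $J_T=(0,T)\times J$; balls are taken in $(0,\infty)\times J$. For $u$ on $J_T$, $u^i$ is its restriction to $(0,T)\times J_i$ as a function of $(t,x_i)$; $C^1_*(J_T)$ is the set of continuous $u$ with each $u^i\in C^1((0,T)\times[0,\infty))$; $u^i_x=\partial u^i/\partial x_i$, $u_x=u^i_x$ on $J_i^*$, $u_x(t,0)=(u^1_x(t,0),\dots,u^N_x(t,0))$. (A0): $u_0:J\to\mathbb{R}$ is Lipschitz with respect to $d$. (A1): there is $\gamma>0$ with $L_i\in C^2(\mathbb{R})$, $L_i''\ge\gamma$ for each $i$; $H_i(p)=\sup_{q\in\mathbb{R}}(pq-L_i(q))$,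 $H_i^-(p)=\sup_{q\le0}(pq-L_i(q))$. $H(x,p)=H_i(p)$ for $x\in J_i^*$, $H(0,p)=\max_iH_i^-(p_i)$ for $p\in\mathbb{R}^N$. Viscosity solutions: $u$ is a sub-solution (resp. super-solution) on $J_T$ if it is u.s.c. (resp. l.s.c.) and for every $\phi\in C^1_*(J_T)$ touching $u$ from above (resp. below) at $P=(t,x)\in J_T$ on some ball $B(P,r)$: $\phi_t+H_i(\phi_x)\le0$ (resp. $\ge0$) at $P$ if $x\in J_i^*$, and $\phi_t(t,0)+\max_iH_i^-(\phi^i_x(t,0))\le0$ (resp. $\ge0$) if $x=0$; with the initial condition, additionally $u(0,\cdot)\le u_0$ (resp. $\ge u_0$). A solution is a function whose u.s.c. envelope is a sub-solution and l.s.c. envelope a super-solution. Optimal control: $L_0(p)=\min_{j\in I_N}L_j(p)$. Admissible directions: $A(x)=\mathbb{R}e_i$ if $x\in J_i^*$, $A(0)=\bigcup_i[0,\infty)e_i$. For $P=pe_i\in A(x)$: $L(x,P)=L_i(p)$ if $x\in J_i^*$, $L(0,P)=L_0(p)$. For $s<t$, $\mathcal{A}(s,y;t,x)$ is the set of $X\in W^{1,1}([s,t];\mathbb{R}^2)$ with $X(\tau)\in J$ for all $\tau$, $\dot X(\tau)\in A(X(\tau))$ for a.e. $\tau$, $X(s)=y$, $X(t)=x$. The minimal action is $\mathcal{D}(s,y;t,x)=\inf_{X\in\mathcal{A}(s,y;t,x)}\int_s^tL(X(\tau),\dot X(\tau))\,d\tau$ for $s<t$, and $\mathcal{D}(t,y;t,x)=0$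 if $y=x$, $+\infty$ otherwise. The value function is $u_{\mathrm{oc}}(t,x)=\inf_{y\in J,\,X\in\mathcal{A}(0,y;t,x)}\{u_0(y)+\int_0^tL(X,\dot X)\,d\tau\}$ for $t>0$, and $u_{\mathrm{oc}}(0,\cdot)=u_0$. *)

theory Defs
  imports "HOL-Analysis.Analysis"
begin

(* Junction: N distinct unit vectors e 1, ..., e N in R^2 (type real^2), index set I_N = {1..N}. *)

definition branch :: "(nat \<Rightarrow> real^2) \<Rightarrow> nat \<Rightarrow> (real^2) set" where
  "branch e i = {s *\<^sub>R e i | s. s \<ge> 0}"

definition branch_star :: "(nat \<Rightarrow> real^2) \<Rightarrow> nat \<Rightarrow> (real^2) set" where
  "branch_star e i = {s *\<^sub>R e i | s. s > 0}"

definition junction :: "nat \<Rightarrow> (nat \<Rightarrow> real^2) \<Rightarrow> (real^2) set" where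
  "junction N e = (\<Union>i\<in>{1..N}. branch e i)"

definition jdist :: "nat \<Rightarrow> (nat \<Rightarrow> real^2) \<Rightarrow> real^2 \<Rightarrow> real^2 \<Rightarrow> real" where
  "jdist N e x y = (if \<exists>i\<in>{1..N}. x \<in> branch e i \<and> y \<in> branch e i
                    then norm (x - y) else norm x + norm y)"

definition pdist :: "nat \<Rightarrow> (nat \<Rightarrow> real^2) \<Rightarrow> real \<times> (real^2) \<Rightarrow> real \<times> (real^2) \<Rightarrow> real" where
  "pdist N e P Q = sqrt ((fst P - fst Q)\<^sup>2 + (jdist N e (snd P) (snd Q))\<^sup>2)"

definition JT :: "nat \<Rightarrow> (nat \<Rightarrow> real^2) \<Rightarrow> real \<Rightarrow> (real \<times> (real^2)) set" where
  "JT N e T = {0<..<T} \<times> junction N e"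

definition JT0 :: "nat \<Rightarrow> (nat \<Rightarrow> real^2) \<Rightarrow> real \<Rightarrow> (real \<times> (real^2)) set" where
  "JT0 N e T = {0..<T} \<times> junction N e"

definition d_lipschitz :: "nat \<Rightarrow> (nat \<Rightarrow> real^2) \<Rightarrow> (real^2 \<Rightarrow> real) \<Rightarrow> bool" where
  "d_lipschitz N e u0 \<longleftrightarrow> (\<exists>K. \<forall>x\<in>junction N e. \<forall>y\<in>junction N e.
      \<bar>u0 x - u0 y\<bar> \<le> K * jdist N e x y)"

definition hyp_A1 :: "nat \<Rightarrow> (nat \<Rightarrow> real \<Rightarrow> real) \<Rightarrow> bool" where
  "hyp_A1 N Lag \<longleftrightarrow> (\<exists>\<gamma>>0. \<forall>i\<in>{1..N}. \<exists>L1 L2.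
      (\<forall>q. (Lag i has_real_derivative L1 q) (at q) \<and> (L1 has_real_derivative L2 q) (at q)
           \<and> L2 q \<ge> \<gamma>) \<and> continuous_on UNIV L2)"

definition Ham :: "(nat \<Rightarrow> real \<Rightarrow> real) \<Rightarrow> nat \<Rightarrow> real \<Rightarrow> real" where
  "Ham Lag i p = (SUP q. p * q - Lag i q)"

definition Ham_minus :: "(nat \<Rightarrow> real \<Rightarrow> real) \<Rightarrow> nat \<Rightarrow> real \<Rightarrow> real" where
  "Ham_minus Lag i p = (SUP q\<in>{..0}. p * q - Lag i q)"

definition usc_on :: "nat \<Rightarrow> (nat \<Rightarrow> real^2) \<Rightarrow> (real \<times> (real^2)) set \<Rightarrow> (real \<Rightarrow> real^2 \<Rightarrow> real) \<Rightarrow> bool" where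
  "usc_on N e D u \<longleftrightarrow> (\<forall>P\<in>D. \<forall>\<epsilon>>0. \<exists>\<delta>>0. \<forall>Q\<in>D. pdist N e Q P < \<delta> \<longrightarrow>
      u (fst Q) (snd Q) < u (fst P) (snd P) + \<epsilon>)"

definition lsc_on :: "nat \<Rightarrow> (nat \<Rightarrow> real^2) \<Rightarrow> (real \<times> (real^2)) set \<Rightarrow> (real \<Rightarrow> real^2 \<Rightarrow> real) \<Rightarrow> bool" where
  "lsc_on N e D u \<longleftrightarrow> (\<forall>P\<in>D. \<forall>\<epsilon>>0. \<exists>\<delta>>0. \<forall>Q\<in>D. pdist N e Q P < \<delta> \<longrightarrow>
      u (fst P) (snd P) - \<epsilon> < u (fst Q) (snd Q))"

definition usc_env_e :: "nat \<Rightarrow> (nat \<Rightarrow> real^2) \<Rightarrow> (real \<times> (real^2)) set \<Rightarrow> (real \<Rightarrow> real^2 \<Rightarrow> real) \<Rightarrow> real \<Rightarrow> real^2 \<Rightarrow> ereal" where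
  "usc_env_e N e D u t x = (INF \<delta>\<in>{0<..}. SUP Q\<in>{Q\<in>D. pdist N e Q (t, x) < \<delta>}. ereal (u (fst Q) (snd Q)))"

definition lsc_env_e :: "nat \<Rightarrow> (nat \<Rightarrow> real^2) \<Rightarrow> (real \<times> (real^2)) set \<Rightarrow> (real \<Rightarrow> real^2 \<Rightarrow> real) \<Rightarrow> real \<Rightarrow> real^2 \<Rightarrow> ereal" where
  "lsc_env_e N e D u t x = (SUP \<delta>\<in>{0<..}. INF Q\<in>{Q\<in>D. pdist N e Q (t, x) < \<delta>}. ereal (u (fst Q) (snd Q)))"

definition C1_star :: "nat \<Rightarrow> (nat \<Rightarrow> real^2) \<Rightarrow> real \<Rightarrow> (real \<Rightarrow> real^2 \<Rightarrow> real)
    \<Rightarrow> (nat \<Rightarrow> real \<Rightarrow> real \<Rightarrow> real) \<Rightarrow> (nat \<Rightarrow> real \<Rightarrow> real \<Rightarrow> real) \<Rightarrow> bool" where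
  "C1_star N e T \<phi> Dt Dx \<longleftrightarrow>
     continuous_on (JT N e T) (\<lambda>(t, x). \<phi> t x) \<and>
     (\<forall>i\<in>{1..N}.
        continuous_on ({0<..<T} \<times> {0..}) (\<lambda>(t, s). Dt i t s) \<and>
        continuous_on ({0<..<T} \<times> {0..}) (\<lambda>(t, s). Dx i t s) \<and>
        (\<forall>t s. 0 < t \<and> t < T \<and> 0 \<le> s \<longrightarrow>
           ((\<lambda>(\<tau>, \<sigma>). \<phi> \<tau> (\<sigma> *\<^sub>R e i)) has_derivative (\<lambda>(h, k). Dt i t s * h + Dx i t s * k))
             (at (t, s) within ({0<..<T} \<times> {0..}))))"

definition touch_above :: "nat \<Rightarrow> (nat \<Rightarrow> real^2) \<Rightarrow> real \<Rightarrow> (real \<Rightarrow> real^2 \<Rightarrow> real) \<Rightarrow> (real \<Rightarrow> real^2 \<Rightarrow> real) \<Rightarrow> real \<times> (real^2) \<Rightarrow> bool" where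
  "touch_above N e T \<phi> u P \<longleftrightarrow> u (fst P) (snd P) = \<phi> (fst P) (snd P) \<and>
     (\<exists>r>0. \<forall>Q\<in>JT N e T. pdist N e Q P < r \<longrightarrow> u (fst Q) (snd Q) \<le> \<phi> (fst Q) (snd Q))"

definition touch_below :: "nat \<Rightarrow> (nat \<Rightarrow> real^2) \<Rightarrow> real \<Rightarrow> (real \<Rightarrow> real^2 \<Rightarrow> real) \<Rightarrow> (real \<Rightarrow> real^2 \<Rightarrow> real) \<Rightarrow> real \<times> (real^2) \<Rightarrow> bool" where
  "touch_below N e T \<phi> u P \<longleftrightarrow> u (fst P) (snd P) = \<phi> (fst P) (snd P) \<and>
     (\<exists>r>0. \<forall>Q\<in>JT N e T. pdist N e Q P < r \<longrightarrow> \<phi> (fst Q) (snd Q) \<le> u (fst Q) (snd Q))"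

definition visc_sub :: "nat \<Rightarrow> (nat \<Rightarrow> real^2) \<Rightarrow> (nat \<Rightarrow> real \<Rightarrow> real) \<Rightarrow> real
    \<Rightarrow> (real^2 \<Rightarrow> real) \<Rightarrow> (real \<Rightarrow> real^2 \<Rightarrow> real) \<Rightarrow> bool" where
  "visc_sub N e Lag T u0 u \<longleftrightarrow>
     usc_on N e (JT0 N e T) u \<and>
     (\<forall>\<phi> Dt Dx. C1_star N e T \<phi> Dt Dx \<longrightarrow>
        (\<forall>t. 0 < t \<and> t < T \<longrightarrow>
           (\<forall>i\<in>{1..N}. \<forall>s>0. touch_above N e T \<phi> u (t, s *\<^sub>R e i) \<longrightarrow>
               Dt i t s + Ham Lag i (Dx i t s) \<le> 0) \<and>
           (touch_above N e T \<phi> u (t, 0) \<longrightarrow>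
               Dt 1 t 0 + Max ((\<lambda>i. Ham_minus Lag i (Dx i t 0)) ` {1..N}) \<le> 0))) \<and>
     (\<forall>x\<in>junction N e. u 0 x \<le> u0 x)"

definition visc_super :: "nat \<Rightarrow> (nat \<Rightarrow> real^2) \<Rightarrow> (nat \<Rightarrow> real \<Rightarrow> real) \<Rightarrow> real
    \<Rightarrow> (real^2 \<Rightarrow> real) \<Rightarrow> (real \<Rightarrow> real^2 \<Rightarrow> real) \<Rightarrow> bool" where
  "visc_super N e Lag T u0 u \<longleftrightarrow>
     lsc_on N e (JT0 N e T) u \<and>
     (\<forall>\<phi> Dt Dx. C1_star N e T \<phi> Dt Dx \<longrightarrow>
        (\<forall>t. 0 < t \<and> t < T \<longrightarrow>
           (\<forall>i\<in>{1..N}. \<forall>s>0. touch_below N e T \<phi> u (t, s *\<^sub>R e i) \<longrightarrow>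
               Dt i t s + Ham Lag i (Dx i t s) \<ge> 0) \<and>
           (touch_below N e T \<phi> u (t, 0) \<longrightarrow>
               Dt 1 t 0 + Max ((\<lambda>i. Ham_minus Lag i (Dx i t 0)) ` {1..N}) \<ge> 0))) \<and>
     (\<forall>x\<in>junction N e. u 0 x \<ge> u0 x)"

definition visc_sol :: "nat \<Rightarrow> (nat \<Rightarrow> real^2) \<Rightarrow> (nat \<Rightarrow> real \<Rightarrow> real) \<Rightarrow> real
    \<Rightarrow> (real^2 \<Rightarrow> real) \<Rightarrow> (real \<Rightarrow> real^2 \<Rightarrow> real) \<Rightarrow> bool" where
  "visc_sol N e Lag T u0 u \<longleftrightarrow>
     (\<forall>(t, x)\<in>JT0 N e T. \<bar>usc_env_e N e (JT0 N e T) u t x\<bar> \<noteq> \<infinity> \<and>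
                          \<bar>lsc_env_e N e (JT0 N e T) u t x\<bar> \<noteq> \<infinity>) \<and>
     visc_sub N e Lag T u0 (\<lambda>t x. real_of_ereal (usc_env_e N e (JT0 N e T) u t x)) \<and>
     visc_super N e Lag T u0 (\<lambda>t x. real_of_ereal (lsc_env_e N e (JT0 N e T) u t x))"

definition L0 :: "nat \<Rightarrow> (nat \<Rightarrow> real \<Rightarrow> real) \<Rightarrow> real \<Rightarrow> real" where
  "L0 N Lag p = Min ((\<lambda>j. Lag j p) ` {1..N})"

definition adm_dir :: "nat \<Rightarrow> (nat \<Rightarrow> real^2) \<Rightarrow> real^2 \<Rightarrow> real^2 \<Rightarrow> bool" where
  "adm_dir N e x P \<longleftrightarrow>
     (\<exists>i\<in>{1..N}. x \<in> branch_star e i \<and> (\<exists>p. P = p *\<^sub>R e i)) \<or>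
     (x = 0 \<and> (\<exists>i\<in>{1..N}. \<exists>p\<ge>0. P = p *\<^sub>R e i))"

(* the running cost L(x,P), meaningful for P \<in> A(x) *)
definition Lcost :: "nat \<Rightarrow> (nat \<Rightarrow> real^2) \<Rightarrow> (nat \<Rightarrow> real \<Rightarrow> real) \<Rightarrow> real^2 \<Rightarrow> real^2 \<Rightarrow> real" where
  "Lcost N e Lag x P =
     (if x = 0 then L0 N Lag (norm P)
      else (let i = (THE i. i \<in> {1..N} \<and> x \<in> branch_star e i) in Lag i (P \<bullet> e i)))"

(* A(s,y;t,x): X in W^{1,1}([s,t];R^2) with weak derivative V (X(tau) = X(s) + int_s^tau V),
   X(tau) in J, V(tau) in A(X(tau)) a.e., X(s) = y, X(t) = x *)
definition adm_paths :: "nat \<Rightarrow> (nat \<Rightarrow> real^2) \<Rightarrow> real \<Rightarrow> real^2 \<Rightarrow> real \<Rightarrow> real^2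
    \<Rightarrow> ((real \<Rightarrow> real^2) \<times> (real \<Rightarrow> real^2)) set" where
  "adm_paths N e s y t x = {(X, V).
     V absolutely_integrable_on {s..t} \<and>
     (\<forall>\<tau>\<in>{s..t}. X \<tau> = X s + integral {s..\<tau>} V) \<and>
     (\<forall>\<tau>\<in>{s..t}. X \<tau> \<in> junction N e) \<and>
     (AE \<tau> in lebesgue. \<tau> \<in> {s..t} \<longrightarrow> adm_dir N e (X \<tau>) (V \<tau>)) \<and>
     X s = y \<and> X t = x}"

(* int_s^t L(X, Xdot), as an extended real (positive part minus negative part) *)
definition action :: "nat \<Rightarrow> (nat \<Rightarrow> real^2) \<Rightarrow> (nat \<Rightarrow> real \<Rightarrow> real) \<Rightarrow> real \<Rightarrow> real
    \<Rightarrow> (real \<Rightarrow> real^2) \<Rightarrow> (real \<Rightarrow> real^2) \<Rightarrow> ereal" where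
  "action N e Lag s t X V =
     enn2ereal (set_nn_integral lborel {s..t} (\<lambda>\<tau>. ennreal (Lcost N e Lag (X \<tau>) (V \<tau>))))
     - enn2ereal (set_nn_integral lborel {s..t} (\<lambda>\<tau>. ennreal (- Lcost N e Lag (X \<tau>) (V \<tau>))))"

definition min_action :: "nat \<Rightarrow> (nat \<Rightarrow> real^2) \<Rightarrow> (nat \<Rightarrow> real \<Rightarrow> real) \<Rightarrow> real \<Rightarrow> real^2 \<Rightarrow> real \<Rightarrow> real^2 \<Rightarrow> ereal" where
  "min_action N e Lag s y t x =
     (if s < t then (INF XV\<in>adm_paths N e s y t x. action N e Lag s t (fst XV) (snd XV))
      else if s = t \<and> y = x then 0 else \<infinity>)"

definition u_oc :: "nat \<Rightarrow> (nat \<Rightarrow> real^2) \<Rightarrow> (nat \<Rightarrow> real \<Rightarrow> real) \<Rightarrow> (real^2 \<Rightarrow> real) \<Rightarrow> real \<Rightarrow> real^2 \<Rightarrow> ereal" where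
  "u_oc N e Lag u0 t x =
     (if t = 0 then ereal (u0 x)
      else (INF yXV\<in>{(y, XV). y \<in> junction N e \<and> XV \<in> adm_paths N e 0 y t x}.
              ereal (u0 (fst yXV)) + action N e Lag 0 t (fst (snd yXV)) (snd (snd yXV))))"

end

(*
  The value function is first taken over piecewise linear trajectories only. There the dynamic programming
  inequality along lines holds by construction, Lipschitz bounds follow by cutting trajectories, and optimal last
  pieces exist by compactness. This makes the function a viscosity solution.

  A subsolution satisfies the dynamic programming inequality along every line, by comparison with a moving parabola,
  and is therefore below the value function. A supersolution v is above it: minimise v plus the cost of
  going on to a fixed target. At an interior minimum the first piece of an optimal continuation yields a smooth strict
  subsolution touching v from below, so the minimum is at time 0. The target is first the vertex; other
  targets then amount to a half-line problem whose boundary data are controlled at the vertex.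

  Arbitrary admissible trajectories cost at least as much as piecewise linear ones: by Jensen before the first and after the
  last visit of the vertex, and in between because excursions have mean velocity 0 and the velocity
  vanishes almost everywhere on the zero set.
*)
theory Submission
  imports Defs
begin

text \<open>The vertex is the obstacle: a test function has an independent slope there on each
  branch, so doubling the variables would need a penalty adapted to the junction. Therefore a
  subsolution and a supersolution are never compared with each other but separately with
  \<open>U\<close>, by test functions whose one-sided quadratic expansions are explicit.
  \<open>Ham_minus\<close> only sees speeds q \<le> 0, those of lines that arrive at the vertex;
  lines that leave it need extra care in the subsolution argument. For supersolutions the cost of
  going on to the vertex is not differentiated as a function of the starting point: the duration of
  the run becomes one more variable of the minimisation, and at a minimum a convenient choice of it
  suffices for the test. A small multiple of time and a term blowing up at the final time make the
  test strict and keep the minimum away from the final time; both disappear in a limit that uses the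
  Lipschitz bound of \<open>U\<close> in time.\<close>

locale junction_hj =
  fixes N :: nat and e :: "nat \<Rightarrow> real^2" and Lag dLag ddLag :: "nat \<Rightarrow> real \<Rightarrow> real"
    and u0 :: "real^2 \<Rightarrow> real" and \<gamma> K :: real
  assumes N_pos: "N \<ge> 1"
    and unit0: "i \<in> {1..N} \<Longrightarrow> norm (e i) = 1"
    and distinct0: "inj_on e {1..N}"
    and lip: "x \<in> junction N e \<Longrightarrow> y \<in> junction N e \<Longrightarrow> \<bar>u0 x - u0 y\<bar> \<le> K * jdist N e x y"
    and K_nonneg: "K \<ge> 0"
    and gamma_pos: "\<gamma> > 0"
    and Lag_deriv0: "i \<in> {1..N} \<Longrightarrow> (Lag i has_real_derivative dLag i q) (at q)"
    and dLag_deriv0: "i \<in> {1..N} \<Longrightarrow> (dLag i has_real_derivative ddLag i q) (at q)"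
    and ddLag_ge0: "i \<in> {1..N} \<Longrightarrow> \<gamma> \<le> ddLag i q"
    and ddLag_cont0: "i \<in> {1..N} \<Longrightarrow> continuous_on UNIV (ddLag i)"
begin

text \<open>An opaque name for the index set, so that the simplifier does not split membership into
  two inequalities.\<close>

definition I :: "nat set" where I_eq: "I = {1..N}"

lemmas unit = unit0[folded I_eq] and distinct = distinct0[folded I_eq]
  and Lag_deriv = Lag_deriv0[folded I_eq] and dLag_deriv = dLag_deriv0[folded I_eq]
  and ddLag_ge = ddLag_ge0[folded I_eq] and ddLag_cont = ddLag_cont0[folded I_eq]

lemma finite_I [simp]: "finite I" by (simp add: I_eq)

lemma L0_eq: "L0 N Lag p = Min ((\<lambda>j. Lag j p) ` I)"
  by (simp add: L0_def I_eq)

lemma jdist_eq: "jdist N e x y = (if \<exists>i\<in>I. x \<in> branch e i \<and> y \<in> branch e i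
                    then norm (x - y) else norm x + norm y)"
  by (simp add: jdist_def I_eq)

abbreviation J :: "(real^2) set" where "J \<equiv> junction N e"

lemma I_nonempty: "I \<noteq> {}" and one_in_I: "1 \<in> I"
  using N_pos by (auto simp: I_eq)

subsection \<open>Uniformly convex Lagrangians\<close>

lemma Lag_taylor:
  assumes i: "i \<in> I"
  shows "\<exists>\<xi>. min q0 q \<le> \<xi> \<and> \<xi> \<le> max q0 q \<and>
     Lag i q = Lag i q0 + dLag i q0 * (q - q0) + ddLag i \<xi> / 2 * (q - q0)\<^sup>2"
proof (cases "q = q0")
  case False
  define D where "D = (\<lambda>m::nat. if m = 0 then Lag i else if m = 1 then dLag i else ddLag i)"
  have "\<exists>t. (if q < q0 then q < t \<and> t < q0 else q0 < t \<and> t < q) \<and>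
        Lag i q = (\<Sum>m<2. D m q0 / fact m * (q - q0) ^ m) + D 2 t / fact 2 * (q - q0) ^ 2"
  proof (rule Taylor[where a = "min q0 q" and b = "max q0 q"])
    show "\<forall>m t. m < 2 \<and> min q0 q \<le> t \<and> t \<le> max q0 q \<longrightarrow> (D m has_real_derivative D (Suc m) t) (at t)"
      using Lag_deriv[OF i] dLag_deriv[OF i] by (auto simp: D_def less_2_cases_iff)
  qed (use False in \<open>auto simp: D_def\<close>)
  then obtain t where "if q < q0 then q < t \<and> t < q0 else q0 < t \<and> t < q"
    and "Lag i q = (\<Sum>m<2. D m q0 / fact m * (q - q0) ^ m) + D 2 t / fact 2 * (q - q0) ^ 2"
    by blast
  then show ?thesis
    by (intro exI[of _ t]) (auto simp: D_def numeral_2_eq_2 split: if_splits)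
qed auto

lemma Lag_ge_quadratic:
  assumes i: "i \<in> I"
  shows "Lag i q \<ge> Lag i q0 + dLag i q0 * (q - q0) + \<gamma> / 2 * (q - q0)\<^sup>2"
proof -
  obtain \<xi> where "Lag i q = Lag i q0 + dLag i q0 * (q - q0) + ddLag i \<xi> / 2 * (q - q0)\<^sup>2"
    using Lag_taylor[OF i] by blast
  moreover have "\<gamma> / 2 * (q - q0)\<^sup>2 \<le> ddLag i \<xi> / 2 * (q - q0)\<^sup>2"
    using ddLag_ge[OF i, of \<xi>] by (intro mult_right_mono) auto
  ultimately show ?thesis by simp
qed

lemma Lag_ge_tangent:
  assumes i: "i \<in> I"
  shows "Lag i q \<ge> Lag i q0 + dLag i q0 * (q - q0)"
proof -
  have "0 \<le> \<gamma> / 2 * (q - q0)\<^sup>2" using gamma_pos by simp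
  then show ?thesis using Lag_ge_quadratic[OF i, of q0 q] by linarith
qed

lemma Lag_continuous:
  assumes "i \<in> I" shows "continuous_on S (Lag i)"
  using Lag_deriv[OF assms] by (meson DERIV_isCont continuous_at_imp_continuous_on)

text \<open>Completing the square in the quadratic lower bound at speed 0: \<open>\<beta> i\<close>
  is the vertex of the parabola, and summing the nonnegative \<open>c i\<close> gives one constant
  for all branches. The slope P is free; later coercivity estimates choose K, K + 1 or something
  larger.\<close>

lemma Lag_superlinear:
  obtains C where "C \<ge> 0" "\<And>i q. i \<in> I \<Longrightarrow> Lag i q \<ge> P * \<bar>q\<bar> - C"
proof -
  define \<beta> where "\<beta> = (\<lambda>i. (\<bar>P\<bar> + \<bar>dLag i 0\<bar>) / \<gamma>)"
  define c where "c = (\<lambda>i. \<bar>Lag i 0\<bar> + \<gamma> / 2 * (\<beta> i)\<^sup>2)"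
  have c0: "c i \<ge> 0" for i using gamma_pos by (simp add: c_def)
  show thesis
  proof (rule that)
    show "(\<Sum>i\<in>I. c i) \<ge> 0" using c0 by (simp add: sum_nonneg)
    fix i q assume i: "i \<in> I"
    have "0 \<le> \<gamma> / 2 * (\<bar>q\<bar> - \<beta> i)\<^sup>2" using gamma_pos by simp
    also have "\<dots> = \<gamma> / 2 * q\<^sup>2 - (\<gamma> * \<beta> i) * \<bar>q\<bar> + \<gamma> / 2 * (\<beta> i)\<^sup>2"
      by (simp add: power2_eq_square algebra_simps)
    also have "\<gamma> * \<beta> i = \<bar>P\<bar> + \<bar>dLag i 0\<bar>" using gamma_pos by (simp add: \<beta>_def)
    finally have 1: "\<gamma> / 2 * q\<^sup>2 \<ge> \<bar>P\<bar> * \<bar>q\<bar> + \<bar>dLag i 0\<bar> * \<bar>q\<bar> - \<gamma> / 2 * (\<beta> i)\<^sup>2"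
      by (simp add: distrib_right)
    have 2: "dLag i 0 * q \<ge> - (\<bar>dLag i 0\<bar> * \<bar>q\<bar>)" by (metis abs_ge_minus_self abs_mult minus_le_iff)
    have 3: "P * \<bar>q\<bar> \<le> \<bar>P\<bar> * \<bar>q\<bar>" by (intro mult_right_mono) auto
    have 4: "Lag i q \<ge> Lag i 0 + dLag i 0 * q + \<gamma> / 2 * q\<^sup>2" using Lag_ge_quadratic[OF i, of 0 q] by simp
    have "Lag i q \<ge> P * \<bar>q\<bar> - c i" unfolding c_def using 1 2 3 4 by linarith
    moreover have "c i \<le> (\<Sum>i\<in>I. c i)" using c0 i by (intro member_le_sum) auto
    ultimately show "Lag i q \<ge> P * \<bar>q\<bar> - (\<Sum>i\<in>I. c i)" by linarith
  qed
qed

text \<open>Continuity of the second derivative enters here, through its bound on a compact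
  interval. This upper bound is what allows a line cost to be touched from above by a quadratic
  function.\<close>

lemma Lag_le_quadratic:
  assumes i: "i \<in> I"
  obtains M where "M \<ge> 0"
    "\<And>q0 q. \<bar>q0\<bar> \<le> R \<Longrightarrow> \<bar>q\<bar> \<le> R \<Longrightarrow> Lag i q \<le> Lag i q0 + dLag i q0 * (q - q0) + M * (q - q0)\<^sup>2"
proof -
  have "compact (ddLag i ` {-\<bar>R\<bar>..\<bar>R\<bar>})"
    by (intro compact_continuous_image continuous_on_subset[OF ddLag_cont[OF i]]) auto
  then obtain B where B: "\<And>x. x \<in> {-\<bar>R\<bar>..\<bar>R\<bar>} \<Longrightarrow> \<bar>ddLag i x\<bar> \<le> B"
    by (metis bounded_iff compact_imp_bounded imageI real_norm_def)
  show thesis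
  proof (rule that)
    show "\<bar>B\<bar> \<ge> 0" by simp
    fix q0 q assume b: "\<bar>q0\<bar> \<le> R" "\<bar>q\<bar> \<le> R"
    obtain \<xi> where x: "min q0 q \<le> \<xi>" "\<xi> \<le> max q0 q"
      and eq: "Lag i q = Lag i q0 + dLag i q0 * (q - q0) + ddLag i \<xi> / 2 * (q - q0)\<^sup>2"
      using Lag_taylor[OF i] by blast
    have "\<bar>ddLag i \<xi>\<bar> \<le> B" using x b by (intro B) auto
    then have "ddLag i \<xi> / 2 * (q - q0)\<^sup>2 \<le> \<bar>B\<bar> * (q - q0)\<^sup>2"
      by (intro mult_right_mono) auto
    then show "Lag i q \<le> Lag i q0 + dLag i q0 * (q - q0) + \<bar>B\<bar> * (q - q0)\<^sup>2"
      using eq by linarith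
  qed
qed

abbreviation l0 :: real where "l0 \<equiv> L0 N Lag 0"

lemma l0_le: "i \<in> I \<Longrightarrow> l0 \<le> Lag i 0"
  by (simp add: L0_eq)

lemma l0_attained: obtains i where "i \<in> I" "l0 = Lag i 0"
proof -
  have "l0 \<in> (\<lambda>j. Lag j 0) ` I" unfolding L0_eq using I_nonempty by (intro Min_in) auto
  then show thesis using that by auto
qed

text \<open>The perspective of the Lagrangian: the cost of covering the distance \<open>x\<close> in time \<open>\<tau>\<close> at constant speed.\<close>

definition line_cost :: "nat \<Rightarrow> real \<Rightarrow> real \<Rightarrow> real" where
  "line_cost i \<tau> x = \<tau> * Lag i (x / \<tau>)"

text \<open>\<open>line_cost i\<close> is positively homogeneous of degree 1 and convex, so its
  tangent plane along the ray x = q * \<tau> is linear. Its slopes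
  \<open>Lag i q - q * dLag i q\<close> and \<open>dLag i q\<close> reappear as time and space
  derivatives in the viscosity tests.\<close>

lemma line_cost_ge_tangent:
  assumes "i \<in> I" "\<tau> > 0"
  shows "line_cost i \<tau> x \<ge> \<tau> * (Lag i q - q * dLag i q) + dLag i q * x"
proof -
  have "\<tau> * (Lag i q + dLag i q * (x / \<tau> - q)) \<le> line_cost i \<tau> x"
    unfolding line_cost_def using assms by (intro mult_left_mono Lag_ge_tangent) auto
  then show ?thesis using assms by (simp add: algebra_simps)
qed

lemma line_cost_speed: "\<tau> > 0 \<Longrightarrow> line_cost i \<tau> (q * \<tau>) = \<tau> * Lag i q"
  by (simp add: line_cost_def)

lemma line_cost_coercive:
  assumes "i \<in> I" "\<tau> > 0" "\<And>q. Lag i q \<ge> P * \<bar>q\<bar> - C"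
  shows "line_cost i \<tau> x \<ge> P * \<bar>x\<bar> - C * \<tau>"
proof -
  have "\<tau> * (P * \<bar>x / \<tau>\<bar> - C) \<le> line_cost i \<tau> x"
    unfolding line_cost_def using assms(2) by (intro mult_left_mono assms(3)) auto
  also have "\<tau> * (P * \<bar>x / \<tau>\<bar> - C) = P * \<bar>x\<bar> - C * \<tau>"
    using assms(2) by (simp add: right_diff_distrib abs_divide)
  finally show ?thesis .
qed

lemma line_cost_le_quadratic:
  assumes "i \<in> I" "\<tau> > 0" "M \<ge> 0"
    and "Lag i (x / \<tau>) \<le> Lag i q + dLag i q * (x / \<tau> - q) + M * (x / \<tau> - q)\<^sup>2"
  shows "line_cost i \<tau> x \<le> \<tau> * (Lag i q - q * dLag i q) + dLag i q * x + M / \<tau> * (x - q * \<tau>)\<^sup>2"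
proof -
  have "line_cost i \<tau> x \<le> \<tau> * (Lag i q + dLag i q * (x / \<tau> - q) + M * (x / \<tau> - q)\<^sup>2)"
    unfolding line_cost_def using assms by (intro mult_left_mono) auto
  also have "\<dots> = \<tau> * (Lag i q - q * dLag i q) + dLag i q * (\<tau> * (x / \<tau>)) + M / \<tau> * (\<tau> * (x / \<tau> - q))\<^sup>2"
    using assms(2) by (simp add: algebra_simps power2_eq_square)
  also have "\<tau> * (x / \<tau> - q) = x - q * \<tau>" using assms(2) by (simp add: algebra_simps)
  finally show ?thesis using assms(2) by simp
qed

text \<open>Both costs on the right lie above the tangent plane at the common mean speed, and the
  cost on the left lies in it. So merging consecutive lines in one branch never costs more.\<close>

lemma line_cost_add:
  assumes "i \<in> I" "\<tau> > 0" "\<sigma> > 0"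
  shows "line_cost i (\<tau> + \<sigma>) (x + y) \<le> line_cost i \<tau> x + line_cost i \<sigma> y"
proof -
  define q where "q = (x + y) / (\<tau> + \<sigma>)"
  have q: "x + y = q * (\<tau> + \<sigma>)" using assms by (simp add: q_def)
  have "line_cost i (\<tau> + \<sigma>) (x + y) = (\<tau> + \<sigma>) * Lag i q"
    using assms line_cost_speed[of "\<tau> + \<sigma>" i q] q by simp
  also have "\<dots> = (\<tau> * (Lag i q - q * dLag i q) + dLag i q * x) + (\<sigma> * (Lag i q - q * dLag i q) + dLag i q * y)"
    using arg_cong[OF q, of "\<lambda>z. dLag i q * z"] by (simp add: algebra_simps)
  also have "\<dots> \<le> line_cost i \<tau> x + line_cost i \<sigma> y"
    using assms by (intro add_mono line_cost_ge_tangent) auto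
  finally show ?thesis .
qed

lemma line_cost_continuous:
  assumes "i \<in> I"
  shows "continuous_on ({0<..} \<times> UNIV) (\<lambda>(\<tau>, x). line_cost i \<tau> x)"
proof -
  have "continuous_on ({0<..} \<times> UNIV) (\<lambda>z. Lag i (snd z / fst z))"
    by (rule continuous_on_compose2[OF Lag_continuous[OF assms, of UNIV]]) (auto intro!: continuous_intros)
  then show ?thesis unfolding line_cost_def case_prod_unfold by (intro continuous_intros)
qed

subsection \<open>Hamiltonians\<close>

text \<open>The \<open>SUP\<close> in \<open>Ham\<close> is taken in the reals and carries
  information only for bounded sets; superlinearity with slope |p| provides the bound.\<close>

lemma Ham_bdd_above:
  assumes i: "i \<in> I" shows "bdd_above (range (\<lambda>q. p * q - Lag i q))"
proof -
  obtain C where C: "\<And>j q. j \<in> I \<Longrightarrow> Lag j q \<ge> \<bar>p\<bar> * \<bar>q\<bar> - C"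
    using Lag_superlinear by blast
  have "p * q - Lag i q \<le> C" for q
    using C[OF i, of q] abs_ge_self[of "p * q"] by (simp add: abs_mult)
  then show ?thesis by (intro bdd_aboveI2)
qed

lemma Ham_ge: "i \<in> I \<Longrightarrow> p * q - Lag i q \<le> Ham Lag i p"
  unfolding Ham_def by (rule cSUP_upper[OF _ Ham_bdd_above]) auto

lemma Ham_le: "(\<And>q. p * q - Lag i q \<le> c) \<Longrightarrow> Ham Lag i p \<le> c"
  unfolding Ham_def by (rule cSUP_least) auto

lemma Ham_minus_ge: "i \<in> I \<Longrightarrow> q \<le> 0 \<Longrightarrow> p * q - Lag i q \<le> Ham_minus Lag i p"
  unfolding Ham_minus_def
  by (rule cSUP_upper[OF _ bdd_above_mono[OF Ham_bdd_above]]) auto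

lemma Ham_minus_le: "(\<And>q. q \<le> 0 \<Longrightarrow> p * q - Lag i q \<le> c) \<Longrightarrow> Ham_minus Lag i p \<le> c"
  unfolding Ham_minus_def by (rule cSUP_least) auto

text \<open>The tangent at q shows that the supremum at the momentum \<open>dLag i q\<close> is
  attained at the speed q.\<close>

lemma Ham_dLag: "i \<in> I \<Longrightarrow> Ham Lag i (dLag i q) \<le> q * dLag i q - Lag i q"
proof (rule Ham_le)
  fix r assume "i \<in> I"
  from Lag_ge_tangent[OF this, of q r] show "dLag i q * r - Lag i r \<le> q * dLag i q - Lag i q"
    by (simp add: algebra_simps)
qed

subsection \<open>Coordinates on the junction\<close>

lemma branch_scaleR: "s \<ge> 0 \<Longrightarrow> s *\<^sub>R e i \<in> branch e i"
  by (auto simp: branch_def)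

lemma scaleR_in_J: "i \<in> I \<Longrightarrow> s \<ge> 0 \<Longrightarrow> s *\<^sub>R e i \<in> J"
  by (auto simp: junction_def branch_def I_eq)

lemma J_cases:
  assumes "x \<in> J" obtains i s where "i \<in> I" "s \<ge> 0" "x = s *\<^sub>R e i"
  using assms by (auto simp: junction_def branch_def I_eq)

lemma zero_in_J: "0 \<in> J"
  using scaleR_in_J[OF one_in_I, of 0] by simp

lemma norm_scaleR_e: "i \<in> I \<Longrightarrow> s \<ge> 0 \<Longrightarrow> norm (s *\<^sub>R e i) = s"
  using unit by simp

lemma scaleR_e_eq_iff:
  assumes "i \<in> I" "j \<in> I" "s \<ge> 0" "r \<ge> 0"
  shows "s *\<^sub>R e i = r *\<^sub>R e j \<longleftrightarrow> s = r \<and> (s = 0 \<or> i = j)"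
proof
  assume eq: "s *\<^sub>R e i = r *\<^sub>R e j"
  then have "s = r" using norm_scaleR_e assms by metis
  moreover have "e i = e j" if "s \<noteq> 0" using eq that \<open>s = r\<close> by simp
  ultimately show "s = r \<and> (s = 0 \<or> i = j)" using distinct assms by (auto dest: inj_onD)
qed auto

lemma scaleR_in_branch_iff:
  assumes "i \<in> I" "j \<in> I" "s \<ge> 0"
  shows "s *\<^sub>R e i \<in> branch e j \<longleftrightarrow> s = 0 \<or> i = j"
  using scaleR_e_eq_iff[OF assms(1,2,3)] assms(3) by (auto simp: branch_def)

lemma scaleR_in_branch_star_iff:
  assumes "i \<in> I" "j \<in> I" "s \<ge> 0"
  shows "s *\<^sub>R e i \<in> branch_star e j \<longleftrightarrow> s > 0 \<and> i = j"
proof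
  assume "s *\<^sub>R e i \<in> branch_star e j"
  then obtain r where "r > 0" "s *\<^sub>R e i = r *\<^sub>R e j" by (auto simp: branch_star_def)
  then show "s > 0 \<and> i = j" using scaleR_e_eq_iff[OF assms, of r] by auto
qed (auto simp: branch_star_def)

lemma jdist_same:
  assumes "i \<in> I" "s \<ge> 0" "r \<ge> 0" shows "jdist N e (s *\<^sub>R e i) (r *\<^sub>R e i) = \<bar>s - r\<bar>"
proof -
  have "norm (s *\<^sub>R e i - r *\<^sub>R e i) = \<bar>s - r\<bar>"
    using unit[OF assms(1)] by (simp add: scaleR_diff_left[symmetric])
  moreover have "\<exists>k\<in>I. s *\<^sub>R e i \<in> branch e k \<and> r *\<^sub>R e i \<in> branch e k"
    using assms branch_scaleR by blast
  ultimately show ?thesis by (simp only: jdist_eq if_True)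
qed

lemma jdist_diff:
  assumes "i \<in> I" "j \<in> I" "s \<ge> 0" "r \<ge> 0" "i \<noteq> j"
  shows "jdist N e (s *\<^sub>R e i) (r *\<^sub>R e j) = s + r"
proof (cases "\<exists>k\<in>I. s *\<^sub>R e i \<in> branch e k \<and> r *\<^sub>R e j \<in> branch e k")
  case True
  then have "s = 0 \<or> r = 0" using assms scaleR_in_branch_iff by metis
  then have "norm (s *\<^sub>R e i - r *\<^sub>R e j) = s + r" using norm_scaleR_e assms by auto
  then show ?thesis using True by (simp only: jdist_eq if_True)
next
  case False
  then have "jdist N e (s *\<^sub>R e i) (r *\<^sub>R e j) = norm (s *\<^sub>R e i) + norm (r *\<^sub>R e j)"
    by (simp only: jdist_eq if_False)
  then show ?thesis using norm_scaleR_e[OF assms(1,3)] norm_scaleR_e[OF assms(2,4)] by (simp only:)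
qed

lemma pdist_same:
  "i \<in> I \<Longrightarrow> s \<ge> 0 \<Longrightarrow> r \<ge> 0 \<Longrightarrow> pdist N e (t, s *\<^sub>R e i) (t', r *\<^sub>R e i) = dist (t, s) (t', r)"
  by (simp add: pdist_def jdist_same dist_Pair_Pair dist_real_def)

lemma pdist_diff:
  "i \<in> I \<Longrightarrow> j \<in> I \<Longrightarrow> s \<ge> 0 \<Longrightarrow> r \<ge> 0 \<Longrightarrow> i \<noteq> j \<Longrightarrow>
   pdist N e (t, s *\<^sub>R e i) (t', r *\<^sub>R e j) = sqrt ((t - t')\<^sup>2 + (s + r)\<^sup>2)"
  by (simp add: pdist_def jdist_diff)

lemma pdist_zero:
  "i \<in> I \<Longrightarrow> s \<ge> 0 \<Longrightarrow> pdist N e (t, s *\<^sub>R e i) (t', 0) = dist (t, s) (t', 0)"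
  using pdist_same[of i s 0 t t'] by simp

lemma pdist_ge_time: "\<bar>t - t'\<bar> \<le> pdist N e (t, x) (t', y)"
  unfolding pdist_def by (simp add: real_le_rsqrt)

lemma pdist_ge_norm: "x \<in> J \<Longrightarrow> y \<in> J \<Longrightarrow> \<bar>norm x - norm y\<bar> \<le> pdist N e (t, x) (t', y)"
proof -
  have "\<bar>norm x - norm y\<bar> \<le> jdist N e x y"
    unfolding jdist_eq using norm_triangle_ineq3[of x y] by (auto simp: abs_le_iff)
  moreover have "jdist N e x y \<le> pdist N e (t, x) (t', y)"
    unfolding pdist_def by (rule real_le_rsqrt) simp
  ultimately show ?thesis by linarith
qed

lemma u0_lipschitz_branch:
  assumes "i \<in> I" "s \<ge> 0" "r \<ge> 0" shows "\<bar>u0 (s *\<^sub>R e i) - u0 (r *\<^sub>R e i)\<bar> \<le> K * \<bar>s - r\<bar>"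
  using lip[OF scaleR_in_J[OF assms(1,2)] scaleR_in_J[OF assms(1,3)]] jdist_same[OF assms] by simp

lemma u0_growth:
  assumes "i \<in> I" "s \<ge> 0" shows "\<bar>u0 (s *\<^sub>R e i) - u0 0\<bar> \<le> K * s"
  using u0_lipschitz_branch[OF assms, of 0] assms by simp


subsection \<open>Quadratic test functions\<close>

text \<open>Extension by 0 to the other branches is continuous on the junction, so a test function
  with different slopes on the branches can be written as one sum.\<close>

definition coord :: "nat \<Rightarrow> real^2 \<Rightarrow> real" where
  "coord j x = (if x \<in> branch e j then norm x else 0)"

lemma coord_scaleR:
  "i \<in> I \<Longrightarrow> j \<in> I \<Longrightarrow> s \<ge> 0 \<Longrightarrow> coord j (s *\<^sub>R e i) = (if i = j then s else 0)"
  using scaleR_in_branch_iff norm_scaleR_e by (auto simp: coord_def)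

lemma closed_branch: "i \<in> I \<Longrightarrow> closed (branch e i)"
proof -
  assume i: "i \<in> I"
  have "branch e i = {x. x = norm x *\<^sub>R e i}"
    using norm_scaleR_e[OF i] by (auto simp: branch_def simp del: norm_scaleR)
  also have "closed \<dots>" by (intro closed_Collect_eq continuous_intros)
  finally show ?thesis .
qed

lemma continuous_coord: 
  assumes j: "j \<in> I" shows "continuous_on J (coord j)"
proof -
  have "continuous_on (\<Union>i\<in>I. branch e i) (coord j)"
  proof (rule continuous_on_closed_Union)
    fix i assume i: "i \<in> I"
    show "continuous_on (branch e i) (coord j)"
    proof (cases "i = j")
      case True
      have "continuous_on (branch e i) norm" by (intro continuous_intros)
      then show ?thesis by (rule continuous_on_eq) (simp add: True coord_def)
    next
      case False
      have "continuous_on (branch e i) (\<lambda>_. 0::real)" by (intro continuous_intros)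
      then show ?thesis
        by (rule continuous_on_eq) (use False i j coord_scaleR in \<open>auto simp: branch_def\<close>)
    qed
  qed (use closed_branch in auto)
  then show ?thesis by (simp add: junction_def I_eq)
qed

text \<open>Slopes and curvatures in space are free on each branch, while the time part is shared,
  as it must be for the values to agree at the vertex.\<close>

definition qtest :: "real \<Rightarrow> real \<Rightarrow> real \<Rightarrow> real \<Rightarrow> (nat \<Rightarrow> real) \<Rightarrow> (nat \<Rightarrow> real) \<Rightarrow> real \<Rightarrow> real^2 \<Rightarrow> real" where
  "qtest a k t0 c \<alpha> \<beta> t x = c + a * (t - t0) + k * (t - t0)\<^sup>2
     + (\<Sum>j\<in>I. \<alpha> j * coord j x + \<beta> j * (coord j x)\<^sup>2)"

lemma qtest_scaleR:
  assumes "i \<in> I" "s \<ge> 0"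
  shows "qtest a k t0 c \<alpha> \<beta> t (s *\<^sub>R e i) = c + a * (t - t0) + k * (t - t0)\<^sup>2 + (\<alpha> i * s + \<beta> i * s\<^sup>2)"
proof -
  have "(\<Sum>j\<in>I. \<alpha> j * coord j (s *\<^sub>R e i) + \<beta> j * (coord j (s *\<^sub>R e i))\<^sup>2)
      = (\<Sum>j\<in>I. if i = j then \<alpha> j * s + \<beta> j * s\<^sup>2 else 0)"
    using coord_scaleR[OF assms(1) _ assms(2)] by (intro sum.cong) auto
  also have "\<dots> = \<alpha> i * s + \<beta> i * s\<^sup>2" using assms by (simp add: sum.delta')
  finally show ?thesis by (simp add: qtest_def)
qed

lemma C1_star_qtest:
  "C1_star N e T (qtest a k t0 c \<alpha> \<beta>) (\<lambda>i t s. a + 2 * k * (t - t0)) (\<lambda>i t s. \<alpha> i + 2 * \<beta> i * s)"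
proof -
  have cc: "continuous_on (JT N e T) (\<lambda>z. coord j (snd z))" if "j \<in> I" for j
    by (rule continuous_on_compose2[OF continuous_coord[OF that]]) (auto intro!: continuous_intros simp: JT_def)
  have 1: "continuous_on (JT N e T) (\<lambda>(t, x). qtest a k t0 c \<alpha> \<beta> t x)"
    unfolding qtest_def case_prod_unfold by (intro continuous_intros cc) auto
  have 2: "((\<lambda>(\<tau>, \<sigma>). qtest a k t0 c \<alpha> \<beta> \<tau> (\<sigma> *\<^sub>R e i)) has_derivative
      (\<lambda>(h, y). (a + 2 * k * (t - t0)) * h + (\<alpha> i + 2 * \<beta> i * s) * y))
      (at (t, s) within ({0<..<T} \<times> {0..}))"
    if i: "i \<in> I" and ts: "0 < t" "t < T" "0 \<le> s" for i t s
  proof (rule has_derivative_transform)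
    show "((\<lambda>z. c + a * (fst z - t0) + k * (fst z - t0)\<^sup>2 + (\<alpha> i * snd z + \<beta> i * (snd z)\<^sup>2)) has_derivative
      (\<lambda>(h, y). (a + 2 * k * (t - t0)) * h + (\<alpha> i + 2 * \<beta> i * s) * y))
      (at (t, s) within ({0<..<T} \<times> {0..}))"
      by (auto intro!: derivative_eq_intros simp: fun_eq_iff algebra_simps)
  qed (use ts in \<open>auto simp: qtest_scaleR[OF i]\<close>)
  show ?thesis unfolding C1_star_def I_eq[symmetric]
    using 1 2 by (auto simp: case_prod_unfold intro!: continuous_intros)
qed

subsection \<open>Semijets\<close>

text \<open>A path to another branch passes through the vertex and has length at least x, so a ball
  of radius at most x stays in the branch.\<close>

lemma near_interior:
  assumes i: "i \<in> I" and x: "x > 0" and r: "r \<le> x" and Q: "snd Q \<in> J"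
    and d: "pdist N e Q (t, x *\<^sub>R e i) < r"
  obtains t' x' where "Q = (t', x' *\<^sub>R e i)" "x' \<ge> 0" "\<bar>t' - t\<bar> < r" "\<bar>x' - x\<bar> < r"
proof -
  obtain j s where j: "j \<in> I" "s \<ge> 0" and sQ: "snd Q = s *\<^sub>R e j" using J_cases[OF Q] .
  have Qe: "Q = (fst Q, s *\<^sub>R e j)" using sQ by (metis prod.collapse)
  have "j = i"
  proof (rule ccontr)
    assume "j \<noteq> i"
    then have "pdist N e Q (t, x *\<^sub>R e i) = sqrt ((fst Q - t)\<^sup>2 + (s + x)\<^sup>2)"
      using pdist_diff[of j i s x "fst Q" t] j i x Qe by simp
    moreover have "x \<le> sqrt ((fst Q - t)\<^sup>2 + (s + x)\<^sup>2)"
    proof (rule real_le_rsqrt)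
      have "x\<^sup>2 \<le> (s + x)\<^sup>2" using x j by (intro power_mono) auto
      then show "x\<^sup>2 \<le> (fst Q - t)\<^sup>2 + (s + x)\<^sup>2" using zero_le_power2[of "fst Q - t"] by linarith
    qed
    ultimately show False using d r by simp
  qed
  then have Qe': "Q = (fst Q, s *\<^sub>R e i)" using Qe by simp
  then have "dist (fst Q, s) (t, x) < r" using pdist_same[of i s x "fst Q" t] i j x d by simp
  then have "\<bar>fst Q - t\<bar> < r" "\<bar>s - x\<bar> < r"
    using dist_fst_le[of "(fst Q, s)" "(t, x)"] dist_snd_le[of "(fst Q, s)" "(t, x)"]
    by (auto simp: dist_real_def)
  then show thesis using that Qe' j by blast
qed

lemma near_vertex:
  assumes Q: "snd Q \<in> J" and d: "pdist N e Q (t, 0) < r"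
  obtains j t' x' where "j \<in> I" "Q = (t', x' *\<^sub>R e j)" "x' \<ge> 0" "\<bar>t' - t\<bar> < r" "x' < r"
proof -
  obtain j s where j: "j \<in> I" "s \<ge> 0" and sQ: "snd Q = s *\<^sub>R e j" using J_cases[OF Q] .
  have Qe: "Q = (fst Q, s *\<^sub>R e j)" using sQ by (metis prod.collapse)
  then have "dist (fst Q, s) (t, 0) < r" using pdist_zero[of j s "fst Q" t] j d by simp
  then have "\<bar>fst Q - t\<bar> < r" "s < r"
    using dist_fst_le[of "(fst Q, s)" "(t, 0)"] dist_snd_le[of "(fst Q, s)" "(t, 0)"] j
    by (auto simp: dist_real_def)
  then show thesis using that Qe j by blast
qed

text \<open>A one-sided expansion with quadratic error of any size k is a touching
  \<open>qtest\<close>. With this and its three companions the comparison arguments never have to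
  construct a \<open>C1_star\<close> function.\<close>

lemma visc_sub_jet:
  assumes u: "visc_sub N e Lag T w u" and t: "0 < t" "t < T" and i: "i \<in> I" and x: "x > 0" and r: "r > 0"
    and le: "\<And>t' x'. 0 < t' \<Longrightarrow> t' < T \<Longrightarrow> 0 \<le> x' \<Longrightarrow> \<bar>t' - t\<bar> < r \<Longrightarrow> \<bar>x' - x\<bar> < r \<Longrightarrow>
      u t' (x' *\<^sub>R e i) \<le> u t (x *\<^sub>R e i) + a * (t' - t) + p * (x' - x) + k * ((t' - t)\<^sup>2 + (x' - x)\<^sup>2)"
  shows "a + Ham Lag i p \<le> 0"
proof -
  \<comment> \<open>The expansion is centred at x and \<open>qtest\<close> at the vertex;
    multiplying out the square shifts the slope by 2 * k * x and the constant accordingly.\<close>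
  define \<phi> where "\<phi> = qtest a k t (u t (x *\<^sub>R e i) - p * x + k * x\<^sup>2) (\<lambda>j. p - 2 * k * x) (\<lambda>j. k)"
  have \<phi>: "\<phi> t' (x' *\<^sub>R e i) = u t (x *\<^sub>R e i) + a * (t' - t) + p * (x' - x) + k * ((t' - t)\<^sup>2 + (x' - x)\<^sup>2)"
    if "x' \<ge> 0" for t' x'
    unfolding \<phi>_def qtest_scaleR[OF i that] by (simp add: algebra_simps power2_eq_square)
  have "touch_above N e T \<phi> u (t, x *\<^sub>R e i)"
    unfolding touch_above_def fst_conv snd_conv
  proof (intro conjI exI[of _ "min r x"] ballI impI)
    show "u t (x *\<^sub>R e i) = \<phi> t (x *\<^sub>R e i)" using \<phi>[of x t] x by simp
    fix Q assume Q: "Q \<in> JT N e T" "pdist N e Q (t, x *\<^sub>R e i) < min r x"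
    then have SQ: "snd Q \<in> J" by (auto simp: JT_def)
    obtain t' x' where "Q = (t', x' *\<^sub>R e i)" "x' \<ge> 0" "\<bar>t' - t\<bar> < min r x" "\<bar>x' - x\<bar> < min r x"
      using near_interior[OF i x min.cobounded2 _ Q(2)] SQ by blast
    then show "u (fst Q) (snd Q) \<le> \<phi> (fst Q) (snd Q)" using le[of t' x'] Q(1) \<phi>[of x' t'] by (simp add: JT_def)
  qed (use r x in auto)
  then have "a + 2 * k * (t - t) + Ham Lag i (p - 2 * k * x + 2 * k * x) \<le> 0"
    using u C1_star_qtest[of T a k t "u t (x *\<^sub>R e i) - p * x + k * x\<^sup>2" "\<lambda>j. p - 2 * k * x" "\<lambda>j. k"] t i x
    unfolding visc_sub_def \<phi>_def I_eq[symmetric] by blast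
  then show ?thesis by simp
qed

lemma visc_super_jet:
  assumes u: "visc_super N e Lag T w u" and t: "0 < t" "t < T" and i: "i \<in> I" and x: "x > 0" and r: "r > 0"
    and ge: "\<And>t' x'. 0 < t' \<Longrightarrow> t' < T \<Longrightarrow> 0 \<le> x' \<Longrightarrow> \<bar>t' - t\<bar> < r \<Longrightarrow> \<bar>x' - x\<bar> < r \<Longrightarrow>
      u t' (x' *\<^sub>R e i) \<ge> u t (x *\<^sub>R e i) + a * (t' - t) + p * (x' - x) - k * ((t' - t)\<^sup>2 + (x' - x)\<^sup>2)"
  shows "a + Ham Lag i p \<ge> 0"
proof -
  define \<phi> where "\<phi> = qtest a (-k) t (u t (x *\<^sub>R e i) - p * x - k * x\<^sup>2) (\<lambda>j. p + 2 * k * x) (\<lambda>j. -k)"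
  have \<phi>: "\<phi> t' (x' *\<^sub>R e i) = u t (x *\<^sub>R e i) + a * (t' - t) + p * (x' - x) - k * ((t' - t)\<^sup>2 + (x' - x)\<^sup>2)"
    if "x' \<ge> 0" for t' x'
    unfolding \<phi>_def qtest_scaleR[OF i that] by (simp add: algebra_simps power2_eq_square)
  have "touch_below N e T \<phi> u (t, x *\<^sub>R e i)"
    unfolding touch_below_def fst_conv snd_conv
  proof (intro conjI exI[of _ "min r x"] ballI impI)
    show "u t (x *\<^sub>R e i) = \<phi> t (x *\<^sub>R e i)" using \<phi>[of x t] x by simp
    fix Q assume Q: "Q \<in> JT N e T" "pdist N e Q (t, x *\<^sub>R e i) < min r x"
    then have SQ: "snd Q \<in> J" by (auto simp: JT_def)
    obtain t' x' where "Q = (t', x' *\<^sub>R e i)" "x' \<ge> 0" "\<bar>t' - t\<bar> < min r x" "\<bar>x' - x\<bar> < min r x"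
      using near_interior[OF i x min.cobounded2 _ Q(2)] SQ by blast
    then show "\<phi> (fst Q) (snd Q) \<le> u (fst Q) (snd Q)" using ge[of t' x'] Q(1) \<phi>[of x' t'] by (simp add: JT_def)
  qed (use r x in auto)
  then have "0 \<le> a + 2 * (-k) * (t - t) + Ham Lag i (p + 2 * k * x + 2 * (-k) * x)"
    using u C1_star_qtest[of T a "-k" t "u t (x *\<^sub>R e i) - p * x - k * x\<^sup>2" "\<lambda>j. p + 2 * k * x" "\<lambda>j. -k"] t i x
    unfolding visc_super_def \<phi>_def I_eq[symmetric] by blast
  then show ?thesis by simp
qed

lemma visc_sub_jet_vertex:
  assumes u: "visc_sub N e Lag T w u" and t: "0 < t" "t < T" and r: "r > 0"
    and le: "\<And>j t' x'. j \<in> I \<Longrightarrow> 0 < t' \<Longrightarrow> t' < T \<Longrightarrow> 0 \<le> x' \<Longrightarrow> \<bar>t' - t\<bar> < r \<Longrightarrow> x' < r \<Longrightarrow>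
      u t' (x' *\<^sub>R e j) \<le> u t 0 + a * (t' - t) + p j * x' + k * ((t' - t)\<^sup>2 + x'\<^sup>2)"
    and i: "i \<in> I"
  shows "a + Ham_minus Lag i (p i) \<le> 0"
proof -
  define \<phi> where "\<phi> = qtest a k t (u t 0) p (\<lambda>j. k)"
  have \<phi>: "\<phi> t' (x' *\<^sub>R e j) = u t 0 + a * (t' - t) + p j * x' + k * ((t' - t)\<^sup>2 + x'\<^sup>2)"
    if "j \<in> I" "x' \<ge> 0" for j t' x'
    unfolding \<phi>_def qtest_scaleR[OF that] by (simp add: algebra_simps)
  have "touch_above N e T \<phi> u (t, 0)"
    unfolding touch_above_def fst_conv snd_conv
  proof (intro conjI exI[of _ r] ballI impI)
    show "u t 0 = \<phi> t 0" using \<phi>[of i 0 t] i by simp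
    fix Q assume Q: "Q \<in> JT N e T" "pdist N e Q (t, 0) < r"
    then have SQ: "snd Q \<in> J" by (auto simp: JT_def)
    obtain j t' x' where "j \<in> I" "Q = (t', x' *\<^sub>R e j)" "x' \<ge> 0" "\<bar>t' - t\<bar> < r" "x' < r"
      using near_vertex[OF SQ Q(2)] by blast
    then show "u (fst Q) (snd Q) \<le> \<phi> (fst Q) (snd Q)" using le[of j t' x'] Q(1) \<phi>[of j x' t'] by (simp add: JT_def)
  qed (use r in auto)
  then have "a + 2 * k * (t - t) + Max ((\<lambda>i. Ham_minus Lag i (p i + 2 * k * 0)) ` I) \<le> 0"
    using u C1_star_qtest[of T a k t "u t 0" p "\<lambda>j. k"] t
    unfolding visc_sub_def \<phi>_def I_eq[symmetric] by blast
  moreover have "Ham_minus Lag i (p i) \<le> Max ((\<lambda>i. Ham_minus Lag i (p i)) ` I)"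
    using i by (intro Max_ge) auto
  ultimately show ?thesis by simp
qed

lemma visc_super_jet_vertex:
  assumes u: "visc_super N e Lag T w u" and t: "0 < t" "t < T" and r: "r > 0"
    and ge: "\<And>j t' x'. j \<in> I \<Longrightarrow> 0 < t' \<Longrightarrow> t' < T \<Longrightarrow> 0 \<le> x' \<Longrightarrow> \<bar>t' - t\<bar> < r \<Longrightarrow> x' < r \<Longrightarrow>
      u t' (x' *\<^sub>R e j) \<ge> u t 0 + a * (t' - t) + p j * x' - k * ((t' - t)\<^sup>2 + x'\<^sup>2)"
  obtains i where "i \<in> I" "a + Ham_minus Lag i (p i) \<ge> 0"
proof -
  define \<phi> where "\<phi> = qtest a (-k) t (u t 0) p (\<lambda>j. -k)"
  have \<phi>: "\<phi> t' (x' *\<^sub>R e j) = u t 0 + a * (t' - t) + p j * x' - k * ((t' - t)\<^sup>2 + x'\<^sup>2)"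
    if "j \<in> I" "x' \<ge> 0" for j t' x'
    unfolding \<phi>_def qtest_scaleR[OF that] by (simp add: algebra_simps)
  have "touch_below N e T \<phi> u (t, 0)"
    unfolding touch_below_def fst_conv snd_conv
  proof (intro conjI exI[of _ r] ballI impI)
    show "u t 0 = \<phi> t 0" using \<phi>[of 1 0 t] one_in_I by simp
    fix Q assume Q: "Q \<in> JT N e T" "pdist N e Q (t, 0) < r"
    then have SQ: "snd Q \<in> J" by (auto simp: JT_def)
    obtain j t' x' where "j \<in> I" "Q = (t', x' *\<^sub>R e j)" "x' \<ge> 0" "\<bar>t' - t\<bar> < r" "x' < r"
      using near_vertex[OF SQ Q(2)] by blast
    then show "\<phi> (fst Q) (snd Q) \<le> u (fst Q) (snd Q)" using ge[of j t' x'] Q(1) \<phi>[of j x' t'] by (simp add: JT_def)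
  qed (use r in auto)
  then have "0 \<le> a + 2 * (-k) * (t - t) + Max ((\<lambda>i. Ham_minus Lag i (p i + 2 * (-k) * 0)) ` I)"
    using u C1_star_qtest[of T a "-k" t "u t 0" p "\<lambda>j. -k"] t
    unfolding visc_super_def \<phi>_def I_eq[symmetric] by blast
  then have "0 \<le> a + Max ((\<lambda>i. Ham_minus Lag i (p i)) ` I)" by simp
  moreover have "Max ((\<lambda>i. Ham_minus Lag i (p i)) ` I) \<in> (\<lambda>i. Ham_minus Lag i (p i)) ` I"
    using I_nonempty by (intro Max_in) auto
  ultimately show thesis using that by auto
qed


subsection \<open>Costs of piecewise linear trajectories\<close>

text \<open>\<open>reach i t x c\<close>: some trajectory made of finitely many lines, each within one branch, ends at time \<open>t\<close>
  at distance \<open>x\<close> on branch \<open>i\<close>, and \<open>c\<close> is its running cost plus the initial datum at its starting point.\<close>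

inductive reach :: "nat \<Rightarrow> real \<Rightarrow> real \<Rightarrow> real \<Rightarrow> bool" where
  init: "i \<in> I \<Longrightarrow> x \<ge> 0 \<Longrightarrow> reach i 0 x (u0 (x *\<^sub>R e i))"
| line: "reach i s y c \<Longrightarrow> s < t \<Longrightarrow> x \<ge> 0 \<Longrightarrow> reach i t x (c + line_cost i (t - s) (x - y))"
| turn: "reach i t 0 c \<Longrightarrow> j \<in> I \<Longrightarrow> reach j t 0 c"

definition U :: "nat \<Rightarrow> real \<Rightarrow> real \<Rightarrow> real" where
  "U i t x = Inf {c. reach i t x c}"

section \<open>A priori bounds and Lipschitz continuity of the value\<close>

lemma reach_dom: "reach i t x c \<Longrightarrow> i \<in> I \<and> t \<ge> 0 \<and> x \<ge> 0"
  by (induction rule: reach.induct) auto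

text \<open>One rate for all a priori bounds. The slope K in the lower bound matches the Lipschitz
  constant of \<open>u0\<close>, so moving gains at most B per unit of time; the upper bounds at the
  speeds 0, 1 and -1 price waiting and running at unit speed.\<close>

definition B :: real where
  "B = (SOME C. C \<ge> 0 \<and> (\<forall>i\<in>I. (\<forall>q. K * \<bar>q\<bar> - C \<le> Lag i q) \<and> Lag i 0 \<le> C \<and> Lag i 1 \<le> C \<and> Lag i (-1) \<le> C))"

lemma
  shows B_nonneg: "B \<ge> 0"
    and B_superlinear: "\<And>i q. i \<in> I \<Longrightarrow> K * \<bar>q\<bar> - B \<le> Lag i q"
    and B_ge: "\<And>i. i \<in> I \<Longrightarrow> Lag i 0 \<le> B" "\<And>i. i \<in> I \<Longrightarrow> Lag i 1 \<le> B" "\<And>i. i \<in> I \<Longrightarrow> Lag i (-1) \<le> B"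
proof -
  obtain C where C: "C \<ge> 0" "\<And>i q. i \<in> I \<Longrightarrow> Lag i q \<ge> K * \<bar>q\<bar> - C" using Lag_superlinear by blast
  define m where "m = (\<lambda>i. \<bar>Lag i 0\<bar> + \<bar>Lag i 1\<bar> + \<bar>Lag i (-1)\<bar>)"
  define D where "D = C + (\<Sum>i\<in>I. m i)"
  have m: "m i \<le> (\<Sum>i\<in>I. m i)" if "i \<in> I" for i
    using that by (intro member_le_sum) (auto simp: m_def)
  have s0: "0 \<le> (\<Sum>i\<in>I. m i)" by (intro sum_nonneg) (auto simp: m_def)
  have "D \<ge> 0 \<and> (\<forall>i\<in>I. (\<forall>q. K * \<bar>q\<bar> - D \<le> Lag i q) \<and> Lag i 0 \<le> D \<and> Lag i 1 \<le> D \<and> Lag i (-1) \<le> D)"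
  proof (intro conjI ballI allI)
    show "D \<ge> 0" using s0 C by (simp add: D_def)
    fix i assume i: "i \<in> I"
    show "K * \<bar>q\<bar> - D \<le> Lag i q" for q using C(2)[OF i, of q] s0 by (simp add: D_def)
    show "Lag i 0 \<le> D" "Lag i 1 \<le> D" "Lag i (-1) \<le> D" using m[OF i] C(1) by (auto simp: D_def m_def)
  qed
  then have "B \<ge> 0 \<and> (\<forall>i\<in>I. (\<forall>q. K * \<bar>q\<bar> - B \<le> Lag i q) \<and> Lag i 0 \<le> B \<and> Lag i 1 \<le> B \<and> Lag i (-1) \<le> B)"
    unfolding B_def by (rule someI)
  then show "B \<ge> 0" "\<And>i q. i \<in> I \<Longrightarrow> K * \<bar>q\<bar> - B \<le> Lag i q"
    "\<And>i. i \<in> I \<Longrightarrow> Lag i 0 \<le> B" "\<And>i. i \<in> I \<Longrightarrow> Lag i 1 \<le> B" "\<And>i. i \<in> I \<Longrightarrow> Lag i (-1) \<le> B" by auto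
qed

text \<open>On each line the part K * |x - y| of the running cost absorbs the change of
  \<open>u0\<close>, and only the loss B per unit of time is left.\<close>

lemma reach_lower: "reach i t x c \<Longrightarrow> c \<ge> u0 (x *\<^sub>R e i) - B * t"
proof (induction rule: reach.induct)
  case (line i s y c t x)
  have d: "i \<in> I" "y \<ge> 0" using reach_dom[OF line.hyps(1)] by auto
  have "line_cost i (t - s) (x - y) \<ge> K * \<bar>x - y\<bar> - B * (t - s)"
    using line.hyps B_superlinear d by (intro line_cost_coercive) auto
  moreover have "u0 (x *\<^sub>R e i) - u0 (y *\<^sub>R e i) \<le> K * \<bar>x - y\<bar>"
    using u0_lipschitz_branch[OF d(1) line.hyps(3) d(2)] by simp
  ultimately show ?case using line.IH by (simp add: algebra_simps)
qed auto

lemma reach_exists: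
  assumes "i \<in> I" "t \<ge> 0" "x \<ge> 0"
  obtains c where "reach i t x c" "c \<le> u0 (x *\<^sub>R e i) + B * t"
proof (cases "t = 0")
  case True
  then show thesis using that[OF _ ] reach.init[OF assms(1,3)] by simp
next
  case False
  then have "reach i t x (u0 (x *\<^sub>R e i) + line_cost i (t - 0) (x - x))"
    using assms by (intro reach.line[OF reach.init]) auto
  moreover have "t * Lag i 0 \<le> t * B" using B_ge assms by (intro mult_left_mono) auto
  ultimately show thesis using that by (simp add: line_cost_def mult.commute)
qed

lemma U_le: "reach i t x c \<Longrightarrow> U i t x \<le> c"
  unfolding U_def by (rule cInf_lower) (auto intro: bdd_belowI reach_lower)

lemma U_ge: "i \<in> I \<Longrightarrow> t \<ge> 0 \<Longrightarrow> x \<ge> 0 \<Longrightarrow> (\<And>c. reach i t x c \<Longrightarrow> m \<le> c) \<Longrightarrow> m \<le> U i t x"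
  unfolding U_def by (rule cInf_greatest) (auto elim: reach_exists)

lemma U_bounds:
  assumes "i \<in> I" "t \<ge> 0" "x \<ge> 0"
  shows "\<bar>U i t x - u0 (x *\<^sub>R e i)\<bar> \<le> B * t"
proof -
  obtain c where "reach i t x c" "c \<le> u0 (x *\<^sub>R e i) + B * t" using reach_exists[OF assms] .
  then have "U i t x \<le> u0 (x *\<^sub>R e i) + B * t" using U_le by fastforce
  moreover have "u0 (x *\<^sub>R e i) - B * t \<le> U i t x" using assms reach_lower by (intro U_ge) auto
  ultimately show ?thesis by (simp add: abs_le_iff)
qed

lemma U_0: "i \<in> I \<Longrightarrow> x \<ge> 0 \<Longrightarrow> U i 0 x = u0 (x *\<^sub>R e i)"
  using U_bounds[of i 0 x] by simp

lemma U_turn: "i \<in> I \<Longrightarrow> j \<in> I \<Longrightarrow> U i t 0 = U j t 0"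
proof -
  assume "i \<in> I" "j \<in> I"
  then have "reach i t 0 = reach j t 0" by (auto intro: reach.turn)
  then show ?thesis by (simp add: U_def)
qed

lemma U_line:
  assumes "i \<in> I" "0 \<le> s" "s < t" "x \<ge> 0" "y \<ge> 0"
  shows "U i t x \<le> U i s y + line_cost i (t - s) (x - y)"
proof -
  have "U i t x - line_cost i (t - s) (x - y) \<le> U i s y"
  proof (rule U_ge)
    fix c assume "reach i s y c"
    from U_le[OF reach.line[OF this assms(3,4)]] show "U i t x - line_cost i (t - s) (x - y) \<le> c" by simp
  qed (use assms in auto)
  then show ?thesis by simp
qed

lemma U_stay:
  assumes "i \<in> I" "0 \<le> t" "h \<ge> 0" "x \<ge> 0" shows "U i (t + h) x \<le> U i t x + B * h"
proof (cases "h = 0")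
  case False
  then have "U i (t + h) x \<le> U i t x + h * Lag i 0"
    using U_line[of i t "t + h" x x] assms by (simp add: line_cost_def)
  moreover have "h * Lag i 0 \<le> h * B" using B_ge assms by (intro mult_left_mono) auto
  ultimately show ?thesis by (simp add: mult.commute)
qed simp

text \<open>Up to time \<open>h\<close> a trajectory pays at least the change of \<open>u0\<close> minus \<open>B h\<close>, so one can as well start at time 0
  from its position at time \<open>h\<close>.\<close>

lemma reach_cut: "reach i t x c \<Longrightarrow> 0 \<le> h \<Longrightarrow> h \<le> t \<Longrightarrow> U i (t - h) x \<le> c + B * h"
proof (induction rule: reach.induct)
  case (init i x)
  then show ?case by (simp add: U_0)
next
  case (line i s y c t x)
  have d: "i \<in> I" "s \<ge> 0" "y \<ge> 0" using reach_dom[OF line.hyps(1)] by auto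
  consider "h \<le> s" | "s < h" "h < t" | "h = t" using line.prems by linarith
  then show ?case
  proof cases
    case 1
    then have "U i (t - h) x \<le> U i (s - h) y + line_cost i (t - h - (s - h)) (x - y)"
      using d line by (intro U_line) auto
    then show ?thesis using line.IH 1 line.prems by simp
  next
    case 2
    \<comment> \<open>The cut falls inside the last line, at the point z. The part before z is
      charged to \<open>reach_lower\<close>, the part after z is rerun from time 0 at the same
      speed. That z is nonnegative follows by writing (t - s) * z as a nonnegative combination of
      the end points.\<close>
    define q where "q = (x - y) / (t - s)"
    define z where "z = y + q * (h - s)"
    have xy: "x - y = q * (t - s)" using line.hyps by (simp add: q_def)
    have xz: "x - z = q * (t - h)" using xy by (simp add: z_def algebra_simps)
    have "(t - s) * z = y * (t - h) + x * (h - s)"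
      using arg_cong[OF xy, of "\<lambda>r. r * (h - s)"] by (simp add: z_def algebra_simps)
    moreover have "y * (t - h) + x * (h - s) \<ge> 0" using d line 2 by (intro add_nonneg_nonneg mult_nonneg_nonneg) auto
    ultimately have z: "z \<ge> 0" using line.hyps by (metis diff_gt_0_iff_gt zero_le_mult_iff not_less_iff_gr_or_eq not_le)
    have "reach i h z (c + line_cost i (h - s) (z - y))"
      using line.hyps 2 z by (intro reach.line) auto
    from reach_lower[OF this] have 1: "u0 (z *\<^sub>R e i) - B * h \<le> c + (h - s) * Lag i q"
      using 2 line_cost_speed[of "h - s" i q] by (simp add: z_def)
    have "U i (t - h) x \<le> U i 0 z + line_cost i (t - h - 0) (x - z)"
      using d z line.hyps 2 by (intro U_line) auto
    then have "U i (t - h) x \<le> u0 (z *\<^sub>R e i) + (t - h) * Lag i q"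
      using 2 line_cost_speed[of "t - h" i q] xz U_0[OF d(1) z] by simp
    moreover have "line_cost i (t - s) (x - y) = (t - s) * Lag i q"
      using line.hyps line_cost_speed[of "t - s" i q] xy by simp
    ultimately show ?thesis using 1 by (simp add: algebra_simps)
  next
    case 3
    have "reach i t x (c + line_cost i (t - s) (x - y))" using line.hyps by (rule reach.line)
    from reach_lower[OF this] show ?thesis using 3 U_0[OF d(1) line.hyps(3)] by simp
  qed
next
  case (turn i t c j)
  then show ?case using U_turn[of i j "t - h"] reach_dom[OF turn.hyps(1)] by simp
qed

lemma U_time_lower:
  assumes "i \<in> I" "0 \<le> t" "h \<ge> 0" "x \<ge> 0" shows "U i t x \<le> U i (t + h) x + B * h"
proof -
  have "U i t x - B * h \<le> U i (t + h) x"
  proof (rule U_ge)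
    fix c assume "reach i (t + h) x c"
    from reach_cut[OF this, of h] show "U i t x - B * h \<le> c" using assms by simp
  qed (use assms in auto)
  then show ?thesis by simp
qed

lemma U_time_lipschitz:
  assumes "i \<in> I" "0 \<le> t" "0 \<le> s" "x \<ge> 0" shows "\<bar>U i t x - U i s x\<bar> \<le> B * \<bar>t - s\<bar>"
proof (cases "s \<le> t")
  case True
  then show ?thesis using U_time_lower[of i s "t - s" x] U_stay[of i s "t - s" x] assms by (simp add: abs_le_iff)
next
  case False
  then show ?thesis using U_time_lower[of i t "s - t" x] U_stay[of i t "s - t" x] assms by (simp add: abs_le_iff)
qed

text \<open>Running from y to x at unit speed takes the time |x - y| and costs at most B times that;
  the remaining time shift is covered by the Lipschitz bound in time. Each contributes once, hence
  the factor 2.\<close>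

lemma U_le_lipschitz:
  assumes "i \<in> I" "0 \<le> t" "0 \<le> s" "x \<ge> 0" "y \<ge> 0"
  shows "U i t x \<le> U i s y + 2 * B * (\<bar>t - s\<bar> + \<bar>x - y\<bar>)"
proof -
  define h where "h = \<bar>x - y\<bar>"
  have 1: "U i (s + h) x \<le> U i s y + B * h"
  proof (cases "h = 0")
    case False
    then have h: "h > 0" by (simp add: h_def)
    have "line_cost i h (x - y) = h * Lag i 1 \<or> line_cost i h (x - y) = h * Lag i (-1)"
      using line_cost_speed[OF h, of i 1] line_cost_speed[OF h, of i "-1"]
      by (cases "x \<ge> y") (auto simp: h_def)
    moreover have "h * Lag i 1 \<le> h * B" "h * Lag i (-1) \<le> h * B"
      using B_ge assms h by (auto intro: mult_left_mono)
    ultimately have "line_cost i h (x - y) \<le> B * h" by (auto simp: mult.commute)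
    then show ?thesis using U_line[of i s "s + h" x y] assms h by simp
  qed (use h_def in auto)
  have "U i t x \<le> U i (s + h) x + B * \<bar>t - (s + h)\<bar>"
    using U_time_lipschitz[of i t "s + h" x] assms by (simp add: h_def abs_le_iff)
  moreover have "B * \<bar>t - (s + h)\<bar> \<le> B * (\<bar>t - s\<bar> + h)"
    using B_nonneg by (intro mult_left_mono) (auto simp: h_def)
  moreover have "0 \<le> B * \<bar>t - s\<bar>" using B_nonneg by simp
  ultimately have "U i t x \<le> U i s y + 2 * (B * \<bar>t - s\<bar>) + 2 * (B * h)" using 1 by (simp add: algebra_simps)
  then show ?thesis by (simp add: h_def algebra_simps)
qed

lemma U_lipschitz:
  assumes "i \<in> I" "0 \<le> t" "0 \<le> s" "x \<ge> 0" "y \<ge> 0"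
  shows "\<bar>U i t x - U i s y\<bar> \<le> 2 * B * (\<bar>t - s\<bar> + \<bar>x - y\<bar>)"
  using U_le_lipschitz[OF assms] U_le_lipschitz[OF assms(1,3,2,5,4)]
  by (simp add: abs_le_iff abs_minus_commute)

text \<open>\<open>U\<close> is the largest function with these two properties, which is how
  subsolutions are compared with it. A turn needs no hypothesis, because g is a function on the
  junction and takes one value at the vertex.\<close>

lemma reach_ge_dpp:
  assumes init: "\<And>i x. i \<in> I \<Longrightarrow> x \<ge> 0 \<Longrightarrow> g 0 (x *\<^sub>R e i) \<le> u0 (x *\<^sub>R e i)"
    and dpp: "\<And>i s t x y. i \<in> I \<Longrightarrow> 0 \<le> s \<Longrightarrow> s < t \<Longrightarrow> t < T \<Longrightarrow> x \<ge> 0 \<Longrightarrow> y \<ge> 0 \<Longrightarrow>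
      g t (x *\<^sub>R e i) \<le> g s (y *\<^sub>R e i) + line_cost i (t - s) (x - y)"
  shows "reach i t x c \<Longrightarrow> t < T \<Longrightarrow> g t (x *\<^sub>R e i) \<le> c"
proof (induction rule: reach.induct)
  case (line i s y c t x)
  then show ?case using dpp[of i s t x y] reach_dom[OF line.hyps(1)] by simp
qed (auto intro: init)

subsection \<open>The last piece of an optimal trajectory\<close>

text \<open>The cost of starting at distance \<open>- q a\<close> on branch \<open>i\<close>, running to the vertex at speed \<open>q \<le> 0\<close>, and
  waiting there from time \<open>a\<close> until \<open>t\<close>. Parametrised by the speed it is continuous up to \<open>a = 0\<close>.\<close>

definition vertex_cost :: "real \<Rightarrow> nat \<Rightarrow> real \<Rightarrow> real \<Rightarrow> real" where
  "vertex_cost t i a q = u0 ((- (q * a)) *\<^sub>R e i) + a * Lag i q + (t - a) * l0"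

definition vertex_reach :: "real \<Rightarrow> real \<Rightarrow> bool" where
  "vertex_reach t c \<longleftrightarrow> (\<exists>i\<in>I. \<exists>a q. 0 \<le> a \<and> a \<le> t \<and> q \<le> 0 \<and> vertex_cost t i a q \<le> c)"

lemma U_line_to_vertex:
  assumes i: "i \<in> I" and j: "j \<in> I" and a: "0 \<le> a" and q: "q \<le> 0"
  shows "U j a 0 \<le> u0 ((- (q * a)) *\<^sub>R e i) + a * Lag i q"
proof (cases "a = 0")
  case True
  then show ?thesis using U_0[OF j, of 0] by simp
next
  case False
  have z: "- (q * a) \<ge> 0" using a q by (simp add: mult_nonpos_nonneg)
  have "U i a 0 \<le> U i 0 (- (q * a)) + line_cost i (a - 0) (0 - (- (q * a)))"
    using i a False z by (intro U_line) auto
  then show ?thesis using False a line_cost_speed[of a i q] U_0[OF i z] U_turn[OF i j] by simp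
qed

lemma U_wait_at_vertex:
  assumes j: "j \<in> I" and a: "0 \<le> a" "a \<le> t"
  shows "U j t 0 \<le> U j a 0 + (t - a) * l0"
proof (cases "a = t")
  case False
  obtain i where i: "i \<in> I" "l0 = Lag i 0" using l0_attained .
  have "U i t 0 \<le> U i a 0 + line_cost i (t - a) (0 - 0)" using i a False by (intro U_line) auto
  then show ?thesis using U_turn[OF i(1) j] i by (simp add: line_cost_def)
qed simp

lemma U_le_vertex_cost:
  assumes "i \<in> I" "j \<in> I" "0 \<le> a" "a \<le> t" "q \<le> 0"
  shows "U j t 0 \<le> vertex_cost t i a q"
  using U_line_to_vertex[OF assms(1,2,3,5)] U_wait_at_vertex[OF assms(2,3,4)] by (simp add: vertex_cost_def)

lemma vertex_reach_wait:
  assumes "vertex_reach b c" "b \<le> t" shows "vertex_reach t (c + (t - b) * l0)"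
proof -
  obtain i a q where iaq: "i \<in> I" "0 \<le> a" "a \<le> b" "q \<le> 0" "vertex_cost b i a q \<le> c"
    using assms(1) unfolding vertex_reach_def by blast
  then have "vertex_cost t i a q \<le> c + (t - b) * l0" by (simp add: vertex_cost_def algebra_simps)
  then show ?thesis unfolding vertex_reach_def using iaq assms(2) by force
qed

text \<open>Normal form of a trajectory: consecutive lines in one branch are merged by convexity,
  and everything between two visits of the vertex is replaced by waiting. Only finitely many real
  parameters remain, over which minima exist by compactness.\<close>

definition normal_reach :: "nat \<Rightarrow> real \<Rightarrow> real \<Rightarrow> real \<Rightarrow> bool" where
  "normal_reach j t x c \<longleftrightarrow>
     (\<exists>y\<ge>0. 0 < t \<and> u0 (y *\<^sub>R e j) + line_cost j t (x - y) \<le> c) \<or>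
     (\<exists>b c0. 0 \<le> b \<and> b < t \<and> vertex_reach b c0 \<and> c0 + line_cost j (t - b) x \<le> c) \<or>
     (t = 0 \<and> u0 (x *\<^sub>R e j) \<le> c) \<or> (x = 0 \<and> vertex_reach t c)"

text \<open>A line from the vertex back to the vertex has speed 0 and costs \<open>Lag j 0\<close>
  \<ge> \<open>l0\<close> per unit of time, so it can be exchanged for waiting at the rate
  \<open>l0\<close>.\<close>

lemma normal_reach_vertex:
  assumes j: "j \<in> I" and n: "normal_reach j t 0 c"
  shows "vertex_reach t c"
  using n unfolding normal_reach_def
proof (elim disjE exE conjE)
  fix y assume y: "0 \<le> y" "0 < t" "u0 (y *\<^sub>R e j) + line_cost j t (0 - y) \<le> c"
  have "vertex_cost t j t (- y / t) = u0 (y *\<^sub>R e j) + line_cost j t (0 - y)"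
    using y by (simp add: vertex_cost_def line_cost_def)
  then show ?thesis unfolding vertex_reach_def using j y
    by (intro bexI[of _ j] exI[of _ t] exI[of _ "- y / t"]) auto
next
  fix b c0 assume b: "0 \<le> b" "b < t" "vertex_reach b c0" "c0 + line_cost j (t - b) 0 \<le> c"
  have "(t - b) * l0 \<le> (t - b) * Lag j 0" using l0_le[OF j] b by (intro mult_left_mono) auto
  moreover have "line_cost j (t - b) 0 = (t - b) * Lag j 0" by (simp add: line_cost_def)
  ultimately have "c0 + (t - b) * l0 \<le> c" using b by linarith
  moreover have "vertex_reach t (c0 + (t - b) * l0)" using vertex_reach_wait b by simp
  ultimately show ?thesis unfolding vertex_reach_def by force
next
  assume "t = 0" "u0 (0 *\<^sub>R e j) \<le> c"
  then show ?thesis unfolding vertex_reach_def using j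
    by (intro bexI[of _ j] exI[of _ 0]) (auto simp: vertex_cost_def)
qed

lemma reach_normal: "reach j t x c \<Longrightarrow> normal_reach j t x c"
proof (induction rule: reach.induct)
  case (line j s y c t x)
  have d: "j \<in> I" "s \<ge> 0" "y \<ge> 0" using reach_dom[OF line.hyps(1)] by auto
  from line.IH show ?case
    unfolding normal_reach_def[of j s]
  proof (elim disjE exE conjE)
    fix z assume z: "0 \<le> z" "0 < s" "u0 (z *\<^sub>R e j) + line_cost j s (y - z) \<le> c"
    have "line_cost j (s + (t - s)) ((y - z) + (x - y)) \<le> line_cost j s (y - z) + line_cost j (t - s) (x - y)"
      using d z line.hyps by (intro line_cost_add) auto
    then have "u0 (z *\<^sub>R e j) + line_cost j t (x - z) \<le> c + line_cost j (t - s) (x - y)" using z by simp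
    then show ?thesis unfolding normal_reach_def using z line.hyps d by force
  next
    fix b c0 assume b: "0 \<le> b" "b < s" "vertex_reach b c0" "c0 + line_cost j (s - b) y \<le> c"
    have "line_cost j ((s - b) + (t - s)) (y + (x - y)) \<le> line_cost j (s - b) y + line_cost j (t - s) (x - y)"
      using d b line.hyps by (intro line_cost_add) auto
    then have "c0 + line_cost j (t - b) x \<le> c + line_cost j (t - s) (x - y)" using b by simp
    then show ?thesis unfolding normal_reach_def using b line.hyps
      by (intro disjI2[OF disjI1] exI[of _ b] exI[of _ c0]) auto
  next
    assume "s = 0" "u0 (y *\<^sub>R e j) \<le> c"
    then show ?thesis unfolding normal_reach_def using d line.hyps
      by (intro disjI1 exI[of _ y]) auto
  next
    assume "y = 0" "vertex_reach s c"
    then show ?thesis unfolding normal_reach_def using d line.hyps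
      by (intro disjI2[OF disjI1] exI[of _ s] exI[of _ c]) auto
  qed
next
  case (turn i t c j)
  then show ?case using normal_reach_vertex[of i t c] reach_dom[OF turn.hyps(1)] by (simp add: normal_reach_def)
qed (auto simp: normal_reach_def)

lemma u0_continuous_branch: "i \<in> I \<Longrightarrow> continuous_on {0..} (\<lambda>s. u0 (s *\<^sub>R e i))"
proof -
  assume i: "i \<in> I"
  have "K-lipschitz_on {0..} (\<lambda>s. u0 (s *\<^sub>R e i))"
    using u0_lipschitz_branch[OF i] K_nonneg by (intro lipschitz_onI) (auto simp: dist_real_def)
  then show ?thesis by (rule lipschitz_on_continuous_on)
qed

text \<open>Running in faster than Q is no better than waiting at the vertex all the time, so the
  minimum over the remaining compact set of parameters is global.\<close>

lemma vertex_cost_attained: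
  assumes t: "t \<ge> 0"
  obtains i a q where "i \<in> I" "0 \<le> a" "a \<le> t" "q \<le> 0"
    "\<And>j b r. j \<in> I \<Longrightarrow> 0 \<le> b \<Longrightarrow> b \<le> t \<Longrightarrow> r \<le> 0 \<Longrightarrow> vertex_cost t i a q \<le> vertex_cost t j b r"
proof -
  obtain C where C: "C \<ge> 0" "\<And>i q. i \<in> I \<Longrightarrow> Lag i q \<ge> (K + 1) * \<bar>q\<bar> - C" using Lag_superlinear by blast
  \<comment> \<open>For r \<le> -Q the spare unit of slope in K + 1 pays for C and for
    \<open>l0\<close>, and the slope K pays for the largest possible gain in
    \<open>u0\<close>.\<close>
  define Q where "Q = C + \<bar>l0\<bar>"
  have Q: "Q \<ge> 0" using C by (simp add: Q_def)
  have far: "vertex_cost t j b r \<ge> vertex_cost t j 0 0" if j: "j \<in> I" and b: "0 \<le> b" "b \<le> t" and r: "r \<le> - Q" for j b r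
  proof -
    have rn: "r \<le> 0" using r Q by simp
    then have z: "- (r * b) \<ge> 0" using b by (simp add: mult_nonpos_nonneg)
    have "u0 ((- (r * b)) *\<^sub>R e j) \<ge> u0 0 - K * (- (r * b))" using u0_growth[OF j z] by (simp add: abs_le_iff)
    moreover have "b * (K * (- r) + l0) \<le> b * Lag j r"
    proof (rule mult_left_mono[OF _ b(1)])
      have "Lag j r \<ge> (K + 1) * (- r) - C" using C(2)[OF j, of r] rn by simp
      then show "K * (- r) + l0 \<le> Lag j r" using r by (simp add: Q_def algebra_simps)
    qed
    ultimately show ?thesis by (simp add: vertex_cost_def algebra_simps)
  qed
  have "\<exists>z\<in>{0..t} \<times> {-Q..0}. \<forall>y\<in>{0..t} \<times> {-Q..0}. vertex_cost t j (fst z) (snd z) \<le> vertex_cost t j (fst y) (snd y)"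
    if j: "j \<in> I" for j
  proof (rule continuous_attains_inf)
    show "compact ({0..t} \<times> {-Q..0})" by (intro compact_Times compact_Icc)
    show "{0..t} \<times> {-Q..0} \<noteq> {}" using t Q by auto
    have "continuous_on ({0..t} \<times> {-Q..0}) (\<lambda>z. u0 ((- (snd z * fst z)) *\<^sub>R e j))"
      by (rule continuous_on_compose2[OF u0_continuous_branch[OF j]])
        (auto intro!: continuous_intros simp: mult_nonpos_nonneg)
    moreover have "continuous_on ({0..t} \<times> {-Q..0}) (\<lambda>z. Lag j (snd z))"
      by (rule continuous_on_compose2[OF Lag_continuous[OF j, of UNIV]]) (auto intro!: continuous_intros)
    ultimately show "continuous_on ({0..t} \<times> {-Q..0}) (\<lambda>z. vertex_cost t j (fst z) (snd z))"
      unfolding vertex_cost_def by (intro continuous_intros)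
  qed
  then obtain z where z: "\<And>j. j \<in> I \<Longrightarrow> z j \<in> {0..t} \<times> {-Q..0}"
    and zmin: "\<And>j y. j \<in> I \<Longrightarrow> y \<in> {0..t} \<times> {-Q..0} \<Longrightarrow>
      vertex_cost t j (fst (z j)) (snd (z j)) \<le> vertex_cost t j (fst y) (snd y)" by metis
  obtain i where i: "i \<in> I" and imin: "\<And>j. j \<in> I \<Longrightarrow>
      vertex_cost t i (fst (z i)) (snd (z i)) \<le> vertex_cost t j (fst (z j)) (snd (z j))"
    using ex_min_if_finite[of "(\<lambda>j. vertex_cost t j (fst (z j)) (snd (z j))) ` I"] I_nonempty
    by (force simp: not_less)
  show thesis
  proof (rule that)
    show "i \<in> I" "0 \<le> fst (z i)" "fst (z i) \<le> t" "snd (z i) \<le> 0" using i z[OF i] by auto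
    fix j b r assume j: "j \<in> I" and b: "0 \<le> b" "b \<le> t" and r: "(r::real) \<le> 0"
    have "vertex_cost t j (fst (z j)) (snd (z j)) \<le> vertex_cost t j b r"
    proof (cases "r \<le> - Q")
      case True
      then show ?thesis using far[OF j b True] zmin[OF j, of "(0, 0)"] t Q by simp
    next
      case False
      then show ?thesis using zmin[OF j, of "(b, r)"] b r by simp
    qed
    then show "vertex_cost t i (fst (z i)) (snd (z i)) \<le> vertex_cost t j b r" using imin[OF j] by linarith
  qed
qed

text \<open>A minimiser of \<open>vertex_cost\<close> either never waits, and then its run is the
  last piece, or it ends by waiting, which is a line of speed 0 on a branch where \<open>l0\<close>
  is attained.\<close>

lemma U_last_piece_vertex:
  assumes j: "j \<in> I" and t: "t > 0"
  obtains i s z where "i \<in> I" "0 \<le> s" "s < t" "z \<ge> 0" "U i s z + line_cost i (t - s) (0 - z) \<le> U j t 0"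
proof -
  obtain i a q where iaq: "i \<in> I" "0 \<le> a" "a \<le> t" "q \<le> 0"
    and mini: "\<And>j b r. j \<in> I \<Longrightarrow> 0 \<le> b \<Longrightarrow> b \<le> t \<Longrightarrow> r \<le> 0 \<Longrightarrow> vertex_cost t i a q \<le> vertex_cost t j b r"
    using vertex_cost_attained[of t] t by auto
  have le: "vertex_cost t i a q \<le> U j t 0"
  proof (rule U_ge)
    fix c assume "reach j t 0 c"
    then have "vertex_reach t c" using reach_normal normal_reach_vertex j by blast
    then show "vertex_cost t i a q \<le> c" unfolding vertex_reach_def using mini by force
  qed (use j t in auto)
  show thesis
  proof (cases "a = t")
    case True
    have z: "- (q * t) \<ge> 0" using t iaq by (simp add: mult_nonpos_nonneg)
    have "U i 0 (- (q * t)) + line_cost i (t - 0) (0 - (- (q * t))) = vertex_cost t i a q"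
      using True U_0[OF iaq(1) z] t line_cost_speed[of t i q] by (simp add: vertex_cost_def)
    then show ?thesis using that[OF iaq(1) order_refl t z] le by simp
  next
    case False
    obtain i0 where i0: "i0 \<in> I" "l0 = Lag i0 0" using l0_attained .
    have "U i0 a 0 + line_cost i0 (t - a) (0 - 0) \<le> vertex_cost t i a q"
      using U_line_to_vertex[OF iaq(1) i0(1) iaq(2,4)] i0 by (simp add: vertex_cost_def line_cost_def)
    then show ?thesis using that[OF i0(1) iaq(2) _ order_refl] False iaq le by fastforce
  qed
qed

text \<open>Either the vertex is never visited, and one line starts at time 0 (\<open>f\<close>), or
  it is last visited at some time b (\<open>g\<close>). Superlinearity reduces both minimisations to
  compact intervals.\<close>

lemma U_last_piece_interior:
  assumes j: "j \<in> I" and t: "t > 0" and x: "x > 0"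
  obtains s z where "0 \<le> s" "s < t" "z \<ge> 0" "U j s z + line_cost j (t - s) (x - z) \<le> U j t x"
proof -
  define f where "f = (\<lambda>y. u0 (y *\<^sub>R e j) + line_cost j t (x - y))"
  define g where "g = (\<lambda>b. U j b 0 + line_cost j (t - b) x)"
  obtain C where C: "C \<ge> 0" "\<And>i q. i \<in> I \<Longrightarrow> Lag i q \<ge> (K + 1) * \<bar>q\<bar> - C" using Lag_superlinear by blast
  have f_far: "f y \<ge> u0 (x *\<^sub>R e j) + \<bar>x - y\<bar> - C * t" if "y \<ge> 0" for y
  proof -
    have "line_cost j t (x - y) \<ge> (K + 1) * \<bar>x - y\<bar> - C * t" using j t C by (intro line_cost_coercive) auto
    moreover have "u0 (y *\<^sub>R e j) \<ge> u0 (x *\<^sub>R e j) - K * \<bar>x - y\<bar>"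
      using u0_lipschitz_branch[OF j _ that, of x] x by (simp add: abs_le_iff)
    ultimately show ?thesis by (simp add: f_def algebra_simps)
  qed
  \<comment> \<open>By \<open>f_far\<close>, f exceeds f x beyond distance R.\<close>
  define R where "R = x + \<bar>f x - u0 (x *\<^sub>R e j) + C * t\<bar>"
  have R: "x \<le> R" by (simp add: R_def)
  have "\<exists>y\<in>{0..R}. \<forall>z\<in>{0..R}. f y \<le> f z"
  proof (rule continuous_attains_inf)
    have "continuous_on {0..R} (\<lambda>y. u0 (y *\<^sub>R e j))"
      by (rule continuous_on_subset[OF u0_continuous_branch[OF j]]) auto
    moreover have "continuous_on {0..R} (\<lambda>y. line_cost j t (x - y))"
      by (rule continuous_on_compose2[OF line_cost_continuous[OF j], of _ "\<lambda>y. (t, x - y)", unfolded prod.case])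
        (use t in \<open>auto intro!: continuous_intros\<close>)
    ultimately show "continuous_on {0..R} f" unfolding f_def by (intro continuous_intros)
  qed (use x R in auto)
  then obtain y where y: "0 \<le> y" and ymin: "\<And>z. 0 \<le> z \<Longrightarrow> z \<le> R \<Longrightarrow> f y \<le> f z" by auto
  have fy: "f y \<le> f z" if "z \<ge> 0" for z
  proof (cases "z \<le> R")
    case False
    then have "f z \<ge> f x" using f_far[OF that] by (auto simp: R_def)
    then show ?thesis using ymin[of x] x R by simp
  qed (use ymin that in auto)
  \<comment> \<open>Leaving the vertex shortly before t means covering x > 0 in little time. P is
    the slope for which P * x outweighs f x and the least possible value at the vertex; the extra 1
    pays for D * \<nu>.\<close>
  define P where "P = (\<bar>f x\<bar> + \<bar>u0 0\<bar> + B * t + 1) / x"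
  obtain D where D: "D \<ge> 0" "\<And>i q. i \<in> I \<Longrightarrow> Lag i q \<ge> P * \<bar>q\<bar> - D" using Lag_superlinear by blast
  define \<nu> where "\<nu> = min t (1 / (D + 1))"
  have \<nu>: "0 < \<nu>" "\<nu> \<le> t" using t D by (auto simp: \<nu>_def)
  have "D * \<nu> \<le> D * (1 / (D + 1))" using D(1) by (intro mult_left_mono) (auto simp: \<nu>_def)
  also have "\<dots> \<le> 1" using D(1) by simp
  finally have D\<nu>: "D * \<nu> \<le> 1" .
  have g_near: "g b \<ge> f x" if b: "0 \<le> b" "b < t" "t - b < \<nu>" for b
  proof -
    have "line_cost j (t - b) x \<ge> P * \<bar>x\<bar> - D * (t - b)" using j b D by (intro line_cost_coercive) auto
    moreover have "D * (t - b) \<le> D * \<nu>" using b D by (intro mult_left_mono) auto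
    moreover have "P * \<bar>x\<bar> = \<bar>f x\<bar> + \<bar>u0 0\<bar> + B * t + 1" using x by (simp add: P_def)
    moreover have "U j b 0 \<ge> u0 0 - B * b" using U_bounds[OF j b(1), of 0] by (simp add: abs_le_iff)
    moreover have "B * b \<le> B * t" using b B_nonneg by (intro mult_left_mono) auto
    ultimately show ?thesis using D\<nu> by (simp add: g_def)
  qed
  have "\<exists>b\<in>{0..t - \<nu>}. \<forall>b'\<in>{0..t - \<nu>}. g b \<le> g b'"
  proof (rule continuous_attains_inf)
    have "(2 * B)-lipschitz_on {0..t - \<nu>} (\<lambda>b. U j b 0)"
      using U_lipschitz[OF j, of _ _ 0 0] B_nonneg by (intro lipschitz_onI) (auto simp: dist_real_def)
    then have "continuous_on {0..t - \<nu>} (\<lambda>b. U j b 0)" by (rule lipschitz_on_continuous_on)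
    moreover have "continuous_on {0..t - \<nu>} (\<lambda>b. line_cost j (t - b) x)"
      by (rule continuous_on_compose2[OF line_cost_continuous[OF j], of _ "\<lambda>b. (t - b, x)", unfolded prod.case])
        (use \<nu> in \<open>auto intro!: continuous_intros\<close>)
    ultimately show "continuous_on {0..t - \<nu>} g" unfolding g_def by (intro continuous_intros)
  qed (use \<nu> in auto)
  then obtain b where b: "0 \<le> b" "b \<le> t - \<nu>" and bmin: "\<And>b'. 0 \<le> b' \<Longrightarrow> b' \<le> t - \<nu> \<Longrightarrow> g b \<le> g b'" by auto
  \<comment> \<open>A trajectory that leaves the vertex after t - \<nu> costs at least f x, hence at
    least f y, so the two compact minimisations cover all cases.\<close>
  have "min (f y) (g b) \<le> U j t x"
  proof (rule U_ge)
    fix c assume "reach j t x c"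
    then have "normal_reach j t x c" by (rule reach_normal)
    then show "min (f y) (g b) \<le> c" unfolding normal_reach_def
    proof (elim disjE exE conjE)
      fix z assume "0 \<le> z" "u0 (z *\<^sub>R e j) + line_cost j t (x - z) \<le> c"
      then show ?thesis using fy[of z] by (simp add: f_def)
    next
      fix b' c0 assume b': "0 \<le> b'" "b' < t" "vertex_reach b' c0" "c0 + line_cost j (t - b') x \<le> c"
      have "U j b' 0 \<le> c0" using b'(3) U_le_vertex_cost[OF _ j] unfolding vertex_reach_def by force
      then have "g b' \<le> c" using b' by (simp add: g_def)
      moreover have "g b' \<ge> f y \<or> g b' \<ge> g b"
        using bmin[of b'] g_near[of b'] fy[of x] b' x by linarith
      ultimately show ?thesis by linarith
    qed (use t x in auto)
  qed (use j t x in auto)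
  then show thesis
    using that[of 0 y] that[of b 0] y b \<nu> t U_0[OF j y] by (auto simp: f_def g_def min_le_iff_disj)
qed


subsection \<open>The value function is a viscosity solution\<close>

definition uval :: "real \<Rightarrow> real^2 \<Rightarrow> real" where
  "uval t x = U (SOME i. i \<in> I \<and> x \<in> branch e i) t (norm x)"

text \<open>The choice of a branch in \<open>uval\<close> is ambiguous only at the vertex, where
  \<open>U_turn\<close> makes all choices agree.\<close>

lemma uval_scaleR:
  assumes "i \<in> I" "s \<ge> 0" shows "uval t (s *\<^sub>R e i) = U i t s"
proof -
  define k where "k = (SOME k. k \<in> I \<and> s *\<^sub>R e i \<in> branch e k)"
  have "k \<in> I \<and> s *\<^sub>R e i \<in> branch e k"
    unfolding k_def by (rule someI[of _ i]) (use assms branch_scaleR in auto)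
  then have "k \<in> I" "s = 0 \<or> i = k" using scaleR_in_branch_iff[OF assms(1) _ assms(2)] by auto
  then have "U k t s = U i t s" using U_turn assms by auto
  then show ?thesis unfolding uval_def k_def[symmetric] norm_scaleR_e[OF assms] .
qed

lemma uval_0: "i \<in> I \<Longrightarrow> uval t 0 = U i t 0"
  using uval_scaleR[of i 0] by simp

text \<open>Chain rule along the line of speed q traced backwards in time. The derivative is
  one-sided, since a line that ends in the vertex cannot be continued in the same branch.\<close>

lemma C1_star_curve:
  assumes \<phi>: "C1_star N e T \<phi> Dt Dx" and i: "i \<in> I" and t: "0 < t" "t < T" and x: "x \<ge> 0"
    and \<eta>: "0 < \<eta>" "\<eta> < t" "\<And>h. 0 \<le> h \<Longrightarrow> h \<le> \<eta> \<Longrightarrow> x - q * h \<ge> 0"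
  shows "((\<lambda>h. (\<phi> (t - h) ((x - q * h) *\<^sub>R e i) - \<phi> t (x *\<^sub>R e i)) / h) \<longlongrightarrow> - (Dt i t x + q * Dx i t x)) (at_right 0)"
proof -
  let ?g = "\<lambda>h. (t - h, x - q * h)"
  have "((\<lambda>(\<tau>, \<sigma>). \<phi> \<tau> (\<sigma> *\<^sub>R e i)) has_derivative (\<lambda>(h, k). Dt i t x * h + Dx i t x * k))
        (at (?g 0) within ({0<..<T} \<times> {0..}))"
    using \<phi> i t x unfolding C1_star_def I_eq[symmetric] by simp
  then have D: "((\<lambda>(\<tau>, \<sigma>). \<phi> \<tau> (\<sigma> *\<^sub>R e i)) has_derivative (\<lambda>(h, k). Dt i t x * h + Dx i t x * k))
        (at (?g 0) within (?g ` {0..\<eta>}))"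
    by (rule has_derivative_subset) (use t \<eta> in auto)
  have g: "(?g has_derivative (\<lambda>h. (- h, - q * h))) (at 0 within {0..\<eta>})"
    by (auto intro!: derivative_eq_intros)
  have "((\<lambda>h. \<phi> (t - h) ((x - q * h) *\<^sub>R e i)) has_derivative (\<lambda>h. - (Dt i t x + q * Dx i t x) * h)) (at 0 within {0..\<eta>})"
    using has_derivative_in_compose[OF g D] by (simp add: case_prod_unfold algebra_simps)
  then have "((\<lambda>h. \<phi> (t - h) ((x - q * h) *\<^sub>R e i)) has_real_derivative - (Dt i t x + q * Dx i t x)) (at 0 within {0..\<eta>})"
    by (simp add: has_field_derivative_def)
  then show ?thesis
    using \<eta>(1) by (simp add: has_field_derivative_iff at_within_Icc_at_right)
qed

text \<open>At the vertex the difference quotient in time does not mention the branch. This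
  reconciles the fixed index in \<open>Dt 1\<close> with inequalities obtained along an arbitrary
  branch.\<close>

lemma C1_star_Dt_vertex:
  assumes \<phi>: "C1_star N e T \<phi> Dt Dx" and i: "i \<in> I" "j \<in> I" and t: "0 < t" "t < T"
  shows "Dt i t 0 = Dt j t 0"
proof -
  have "((\<lambda>h. (\<phi> (t - h) 0 - \<phi> t 0) / h) \<longlongrightarrow> - (Dt k t 0)) (at_right 0)" if "k \<in> I" for k
    using C1_star_curve[OF \<phi> that t, of 0 "t / 2" 0] t by simp
  from tendsto_unique[OF _ this[OF i(1)] this[OF i(2)]] show ?thesis by simp
qed

lemma curve_near:
  assumes i: "i \<in> I" and t: "0 < t" and x: "x \<ge> 0" "x > 0 \<or> q \<le> 0" and r: "r > 0"
  obtains \<eta> where "0 < \<eta>" "\<eta> < t" "\<And>h. 0 \<le> h \<Longrightarrow> h \<le> \<eta> \<Longrightarrow> x - q * h \<ge> 0"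
    "\<And>h. 0 \<le> h \<Longrightarrow> h \<le> \<eta> \<Longrightarrow> pdist N e (t - h, (x - q * h) *\<^sub>R e i) (t, x *\<^sub>R e i) < r"
proof -
  \<comment> \<open>The bounds keep the time positive, the point inside the ball and, for q > 0, the
    position nonnegative. For q \<le> 0 the line traced backwards leads away from the vertex, and 1
    is a dummy.\<close>
  define \<eta> where "\<eta> = min (t / 2) (min (r / (2 * (1 + \<bar>q\<bar>))) (if q \<le> 0 then 1 else x / (1 + \<bar>q\<bar>)))"
  have q: "1 + \<bar>q\<bar> > 0" by (simp add: add_pos_nonneg)
  have \<eta>: "0 < \<eta>" "\<eta> < t" using t r x q by (auto simp: \<eta>_def)
  have pos: "x - q * h \<ge> 0" if h: "0 \<le> h" "h \<le> \<eta>" for h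
  proof (cases "q \<le> 0")
    case True
    then have "q * h \<le> 0" using h by (simp add: mult_nonpos_nonneg)
    then show ?thesis using x by linarith
  next
    case False
    then have "h \<le> x / (1 + \<bar>q\<bar>)" using h by (auto simp: \<eta>_def)
    then have "h * (1 + \<bar>q\<bar>) \<le> x" using q by (simp add: pos_le_divide_eq)
    then show ?thesis using False h by (simp add: algebra_simps)
  qed
  show thesis
  proof (rule that[OF \<eta> pos])
    fix h assume h: "0 \<le> h" "h \<le> \<eta>"
    have "pdist N e (t - h, (x - q * h) *\<^sub>R e i) (t, x *\<^sub>R e i) = dist (t - h, x - q * h) (t, x)"
      using i x(1) pos[OF h] by (intro pdist_same) auto
    also have "\<dots> \<le> \<bar>h\<bar> + \<bar>q * h\<bar>"
      using sqrt_sum_squares_le_sum_abs[of h "q * h"] by (simp add: dist_Pair_Pair dist_real_def)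
    also have "\<dots> = h * (1 + \<bar>q\<bar>)" using h by (simp add: abs_mult algebra_simps)
    also have "\<dots> \<le> r / (2 * (1 + \<bar>q\<bar>)) * (1 + \<bar>q\<bar>)" using h q by (intro mult_right_mono) (auto simp: \<eta>_def)
    also have "\<dots> = r / 2" using q by (simp add: field_simps)
    also have "\<dots> < r" using r by simp
    finally show "pdist N e (t - h, (x - q * h) *\<^sub>R e i) (t, x *\<^sub>R e i) < r" .
  qed
qed

text \<open>\<open>U_line\<close> on short lines of speed q ending at x, divided by their duration.
  At the vertex such lines exist only for q \<le> 0, which is the origin of
  \<open>Ham_minus\<close>.\<close>

lemma uval_test_above:
  assumes \<phi>: "C1_star N e T \<phi> Dt Dx" and i: "i \<in> I" and t: "0 < t" "t < T"
    and x: "x \<ge> 0" "x > 0 \<or> q \<le> 0" and touch: "touch_above N e T \<phi> uval (t, x *\<^sub>R e i)"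
  shows "Dt i t x + q * Dx i t x \<le> Lag i q"
proof -
  obtain r where r: "r > 0" and le: "\<And>Q. Q \<in> JT N e T \<Longrightarrow> pdist N e Q (t, x *\<^sub>R e i) < r \<Longrightarrow> uval (fst Q) (snd Q) \<le> \<phi> (fst Q) (snd Q)"
    and eq: "uval t (x *\<^sub>R e i) = \<phi> t (x *\<^sub>R e i)"
    using touch unfolding touch_above_def by auto
  obtain \<eta> where \<eta>: "0 < \<eta>" "\<eta> < t" "\<And>h. 0 \<le> h \<Longrightarrow> h \<le> \<eta> \<Longrightarrow> x - q * h \<ge> 0"
    and near: "\<And>h. 0 \<le> h \<Longrightarrow> h \<le> \<eta> \<Longrightarrow> pdist N e (t - h, (x - q * h) *\<^sub>R e i) (t, x *\<^sub>R e i) < r"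
    using curve_near[OF i t(1) x r] by metis
  have "- Lag i q \<le> (\<phi> (t - h) ((x - q * h) *\<^sub>R e i) - \<phi> t (x *\<^sub>R e i)) / h" if h: "0 < h" "h \<le> \<eta>" for h
  proof -
    have h': "x - q * h \<ge> 0" "t - h > 0" using \<eta> h by auto
    have "U i t x \<le> U i (t - h) (x - q * h) + line_cost i (t - (t - h)) (x - (x - q * h))"
      using i h' h x by (intro U_line) auto
    then have "U i t x \<le> U i (t - h) (x - q * h) + h * Lag i q" using line_cost_speed[of h i q] h by simp
    moreover have "uval (t - h) ((x - q * h) *\<^sub>R e i) \<le> \<phi> (t - h) ((x - q * h) *\<^sub>R e i)"
      using le[of "(t - h, (x - q * h) *\<^sub>R e i)"] near[of h] h h' t scaleR_in_J[OF i] by (simp add: JT_def)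
    ultimately have "- Lag i q * h \<le> \<phi> (t - h) ((x - q * h) *\<^sub>R e i) - \<phi> t (x *\<^sub>R e i)"
      using uval_scaleR[OF i x(1)] uval_scaleR[OF i h'(1)] eq by (simp add: mult.commute)
    then show ?thesis using h by (simp only: pos_le_divide_eq)
  qed
  then have "eventually (\<lambda>h. - Lag i q \<le> (\<phi> (t - h) ((x - q * h) *\<^sub>R e i) - \<phi> t (x *\<^sub>R e i)) / h) (at_right 0)"
    using \<eta>(1) by (intro eventually_at_rightI[of 0 \<eta>]) auto
  from tendsto_lowerbound[OF C1_star_curve[OF \<phi> i t x(1) \<eta>] this]
  show ?thesis by simp
qed

text \<open>An optimal last piece stays optimal when cut at t - h, so along it the inequality of
  \<open>uval_test_above\<close> is reversed, for this particular speed.\<close>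

lemma uval_test_below:
  assumes \<phi>: "C1_star N e T \<phi> Dt Dx" and i: "i \<in> I" and t: "0 < t" "t < T"
    and x: "x \<ge> 0" and touch: "touch_below N e T \<phi> uval (t, x *\<^sub>R e i)"
    and s: "0 \<le> s" "s < t" "z \<ge> 0" and last: "U i s z + line_cost i (t - s) (x - z) \<le> U i t x"
  shows "Dt i t x + (x - z) / (t - s) * Dx i t x \<ge> Lag i ((x - z) / (t - s))"
proof -
  define q where "q = (x - z) / (t - s)"
  have xz: "x - z = q * (t - s)" using s by (simp add: q_def)
  \<comment> \<open>A last piece that ends in the vertex comes from z \<ge> 0, hence has speed q
    \<le> 0, and the backward line stays in the branch.\<close>
  have xq: "x > 0 \<or> q \<le> 0" using x s by (cases "x = 0") (auto simp: q_def)
  obtain r where r: "r > 0" and le: "\<And>Q. Q \<in> JT N e T \<Longrightarrow> pdist N e Q (t, x *\<^sub>R e i) < r \<Longrightarrow> \<phi> (fst Q) (snd Q) \<le> uval (fst Q) (snd Q)"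
    and eq: "uval t (x *\<^sub>R e i) = \<phi> t (x *\<^sub>R e i)"
    using touch unfolding touch_below_def by auto
  obtain \<eta> where \<eta>: "0 < \<eta>" "\<eta> < t" "\<And>h. 0 \<le> h \<Longrightarrow> h \<le> \<eta> \<Longrightarrow> x - q * h \<ge> 0"
    and near: "\<And>h. 0 \<le> h \<Longrightarrow> h \<le> \<eta> \<Longrightarrow> pdist N e (t - h, (x - q * h) *\<^sub>R e i) (t, x *\<^sub>R e i) < r"
    using curve_near[OF i t(1) x xq r] by metis
  have "(\<phi> (t - h) ((x - q * h) *\<^sub>R e i) - \<phi> t (x *\<^sub>R e i)) / h \<le> - Lag i q" if h: "0 < h" "h \<le> \<eta>" "h < t - s" for h
  proof -
    have h': "x - q * h \<ge> 0" "t - h > 0" using \<eta> h by auto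
    have "U i (t - h) (x - q * h) \<le> U i s z + line_cost i (t - h - s) (x - q * h - z)"
      using i h' h x s by (intro U_line) auto
    moreover have "x - q * h - z = q * (t - h - s)" using xz by (simp add: algebra_simps)
    ultimately have "U i (t - h) (x - q * h) \<le> U i s z + (t - h - s) * Lag i q"
      using line_cost_speed[of "t - h - s" i q] h by simp
    moreover have "line_cost i (t - s) (x - z) = (t - s) * Lag i q"
      using line_cost_speed[of "t - s" i q] s xz by simp
    moreover have "uval (t - h) ((x - q * h) *\<^sub>R e i) \<ge> \<phi> (t - h) ((x - q * h) *\<^sub>R e i)"
      using le[of "(t - h, (x - q * h) *\<^sub>R e i)"] near[of h] h h' t scaleR_in_J[OF i] by (simp add: JT_def)
    ultimately have "\<phi> (t - h) ((x - q * h) *\<^sub>R e i) - \<phi> t (x *\<^sub>R e i) \<le> - Lag i q * h"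
      using uval_scaleR[OF i x] uval_scaleR[OF i h'(1)] eq last by (simp add: algebra_simps)
    then show ?thesis using h by (simp only: pos_divide_le_eq)
  qed
  then have "eventually (\<lambda>h. (\<phi> (t - h) ((x - q * h) *\<^sub>R e i) - \<phi> t (x *\<^sub>R e i)) / h \<le> - Lag i q) (at_right 0)"
    using \<eta>(1) s by (intro eventually_at_rightI[of 0 "min \<eta> (t - s)"]) auto
  from tendsto_upperbound[OF C1_star_curve[OF \<phi> i t x \<eta>] this]
  show ?thesis unfolding q_def[symmetric] by simp
qed

lemma uval_lipschitz:
  assumes "t \<ge> 0" "t' \<ge> 0" "x \<in> J" "y \<in> J"
  shows "\<bar>uval t x - uval t' y\<bar> \<le> 4 * B * pdist N e (t, x) (t', y)"
proof -
  obtain i s where i: "i \<in> I" "s \<ge> 0" "x = s *\<^sub>R e i" using J_cases[OF assms(3)] .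
  obtain j r where j: "j \<in> I" "r \<ge> 0" "y = r *\<^sub>R e j" using J_cases[OF assms(4)] .
  have "\<bar>uval t x - uval t' y\<bar> \<le> 2 * B * (\<bar>t - t'\<bar> + jdist N e x y)"
  proof (cases "i = j")
    case True
    then show ?thesis using U_lipschitz[OF i(1) assms(1,2) i(2) j(2)] i j
      by (simp add: uval_scaleR jdist_same)
  next
    case False
    have "\<bar>U i t s - U j t' r\<bar> \<le> \<bar>U i t s - U i t' 0\<bar> + \<bar>U j t' 0 - U j t' r\<bar>"
      using U_turn[OF i(1) j(1), of t'] by linarith
    also have "\<dots> \<le> 2 * B * (\<bar>t - t'\<bar> + \<bar>s - 0\<bar>) + 2 * B * (\<bar>t' - t'\<bar> + \<bar>0 - r\<bar>)"
      using assms i j by (intro add_mono U_lipschitz) auto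
    also have "\<dots> = 2 * B * (\<bar>t - t'\<bar> + (s + r))" using i(2) j(2) by (simp add: algebra_simps)
    finally show ?thesis using i j False by (simp add: uval_scaleR jdist_diff)
  qed
  also have "\<dots> \<le> 2 * B * (2 * pdist N e (t, x) (t', y))"
  proof -
    have "jdist N e x y \<le> pdist N e (t, x) (t', y)" unfolding pdist_def by (rule real_le_rsqrt) simp
    then show ?thesis using pdist_ge_time[of t t' x y] B_nonneg by (intro mult_left_mono) auto
  qed
  finally show ?thesis by simp
qed

lemma pdist_refl: "x \<in> J \<Longrightarrow> pdist N e (t, x) (t, x) = 0"
proof -
  assume "x \<in> J"
  then obtain i s where "i \<in> I" "s \<ge> 0" "x = s *\<^sub>R e i" using J_cases by blast
  then show ?thesis using pdist_same[of i s s t t] by simp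
qed

lemma usc_uval: "usc_on N e (JT0 N e T) uval" and lsc_uval: "lsc_on N e (JT0 N e T) uval"
proof -
  have "\<exists>\<delta>>0. \<forall>Q\<in>JT0 N e T. pdist N e Q P < \<delta> \<longrightarrow> \<bar>uval (fst Q) (snd Q) - uval (fst P) (snd P)\<bar> < \<epsilon>"
    if P: "P \<in> JT0 N e T" and \<epsilon>: "\<epsilon> > 0" for P \<epsilon>
  proof (intro exI conjI ballI impI)
    show "\<epsilon> / (4 * B + 1) > 0" using \<epsilon> B_nonneg by simp
    fix Q assume Q: "Q \<in> JT0 N e T" and d: "pdist N e Q P < \<epsilon> / (4 * B + 1)"
    have "\<bar>uval (fst Q) (snd Q) - uval (fst P) (snd P)\<bar> \<le> 4 * B * pdist N e Q P"
      using uval_lipschitz[of "fst Q" "fst P" "snd Q" "snd P"] P Q by (auto simp: JT0_def)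
    also have "\<dots> \<le> (4 * B + 1) * pdist N e Q P" by (intro mult_right_mono) (auto simp: pdist_def)
    also have "\<dots> < \<epsilon>" using d B_nonneg by (simp add: pos_less_divide_eq mult.commute)
    finally show "\<bar>uval (fst Q) (snd Q) - uval (fst P) (snd P)\<bar> < \<epsilon>" .
  qed
  then show "usc_on N e (JT0 N e T) uval" "lsc_on N e (JT0 N e T) uval"
    unfolding usc_on_def lsc_on_def abs_less_iff by (smt (verit))+
qed

lemma visc_sub_uval: "visc_sub N e Lag T u0 uval"
  unfolding visc_sub_def I_eq[symmetric]
proof (intro conjI allI impI ballI usc_uval)
  fix \<phi> Dt Dx t i s
  assume \<phi>: "C1_star N e T \<phi> Dt Dx" and t: "0 < t \<and> t < T" and i: "i \<in> I" and s: "(s::real) > 0"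
    and touch: "touch_above N e T \<phi> uval (t, s *\<^sub>R e i)"
  have "Ham Lag i (Dx i t s) \<le> - Dt i t s"
  proof (rule Ham_le)
    fix q
    show "Dx i t s * q - Lag i q \<le> - Dt i t s"
      using uval_test_above[OF \<phi> i _ _ _ _ touch, of q] t s by (simp add: mult.commute)
  qed
  then show "Dt i t s + Ham Lag i (Dx i t s) \<le> 0" by simp
next
  fix \<phi> Dt Dx t
  assume \<phi>: "C1_star N e T \<phi> Dt Dx" and t: "0 < t \<and> t < T" and touch: "touch_above N e T \<phi> uval (t, 0)"
  have "Ham_minus Lag i (Dx i t 0) \<le> - Dt 1 t 0" if i: "i \<in> I" for i
  proof (rule Ham_minus_le)
    fix q :: real assume "q \<le> 0"
    then show "Dx i t 0 * q - Lag i q \<le> - Dt 1 t 0"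
      using uval_test_above[OF \<phi> i, of t 0 q] t touch C1_star_Dt_vertex[OF \<phi> i one_in_I, of t]
      by (simp add: mult.commute)
  qed
  then have "Max ((\<lambda>i. Ham_minus Lag i (Dx i t 0)) ` I) \<le> - Dt 1 t 0"
    using I_nonempty by (intro Max.boundedI) auto
  then show "Dt 1 t 0 + Max ((\<lambda>i. Ham_minus Lag i (Dx i t 0)) ` I) \<le> 0" by simp
next
  fix x assume "x \<in> J"
  then show "uval 0 x \<le> u0 x" using J_cases uval_scaleR U_0 by (metis order_refl)
qed

lemma visc_super_uval: "visc_super N e Lag T u0 uval"
  unfolding visc_super_def I_eq[symmetric]
proof (intro conjI allI impI ballI lsc_uval)
  fix \<phi> Dt Dx t i s
  assume \<phi>: "C1_star N e T \<phi> Dt Dx" and t: "0 < t \<and> t < T" and i: "i \<in> I" and s: "(s::real) > 0"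
    and touch: "touch_below N e T \<phi> uval (t, s *\<^sub>R e i)"
  obtain r z where r: "0 \<le> r" "r < t" "z \<ge> 0" "U i r z + line_cost i (t - r) (s - z) \<le> U i t s"
    using U_last_piece_interior[OF i _ s, of t] t by blast
  have "Dt i t s + (s - z) / (t - r) * Dx i t s \<ge> Lag i ((s - z) / (t - r))"
    using uval_test_below[OF \<phi> i _ _ _ touch r] t s by simp
  moreover have "Dx i t s * ((s - z) / (t - r)) - Lag i ((s - z) / (t - r)) \<le> Ham Lag i (Dx i t s)"
    by (rule Ham_ge[OF i])
  ultimately show "0 \<le> Dt i t s + Ham Lag i (Dx i t s)" by (simp add: mult.commute)
next
  fix \<phi> Dt Dx t
  assume \<phi>: "C1_star N e T \<phi> Dt Dx" and t: "0 < t \<and> t < T" and touch: "touch_below N e T \<phi> uval (t, 0)"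
  obtain i r z where i: "i \<in> I" and r: "0 \<le> r" "r < t" "z \<ge> 0" "U i r z + line_cost i (t - r) (0 - z) \<le> U 1 t 0"
    using U_last_piece_vertex[OF one_in_I, of t] t by blast
  have r': "U i r z + line_cost i (t - r) (0 - z) \<le> U i t 0" using r U_turn[OF i one_in_I] by simp
  have "Dt i t 0 + (0 - z) / (t - r) * Dx i t 0 \<ge> Lag i ((0 - z) / (t - r))"
    using uval_test_below[OF \<phi> i _ _ order_refl _ r(1-3) r'] t touch by simp
  moreover have "Dx i t 0 * ((0 - z) / (t - r)) - Lag i ((0 - z) / (t - r)) \<le> Ham_minus Lag i (Dx i t 0)"
    using r by (intro Ham_minus_ge[OF i]) (auto simp: divide_nonpos_pos)
  moreover have "Ham_minus Lag i (Dx i t 0) \<le> Max ((\<lambda>i. Ham_minus Lag i (Dx i t 0)) ` I)"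
    using i by (intro Max_ge) auto
  moreover have "Dt i t 0 = Dt 1 t 0" using C1_star_Dt_vertex[OF \<phi> i one_in_I] t by blast
  ultimately show "0 \<le> Dt 1 t 0 + Max ((\<lambda>i. Ham_minus Lag i (Dx i t 0)) ` I)" by (simp add: mult.commute)
next
  fix x assume "x \<in> J"
  then show "u0 x \<le> uval 0 x" using J_cases uval_scaleR U_0 by (metis order_refl)
qed

text \<open>The envelopes are known to agree with \<open>uval\<close> only on [0,T) x J, and the
  notion of subsolution looks no further.\<close>

lemma visc_sub_cong:
  assumes eq: "\<And>t x. (t, x) \<in> JT0 N e T \<Longrightarrow> u t x = v t x" and T: "T > 0"
    and v: "visc_sub N e Lag T w v"
  shows "visc_sub N e Lag T w u"
proof -
  have eq': "Q \<in> JT0 N e T \<Longrightarrow> u (fst Q) (snd Q) = v (fst Q) (snd Q)" for Q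
    by (rule eq) simp
  have sub: "Q \<in> JT N e T \<Longrightarrow> Q \<in> JT0 N e T" for Q by (auto simp: JT_def JT0_def)
  have "usc_on N e (JT0 N e T) v" using v by (simp add: visc_sub_def)
  then have 1: "usc_on N e (JT0 N e T) u" unfolding usc_on_def by (simp add: eq' cong: ball_cong_simp)
  have touch: "touch_above N e T \<phi> v P" if "touch_above N e T \<phi> u P" "P \<in> JT N e T" for \<phi> P
    using that unfolding touch_above_def by (simp add: eq' sub cong: ball_cong_simp)
  have v1: "C1_star N e T \<phi> Dt Dx \<Longrightarrow> 0 < t \<and> t < T \<Longrightarrow> i \<in> I \<Longrightarrow> s > 0 \<Longrightarrow>
      touch_above N e T \<phi> v (t, s *\<^sub>R e i) \<Longrightarrow> Dt i t s + Ham Lag i (Dx i t s) \<le> 0" for \<phi> Dt Dx t i s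
    using v unfolding visc_sub_def I_eq[symmetric] by blast
  have v2: "C1_star N e T \<phi> Dt Dx \<Longrightarrow> 0 < t \<and> t < T \<Longrightarrow> touch_above N e T \<phi> v (t, 0) \<Longrightarrow>
      Dt 1 t 0 + Max ((\<lambda>i. Ham_minus Lag i (Dx i t 0)) ` I) \<le> 0" for \<phi> Dt Dx t
    using v unfolding visc_sub_def I_eq[symmetric] by blast
  show ?thesis unfolding visc_sub_def I_eq[symmetric]
  proof (intro conjI allI impI ballI 1)
    fix \<phi> Dt Dx t i s
    assume "C1_star N e T \<phi> Dt Dx" "0 < t \<and> t < T" "i \<in> I" "(s::real) > 0" "touch_above N e T \<phi> u (t, s *\<^sub>R e i)"
    then show "Dt i t s + Ham Lag i (Dx i t s) \<le> 0"
      using v1 touch scaleR_in_J by (simp add: JT_def)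
  next
    fix \<phi> Dt Dx t
    assume "C1_star N e T \<phi> Dt Dx" "0 < t \<and> t < T" "touch_above N e T \<phi> u (t, 0)"
    then show "Dt 1 t 0 + Max ((\<lambda>i. Ham_minus Lag i (Dx i t 0)) ` I) \<le> 0"
      using v2 touch zero_in_J by (simp add: JT_def)
  next
    fix x assume "x \<in> J"
    then show "u 0 x \<le> w x" using v T eq[of 0 x] unfolding visc_sub_def by (simp add: JT0_def)
  qed
qed

lemma visc_super_cong:
  assumes eq: "\<And>t x. (t, x) \<in> JT0 N e T \<Longrightarrow> u t x = v t x" and T: "T > 0"
    and v: "visc_super N e Lag T w v"
  shows "visc_super N e Lag T w u"
proof -
  have eq': "Q \<in> JT0 N e T \<Longrightarrow> u (fst Q) (snd Q) = v (fst Q) (snd Q)" for Q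
    by (rule eq) simp
  have sub: "Q \<in> JT N e T \<Longrightarrow> Q \<in> JT0 N e T" for Q by (auto simp: JT_def JT0_def)
  have "lsc_on N e (JT0 N e T) v" using v by (simp add: visc_super_def)
  then have 1: "lsc_on N e (JT0 N e T) u" unfolding lsc_on_def by (simp add: eq' cong: ball_cong_simp)
  have touch: "touch_below N e T \<phi> v P" if "touch_below N e T \<phi> u P" "P \<in> JT N e T" for \<phi> P
    using that unfolding touch_below_def by (simp add: eq' sub cong: ball_cong_simp)
  have v1: "C1_star N e T \<phi> Dt Dx \<Longrightarrow> 0 < t \<and> t < T \<Longrightarrow> i \<in> I \<Longrightarrow> s > 0 \<Longrightarrow>
      touch_below N e T \<phi> v (t, s *\<^sub>R e i) \<Longrightarrow> 0 \<le> Dt i t s + Ham Lag i (Dx i t s)" for \<phi> Dt Dx t i s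
    using v unfolding visc_super_def I_eq[symmetric] by blast
  have v2: "C1_star N e T \<phi> Dt Dx \<Longrightarrow> 0 < t \<and> t < T \<Longrightarrow> touch_below N e T \<phi> v (t, 0) \<Longrightarrow>
      0 \<le> Dt 1 t 0 + Max ((\<lambda>i. Ham_minus Lag i (Dx i t 0)) ` I)" for \<phi> Dt Dx t
    using v unfolding visc_super_def I_eq[symmetric] by blast
  show ?thesis unfolding visc_super_def I_eq[symmetric]
  proof (intro conjI allI impI ballI 1)
    fix \<phi> Dt Dx t i s
    assume "C1_star N e T \<phi> Dt Dx" "0 < t \<and> t < T" "i \<in> I" "(s::real) > 0" "touch_below N e T \<phi> u (t, s *\<^sub>R e i)"
    then show "0 \<le> Dt i t s + Ham Lag i (Dx i t s)"
      using v1 touch scaleR_in_J by (simp add: JT_def)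
  next
    fix \<phi> Dt Dx t
    assume "C1_star N e T \<phi> Dt Dx" "0 < t \<and> t < T" "touch_below N e T \<phi> u (t, 0)"
    then show "0 \<le> Dt 1 t 0 + Max ((\<lambda>i. Ham_minus Lag i (Dx i t 0)) ` I)"
      using v2 touch zero_in_J by (simp add: JT_def)
  next
    fix x assume "x \<in> J"
    then show "w x \<le> u 0 x" using v T eq[of 0 x] unfolding visc_super_def by (simp add: JT0_def)
  qed
qed

section \<open>Semicontinuous envelopes\<close>

lemma usc_env_ge: "(t, x) \<in> D \<Longrightarrow> x \<in> J \<Longrightarrow> ereal (u t x) \<le> usc_env_e N e D u t x"
  unfolding usc_env_e_def by (intro INF_greatest SUP_upper2[of "(t, x)"]) (auto simp: pdist_refl)

lemma lsc_env_le: "(t, x) \<in> D \<Longrightarrow> x \<in> J \<Longrightarrow> lsc_env_e N e D u t x \<le> ereal (u t x)"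
  unfolding lsc_env_e_def by (intro SUP_least INF_lower2[of "(t, x)"]) (auto simp: pdist_refl)

lemma usc_env_eq:
  assumes u: "usc_on N e D u" and x: "(t, x) \<in> D" "x \<in> J"
  shows "usc_env_e N e D u t x = ereal (u t x)"
proof (rule antisym[OF _ usc_env_ge[OF x]])
  show "usc_env_e N e D u t x \<le> ereal (u t x)"
  proof (rule ereal_le_epsilon2)
    fix \<epsilon> :: real assume "\<epsilon> > 0"
    then obtain \<delta> where \<delta>: "\<delta> > 0" "\<And>Q. Q \<in> D \<Longrightarrow> pdist N e Q (t, x) < \<delta> \<Longrightarrow> u (fst Q) (snd Q) < u t x + \<epsilon>"
      using u x unfolding usc_on_def by force
    then show "usc_env_e N e D u t x \<le> ereal (u t x) + ereal \<epsilon>"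
      unfolding usc_env_e_def by (intro INF_lower2[of \<delta>] SUP_least) (auto intro: less_imp_le)
  qed
qed

lemma lsc_env_eq:
  assumes u: "lsc_on N e D u" and x: "(t, x) \<in> D" "x \<in> J"
  shows "lsc_env_e N e D u t x = ereal (u t x)"
proof (rule antisym[OF lsc_env_le[OF x]])
  show "ereal (u t x) \<le> lsc_env_e N e D u t x"
  proof (rule ereal_le_epsilon2)
    fix \<epsilon> :: real assume "\<epsilon> > 0"
    then obtain \<delta> where \<delta>: "\<delta> > 0" "\<And>Q. Q \<in> D \<Longrightarrow> pdist N e Q (t, x) < \<delta> \<Longrightarrow> u t x - \<epsilon> < u (fst Q) (snd Q)"
      using u x unfolding lsc_on_def by force
    then have "ereal (u t x - \<epsilon>) \<le> lsc_env_e N e D u t x"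
      unfolding lsc_env_e_def by (intro SUP_upper2[of \<delta>] INF_greatest) (auto intro: less_imp_le)
    then show "ereal (u t x) \<le> lsc_env_e N e D u t x + ereal \<epsilon>"
      by (cases "lsc_env_e N e D u t x") auto
  qed
qed

lemma env_cong:
  assumes "\<And>t x. (t, x) \<in> D \<Longrightarrow> u t x = v t x"
  shows "usc_env_e N e D u = usc_env_e N e D v" "lsc_env_e N e D u = lsc_env_e N e D v"
proof -
  have "u (fst Q) (snd Q) = v (fst Q) (snd Q)" if "Q \<in> D" for Q by (rule assms) (simp add: that)
  then show "usc_env_e N e D u = usc_env_e N e D v" "lsc_env_e N e D u = lsc_env_e N e D v"
    unfolding usc_env_e_def lsc_env_e_def by (auto intro!: ext INF_cong SUP_cong)
qed

lemma visc_sol_uval: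
  assumes T: "T > 0" and u: "\<And>t x. (t, x) \<in> JT0 N e T \<Longrightarrow> u t x = uval t x"
  shows "visc_sol N e Lag T u0 u"
proof -
  have 1: "usc_env_e N e (JT0 N e T) u t x = ereal (uval t x)" "lsc_env_e N e (JT0 N e T) u t x = ereal (uval t x)"
    if "(t, x) \<in> JT0 N e T" for t x
  proof -
    have "x \<in> J" using that by (simp add: JT0_def)
    then show "usc_env_e N e (JT0 N e T) u t x = ereal (uval t x)" "lsc_env_e N e (JT0 N e T) u t x = ereal (uval t x)"
      using env_cong[of "JT0 N e T" u uval, OF u] usc_env_eq[OF usc_uval that] lsc_env_eq[OF lsc_uval that] by auto
  qed
  show ?thesis unfolding visc_sol_def
  proof (intro conjI)
    show "visc_sub N e Lag T u0 (\<lambda>t x. real_of_ereal (usc_env_e N e (JT0 N e T) u t x))"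
      using 1 by (intro visc_sub_cong[OF _ T visc_sub_uval]) simp
    show "visc_super N e Lag T u0 (\<lambda>t x. real_of_ereal (lsc_env_e N e (JT0 N e T) u t x))"
      using 1 by (intro visc_super_cong[OF _ T visc_super_uval]) simp
  qed (use 1 in auto)
qed

end

subsection \<open>Lower semicontinuous functions on subsets\<close>

text \<open>Stated for the subspace topology so that it passes through continuous changes of
  variables. On one branch \<open>pdist\<close> is the Euclidean distance of the coordinates, and
  the junction itself can then be left out of the compactness arguments.\<close>

definition lsc_set :: "'a::topological_space set \<Rightarrow> ('a \<Rightarrow> real) \<Rightarrow> bool" where
  "lsc_set D f \<longleftrightarrow> (\<forall>c. openin (top_of_set D) {x \<in> D. c < f x})"

lemma lsc_setI:
  assumes "\<And>x c. x \<in> D \<Longrightarrow> c < f x \<Longrightarrow> \<exists>W. open W \<and> x \<in> W \<and> (\<forall>y\<in>W \<inter> D. c < f y)"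
  shows "lsc_set D f"
  unfolding lsc_set_def
proof
  fix c
  show "openin (top_of_set D) {x \<in> D. c < f x}"
  proof (subst openin_subopen, intro ballI)
    fix x assume "x \<in> {x \<in> D. c < f x}"
    then obtain W where "open W" "x \<in> W" "\<forall>y\<in>W \<inter> D. c < f y" "x \<in> D" using assms by blast
    then show "\<exists>T. openin (top_of_set D) T \<and> x \<in> T \<and> T \<subseteq> {x \<in> D. c < f x}"
      by (intro exI[of _ "D \<inter> W"]) auto
  qed
qed

lemma lsc_set_continuous: "continuous_on D f \<Longrightarrow> lsc_set D f"
proof -
  assume f: "continuous_on D f"
  have "openin (top_of_set D) (D \<inter> f -` {c<..})" for c
    by (rule continuous_openin_preimage_gen[OF f]) simp
  moreover have "D \<inter> f -` {c<..} = {x \<in> D. c < f x}" for c by auto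
  ultimately show ?thesis by (simp add: lsc_set_def)
qed

lemma lsc_set_add:
  assumes "lsc_set D f" "lsc_set D g" shows "lsc_set D (\<lambda>x. f x + g x)"
  unfolding lsc_set_def
proof
  fix c
  have "{x \<in> D. c < f x + g x} = (\<Union>a. {x \<in> D. a < f x} \<inter> {x \<in> D. c - a < g x})" (is "?L = ?R")
  proof
    show "?L \<subseteq> ?R"
    proof
      fix x assume x: "x \<in> ?L"
      define a where "a = f x - (f x + g x - c) / 2"
      have "a < f x \<and> c - a < g x" using x by (simp add: a_def field_simps)
      then show "x \<in> ?R" using x by blast
    qed
  qed auto
  then show "openin (top_of_set D) ?L"
    using assms unfolding lsc_set_def by (auto intro!: openin_Union)
qed

lemma lsc_set_compose:
  assumes f: "lsc_set E f" and g: "continuous_on D g" "g ` D \<subseteq> E"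
  shows "lsc_set D (\<lambda>x. f (g x))"
  unfolding lsc_set_def
proof
  fix c
  have "openin (top_of_set D) (D \<inter> g -` {x \<in> E. c < f x})"
    using f g unfolding lsc_set_def by (intro continuous_openin_preimage[of _ _ E]) auto
  moreover have "D \<inter> g -` {x \<in> E. c < f x} = {x \<in> D. c < f (g x)}" using g by auto
  ultimately show "openin (top_of_set D) {x \<in> D. c < f (g x)}" by simp
qed

lemma lsc_set_subset:
  assumes "lsc_set E f" "D \<subseteq> E" shows "lsc_set D f"
  using lsc_set_compose[OF assms(1) continuous_on_id, of D] assms(2) by (simp add: id_def)

text \<open>Without a minimiser the superlevel sets of the values of f would cover S; in a finite
  subcover the point with the smallest of these values is not covered.\<close>

lemma lsc_set_attains_inf:
  assumes S: "compact S" "S \<noteq> {}" and f: "lsc_set S f"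
  shows "\<exists>x\<in>S. \<forall>y\<in>S. f x \<le> f y"
proof (rule ccontr)
  assume "\<not> (\<exists>x\<in>S. \<forall>y\<in>S. f x \<le> f y)"
  then have "\<forall>x\<in>S. \<exists>y\<in>S. f y < f x" by (auto simp: not_le)
  then have "S \<subseteq> \<Union>((\<lambda>y. {x \<in> S. f y < f x}) ` S)" by auto
  moreover have "\<forall>V\<in>(\<lambda>y. {x \<in> S. f y < f x}) ` S. openin (top_of_set S) V"
    using f by (auto simp: lsc_set_def)
  ultimately obtain \<V> where \<V>: "\<V> \<subseteq> (\<lambda>y. {x \<in> S. f y < f x}) ` S" "finite \<V>" "S \<subseteq> \<Union>\<V>"
    using S(1)[unfolded compact_eq_openin_cover, THEN spec, of "(\<lambda>y. {x \<in> S. f y < f x}) ` S"] by blast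
  then obtain Y where Y: "Y \<subseteq> S" "finite Y" "\<V> = (\<lambda>y. {x \<in> S. f y < f x}) ` Y"
    using finite_subset_image[OF \<V>(2,1)] by blast
  then have "Y \<noteq> {}" using \<V> S by auto
  then obtain y0 where y0: "y0 \<in> Y" "\<And>y. y \<in> Y \<Longrightarrow> f y0 \<le> f y"
    using ex_min_if_finite[of "f ` Y"] Y(2) by (force simp: not_less)
  then obtain y where "y \<in> Y" "f y < f y0" using \<V>(3) Y by blast
  then show False using y0(2) by force
qed

text \<open>The blow-up term \<open>\<kappa> / (t1 - \<tau>)\<close> and the linear growth in \<open>z\<close> compensate for the noncompact domain.\<close>

lemma blowup_attains_inf:
  fixes F :: "nat \<Rightarrow> real \<times> real \<times> real \<Rightarrow> real"
  assumes A: "finite A" "A \<noteq> {}" and st: "s < t1" and \<kappa>: "\<kappa> > 0"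
    and D: "D = {(\<tau>, z, \<theta>). s \<le> \<tau> \<and> \<tau> < t1 \<and> 0 \<le> z \<and> 0 \<le> \<theta> \<and> \<theta> \<le> t1 - \<tau>}"
    and F: "\<And>j. j \<in> A \<Longrightarrow> lsc_set D (F j)"
    and coer: "\<And>j \<tau> z \<theta>. j \<in> A \<Longrightarrow> (\<tau>, z, \<theta>) \<in> D \<Longrightarrow> F j (\<tau>, z, \<theta>) \<ge> z - C + \<kappa> / (t1 - \<tau>)"
  obtains j \<tau> z \<theta> where "j \<in> A" "(\<tau>, z, \<theta>) \<in> D"
    "\<And>k y. k \<in> A \<Longrightarrow> y \<in> D \<Longrightarrow> F j (\<tau>, z, \<theta>) \<le> F k y"
proof -
  obtain j0 where j0: "j0 \<in> A" using A by auto
  define m where "m = F j0 (s, 0, 0)"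
  \<comment> \<open>Outside the compact set S either z or the blow-up term exceeds or reaches E, so
    F is at least E - C, which is larger than the value m at a reference point of S.\<close>
  define E where "E = \<bar>m + C\<bar> + 1"
  have E: "E > 0" "m < E - C" by (auto simp: E_def)
  define \<nu> where "\<nu> = min (\<kappa> / E) (t1 - s)"
  have \<nu>: "\<nu> > 0" "\<nu> \<le> t1 - s" using \<kappa> E st by (auto simp: \<nu>_def)
  define S where "S = ({s..t1 - \<nu>} \<times> {0..E} \<times> {0..t1 - s}) \<inter> {x. snd (snd x) \<le> t1 - fst x}"
  have "compact S" unfolding S_def
    by (intro compact_Int_closed compact_Times compact_Icc closed_Collect_le continuous_intros)
  have SD: "S \<subseteq> D" using \<nu> by (auto simp: S_def D)
  have x0: "(s, 0, 0) \<in> S" using \<nu> st E by (auto simp: S_def)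
  have far: "m \<le> F j y" if j: "j \<in> A" and y: "y \<in> D" "y \<notin> S" for j y
  proof -
    obtain \<tau> z \<theta> where yy: "y = (\<tau>, z, \<theta>)" by (cases y) auto
    have h: "s \<le> \<tau>" "\<tau> < t1" "0 \<le> z" "0 \<le> \<theta>" "\<theta> \<le> t1 - \<tau>" using y(1) by (auto simp: D yy)
    then have or: "\<tau> > t1 - \<nu> \<or> z > E" using y(2) by (auto simp: S_def yy)
    have "\<kappa> / (t1 - \<tau>) \<ge> 0" using \<kappa> h by simp
    moreover have "\<kappa> / (t1 - \<tau>) \<ge> E" if "\<tau> > t1 - \<nu>"
    proof -
      have "t1 - \<tau> \<le> \<kappa> / E" using that by (simp add: \<nu>_def)
      then show ?thesis using E(1) h by (simp add: field_simps)
    qed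
    ultimately have "z + \<kappa> / (t1 - \<tau>) \<ge> E" using or h by auto
    then show ?thesis using coer[OF j y(1)[unfolded yy]] E yy by simp
  qed
  have "\<exists>x\<in>S. \<forall>y\<in>S. F j x \<le> F j y" if "j \<in> A" for j
    using lsc_set_attains_inf[OF \<open>compact S\<close> _ lsc_set_subset[OF F[OF that] SD]] x0 by auto
  then obtain z where z: "\<And>j. j \<in> A \<Longrightarrow> z j \<in> S" "\<And>j y. j \<in> A \<Longrightarrow> y \<in> S \<Longrightarrow> F j (z j) \<le> F j y" by metis
  obtain j where j: "j \<in> A" and jmin: "\<And>k. k \<in> A \<Longrightarrow> F j (z j) \<le> F k (z k)"
    using ex_min_if_finite[of "(\<lambda>j. F j (z j)) ` A"] A by (force simp: not_less)
  have le: "F j (z j) \<le> F k y" if "k \<in> A" "y \<in> D" for k y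
  proof (cases "y \<in> S")
    case True
    then show ?thesis using jmin z that by (meson order_trans)
  next
    case False
    have "F j (z j) \<le> m" using jmin[OF j0] z(2)[OF j0 x0] by (simp add: m_def)
    then show ?thesis using far[OF that False] by linarith
  qed
  show thesis
  proof (cases "z j")
    case (fields \<tau> y \<theta>)
    then show thesis using that[of j \<tau> y \<theta>] le j z(1)[OF j] SD by auto
  qed
qed

section \<open>Quadratic expansions of the ingredients of test functions\<close>

lemma blowup_le_quadratic:
  fixes s t1 \<kappa> :: real
  assumes st: "s < t1" and \<kappa>: "\<kappa> > 0"
  obtains \<rho> k where "\<rho> > 0" "k \<ge> 0"
    "\<And>t. \<bar>t - s\<bar> < \<rho> \<Longrightarrow> t < t1 \<and> \<kappa> / (t1 - t) \<le> \<kappa> / (t1 - s) + \<kappa> / (t1 - s)\<^sup>2 * (t - s) + k * (t - s)\<^sup>2"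
proof -
  define u where "u = t1 - s"
  have u: "u > 0" using st by (simp add: u_def)
  show thesis
  proof (rule that[of "u / 2" "2 * \<kappa> / u ^ 3"])
    fix t assume t: "\<bar>t - s\<bar> < u / 2"
    define h where "h = t - s"
    have h: "\<bar>h\<bar> < u / 2" using t by (simp add: h_def)
    then have uh: "u - h > 0" "u - h \<ge> u / 2" using u by auto
    \<comment> \<open>An identity; only the denominator u - h of the remainder is estimated, by u /
      2.\<close>
    have "\<kappa> / (u - h) = \<kappa> / u + \<kappa> / u\<^sup>2 * h + (\<kappa> / u\<^sup>2 * h\<^sup>2) * (1 / (u - h))"
      using u uh(1) by (simp add: divide_simps power2_eq_square) (simp add: algebra_simps)
    moreover have "(\<kappa> / u\<^sup>2 * h\<^sup>2) * (1 / (u - h)) \<le> (\<kappa> / u\<^sup>2 * h\<^sup>2) * (2 / u)"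
      using uh u \<kappa> by (intro mult_left_mono) (auto simp: field_simps)
    moreover have "(\<kappa> / u\<^sup>2 * h\<^sup>2) * (2 / u) = 2 * \<kappa> / u ^ 3 * h\<^sup>2"
      by (simp add: power2_eq_square power3_eq_cube)
    ultimately have "\<kappa> / (u - h) \<le> \<kappa> / u + \<kappa> / u\<^sup>2 * h + 2 * \<kappa> / u ^ 3 * h\<^sup>2" by linarith
    then show "t < t1 \<and> \<kappa> / (t1 - t) \<le> \<kappa> / (t1 - s) + \<kappa> / (t1 - s)\<^sup>2 * (t - s) + 2 * \<kappa> / u ^ 3 * (t - s)\<^sup>2"
      using uh by (simp add: u_def h_def)
  qed (use u \<kappa> in auto)
qed

lemma square_diff_le: "((a::real) - b)\<^sup>2 \<le> 2 * (a\<^sup>2 + b\<^sup>2)"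
  using zero_le_power2[of "a + b"] by (simp add: power2_eq_square algebra_simps)

lemma weighted_squares_le: "2 * (((q::real) * a)\<^sup>2 + b\<^sup>2) \<le> 2 * (1 + q\<^sup>2) * (a\<^sup>2 + b\<^sup>2)"
proof -
  have "2 * (1 + q\<^sup>2) * (a\<^sup>2 + b\<^sup>2) = 2 * ((q * a)\<^sup>2 + b\<^sup>2) + 2 * (a\<^sup>2 + (q * b)\<^sup>2)"
    by (simp add: power_mult_distrib algebra_simps)
  then show ?thesis by (smt (verit) zero_le_power2)
qed

context junction_hj
begin

text \<open>As long as speeds stay bounded, \<open>line_cost\<close> exceeds its tangent plane by at
  most a quadratic error. Here this is rewritten in terms of the starting point (t, x), with the
  target (a, X) fixed.\<close>

lemma line_cost_touch:
  fixes X y :: real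
  assumes i: "i \<in> I" and s: "s < a"
  defines "q \<equiv> (X - y) / (a - s)"
  obtains \<rho> k where "\<rho> > 0" "k \<ge> 0"
    "\<And>t x. \<bar>t - s\<bar> < \<rho> \<Longrightarrow> \<bar>x - y\<bar> < \<rho> \<Longrightarrow> t < a \<and>
      line_cost i (a - t) (X - x) \<le> line_cost i (a - s) (X - y) - (Lag i q - q * dLag i q) * (t - s)
         - dLag i q * (x - y) + k * ((t - s)\<^sup>2 + (x - y)\<^sup>2)"
proof -
  define w where "w = a - s"
  have w: "w > 0" using s by (simp add: w_def)
  \<comment> \<open>Bounds all speeds that occur when x is within 1 of y and at least half of the
    duration w is left.\<close>
  define R where "R = (\<bar>X\<bar> + \<bar>y\<bar> + 1) * 2 / w"
  obtain M where M: "M \<ge> 0"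
    "\<And>q0 q. \<bar>q0\<bar> \<le> R \<Longrightarrow> \<bar>q\<bar> \<le> R \<Longrightarrow> Lag i q \<le> Lag i q0 + dLag i q0 * (q - q0) + M * (q - q0)\<^sup>2"
    using Lag_le_quadratic[OF i] by blast
  have Xy: "X - y = q * w" using w by (simp add: q_def w_def)
  have qR: "\<bar>q\<bar> \<le> R"
  proof -
    have "\<bar>q\<bar> = \<bar>X - y\<bar> / w" using w by (simp add: q_def w_def abs_divide)
    also have "\<dots> \<le> R" unfolding R_def using w by (intro divide_right_mono) auto
    finally show ?thesis .
  qed
  define k where "k = 2 * M / w * (2 * (1 + q\<^sup>2))"
  show thesis
  proof (rule that[of "min 1 (w / 2)" k])
    fix t x assume t: "\<bar>t - s\<bar> < min 1 (w / 2)" and x: "\<bar>x - y\<bar> < min 1 (w / 2)"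
    define r where "r = a - t"
    have "\<bar>t - s\<bar> < w / 2" using t by simp
    then have "t - s < w / 2" by linarith
    moreover have "r = w - (t - s)" by (simp add: r_def w_def)
    ultimately have r: "r \<ge> w / 2" using field_sum_of_halves[of w] by linarith
    then have r0: "r > 0" using w by linarith
    note r = r r0
    have "\<bar>(X - x) / r\<bar> = \<bar>X - x\<bar> / r" using r by (simp add: abs_divide)
    also have "\<dots> \<le> (\<bar>X\<bar> + \<bar>y\<bar> + 1) / r" using x r by (intro divide_right_mono) auto
    also have "\<dots> \<le> (\<bar>X\<bar> + \<bar>y\<bar> + 1) / (w / 2)" using r w by (intro divide_left_mono) auto
    also have "\<dots> = R" by (simp add: R_def)
    finally have xR: "\<bar>(X - x) / r\<bar> \<le> R" .
    have 1: "line_cost i r (X - x) \<le> r * (Lag i q - q * dLag i q) + dLag i q * (X - x) + M / r * (X - x - q * r)\<^sup>2"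
      using M(2)[OF qR xR] M(1) r i by (intro line_cost_le_quadratic) auto
    have 2: "line_cost i w (X - y) = w * (Lag i q - q * dLag i q) + dLag i q * (X - y)"
      using line_cost_speed[OF w, of i q] Xy by (simp add: algebra_simps)
    have "X - x - q * r = q * (t - s) - (x - y)" using Xy by (simp add: r_def w_def algebra_simps)
    then have "(X - x - q * r)\<^sup>2 \<le> 2 * ((q * (t - s))\<^sup>2 + (x - y)\<^sup>2)" using square_diff_le by metis
    also have "\<dots> \<le> 2 * (1 + q\<^sup>2) * ((t - s)\<^sup>2 + (x - y)\<^sup>2)" by (rule weighted_squares_le)
    finally have sq: "(X - x - q * r)\<^sup>2 \<le> 2 * (1 + q\<^sup>2) * ((t - s)\<^sup>2 + (x - y)\<^sup>2)" .
    have M2: "M / (w / 2) = 2 * M / w" by simp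
    have "M / r \<le> M / (w / 2)" using r w M by (intro divide_left_mono) auto
    then have "M / r * (X - x - q * r)\<^sup>2 \<le> M / (w / 2) * (2 * (1 + q\<^sup>2) * ((t - s)\<^sup>2 + (x - y)\<^sup>2))"
      using sq M w by (intro mult_mono) auto
    then have 3: "M / r * (X - x - q * r)\<^sup>2 \<le> k * ((t - s)\<^sup>2 + (x - y)\<^sup>2)" unfolding k_def by (simp only: M2 mult.assoc)
    have "r * (Lag i q - q * dLag i q) + dLag i q * (X - x) =
        w * (Lag i q - q * dLag i q) + dLag i q * (X - y) - (Lag i q - q * dLag i q) * (t - s) - dLag i q * (x - y)"
      by (simp add: r_def w_def algebra_simps)
    then show "t < a \<and> line_cost i (a - t) (X - x) \<le> line_cost i (a - s) (X - y) - (Lag i q - q * dLag i q) * (t - s)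
         - dLag i q * (x - y) + k * ((t - s)\<^sup>2 + (x - y)\<^sup>2)"
      using 1 2 3 r by (simp add: r_def w_def)
  qed (use w M in \<open>auto simp: k_def\<close>)
qed

lemma lsc_set_branch:
  assumes v: "lsc_on N e (JT0 N e T) v" and i: "i \<in> I"
  shows "lsc_set ({0..<T} \<times> {0..}) (\<lambda>z. v (fst z) (snd z *\<^sub>R e i))"
proof (rule lsc_setI)
  fix z c assume z: "z \<in> {0..<T} \<times> {0..}" and c: "c < v (fst z) (snd z *\<^sub>R e i)"
  let ?P = "(fst z, snd z *\<^sub>R e i)"
  have P: "?P \<in> JT0 N e T" using z scaleR_in_J[OF i] by (auto simp: JT0_def)
  obtain \<delta> where \<delta>: "\<delta> > 0" and gt: "\<And>Q. Q \<in> JT0 N e T \<Longrightarrow> pdist N e Q ?P < \<delta> \<Longrightarrow>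
      v (fst ?P) (snd ?P) - (v (fst ?P) (snd ?P) - c) < v (fst Q) (snd Q)"
    using v P c unfolding lsc_on_def by (metis diff_gt_0_iff_gt fst_conv snd_conv)
  show "\<exists>W. open W \<and> z \<in> W \<and> (\<forall>y\<in>W \<inter> {0..<T} \<times> {0..}. c < v (fst y) (snd y *\<^sub>R e i))"
  proof (intro exI[of _ "ball z \<delta>"] conjI ballI)
    fix y assume y: "y \<in> ball z \<delta> \<inter> {0..<T} \<times> {0..}"
    have "pdist N e (fst y, snd y *\<^sub>R e i) ?P = dist (fst y, snd y) (fst z, snd z)"
      using y z i by (intro pdist_same) auto
    then have "pdist N e (fst y, snd y *\<^sub>R e i) ?P < \<delta>" using y by (simp add: dist_commute)
    then show "c < v (fst y) (snd y *\<^sub>R e i)"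
      using gt[of "(fst y, snd y *\<^sub>R e i)"] y scaleR_in_J[OF i] by (auto simp: JT0_def)
  qed (use \<delta> in auto)
qed

lemma lsc_on_uminus: "usc_on N e D u \<Longrightarrow> lsc_on N e D (\<lambda>t x. - u t x)"
  unfolding usc_on_def lsc_on_def by (smt (verit))

subsection \<open>Comparison with supersolutions\<close>

text \<open>Minus the cost to go solves the equation along its own speed q, because
  \<open>Ham_dLag\<close> cancels its time derivative. The term c * t and the blow-up term turn this
  into a strict subsolution, which cannot touch v from below.\<close>

lemma super_interior_contradiction:
  assumes v: "visc_super N e Lag T w v" and s: "0 < s" "s < T" and i: "i \<in> I" and y: "y > 0"
    and a: "s < a" "s < t1" and c: "c > 0" and \<kappa>: "\<kappa> > 0" and r: "r > 0"
    and min: "\<And>t x. \<bar>t - s\<bar> < r \<Longrightarrow> \<bar>x - y\<bar> < r \<Longrightarrow> 0 < t \<Longrightarrow> 0 \<le> x \<Longrightarrow> t < a \<Longrightarrow> t < t1 \<Longrightarrow>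
       v s (y *\<^sub>R e i) + line_cost i (a - s) (X - y) + c * s + \<kappa> / (t1 - s)
       \<le> v t (x *\<^sub>R e i) + line_cost i (a - t) (X - x) + c * t + \<kappa> / (t1 - t)"
  shows False
proof -
  define q where "q = (X - y) / (a - s)"
  obtain \<rho>1 k1 where 1: "\<rho>1 > 0" "k1 \<ge> 0"
    "\<And>t x. \<bar>t - s\<bar> < \<rho>1 \<Longrightarrow> \<bar>x - y\<bar> < \<rho>1 \<Longrightarrow> t < a \<and>
      line_cost i (a - t) (X - x) \<le> line_cost i (a - s) (X - y) - (Lag i q - q * dLag i q) * (t - s)
         - dLag i q * (x - y) + k1 * ((t - s)\<^sup>2 + (x - y)\<^sup>2)"
    using line_cost_touch[OF i a(1), where X = X and y = y] unfolding q_def by metis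
  obtain \<rho>2 k2 where 2: "\<rho>2 > 0" "k2 \<ge> 0"
    "\<And>t. \<bar>t - s\<bar> < \<rho>2 \<Longrightarrow> t < t1 \<and> \<kappa> / (t1 - t) \<le> \<kappa> / (t1 - s) + \<kappa> / (t1 - s)\<^sup>2 * (t - s) + k2 * (t - s)\<^sup>2"
    using blowup_le_quadratic[OF a(2) \<kappa>] by metis
  have "(Lag i q - q * dLag i q - c - \<kappa> / (t1 - s)\<^sup>2) + Ham Lag i (dLag i q) \<ge> 0"
  proof (rule visc_super_jet[OF v s i y, of "min r (min \<rho>1 \<rho>2)" _ _ "k1 + k2"])
    fix t x assume h: "0 < t" "t < T" "0 \<le> x" "\<bar>t - s\<bar> < min r (min \<rho>1 \<rho>2)" "\<bar>x - y\<bar> < min r (min \<rho>1 \<rho>2)"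
    have "t < a" and A: "line_cost i (a - t) (X - x) \<le> line_cost i (a - s) (X - y) - (Lag i q - q * dLag i q) * (t - s)
         - dLag i q * (x - y) + k1 * ((t - s)\<^sup>2 + (x - y)\<^sup>2)" using 1(3)[of t x] h by auto
    have "t < t1" and B: "\<kappa> / (t1 - t) \<le> \<kappa> / (t1 - s) + \<kappa> / (t1 - s)\<^sup>2 * (t - s) + k2 * (t - s)\<^sup>2"
      using 2(3)[of t] h by auto
    have C: "k2 * (t - s)\<^sup>2 \<le> k2 * ((t - s)\<^sup>2 + (x - y)\<^sup>2)" using 2(2) by (intro mult_left_mono) auto
    have D: "(Lag i q - q * dLag i q - c - \<kappa> / (t1 - s)\<^sup>2) * (t - s) =
       (Lag i q - q * dLag i q) * (t - s) - (c * t - c * s) - \<kappa> / (t1 - s)\<^sup>2 * (t - s)"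
      by (simp add: algebra_simps)
    have E: "(k1 + k2) * ((t - s)\<^sup>2 + (x - y)\<^sup>2) = k1 * ((t - s)\<^sup>2 + (x - y)\<^sup>2) + k2 * ((t - s)\<^sup>2 + (x - y)\<^sup>2)"
      by (rule distrib_right)
    from min[of t x] show "v s (y *\<^sub>R e i) + (Lag i q - q * dLag i q - c - \<kappa> / (t1 - s)\<^sup>2) * (t - s) + dLag i q * (x - y)
        - (k1 + k2) * ((t - s)\<^sup>2 + (x - y)\<^sup>2) \<le> v t (x *\<^sub>R e i)"
      unfolding D E using A B C h \<open>t < a\<close> \<open>t < t1\<close> by simp
  qed (use r 1 2 in auto)
  moreover have "\<kappa> / (t1 - s)\<^sup>2 \<ge> 0" using \<kappa> by simp
  ultimately show False using Ham_dLag[OF i, of q] c by linarith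
qed

text \<open>The line from the origin that touches the graph of \<open>\<rho> \<mapsto> Lag i (- \<rho>) - l0 + \<delta>\<close> gives the slope on branch \<open>i\<close>
  of a test function that is a strict subsolution at the vertex.\<close>

lemma Ham_minus_slope:
  assumes i: "i \<in> I" and \<delta>: "\<delta> > 0"
  obtains \<sigma> where "\<sigma> > 0" "Ham_minus Lag i (- (Lag i (- \<sigma>) - l0) / \<sigma>) \<le> - l0 + \<delta>"
proof -
  define g where "g = (\<lambda>\<rho>. Lag i (- \<rho>) - l0 + \<delta>)"
  \<comment> \<open>The point \<rho> = 1 shows that m bounds the least slope g \<rho> /
    \<rho>.\<close>
  define m where "m = \<bar>g 1\<bar> + 1"
  obtain C where C: "C \<ge> 0" "\<And>j q. j \<in> I \<Longrightarrow> Lag j q \<ge> (m + 1) * \<bar>q\<bar> - C" using Lag_superlinear by blast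
  have gc: "continuous_on S g" for S
    unfolding g_def by (intro continuous_intros continuous_on_compose2[OF Lag_continuous[OF i, of UNIV]]) auto
  have "g 0 > 0" using l0_le[OF i] \<delta> by (simp add: g_def)
  then have "eventually (\<lambda>\<rho>. g \<rho> > g 0 / 2) (at 0)"
    using gc[of UNIV] by (intro order_tendstoD) (auto simp: continuous_on_def)
  then obtain d where d: "d > 0" "\<And>\<rho>. \<bar>\<rho>\<bar> < d \<Longrightarrow> \<rho> \<noteq> 0 \<Longrightarrow> g \<rho> > g 0 / 2"
    unfolding eventually_at by (auto simp: dist_real_def)
  \<comment> \<open>Below r0 the function g is at least g 0 / 2 while a line of slope m is at most
    that; above r1, superlinearity puts g over this line. So the minimal slope over [r0, r1], which
    contains 1, is minimal over all \<rho> > 0.\<close>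
  define r0 where "r0 = min (d / 2) (min 1 (g 0 / (2 * m)))"
  have m: "m > 0" by (simp add: m_def)
  have r0: "r0 > 0" "r0 \<le> 1" using d \<open>g 0 > 0\<close> m by (auto simp: r0_def)
  define r1 where "r1 = 1 + C + \<bar>l0\<bar>"
  have r1: "r1 \<ge> 1" using C by (simp add: r1_def)
  have "\<exists>\<sigma>\<in>{r0..r1}. \<forall>\<rho>\<in>{r0..r1}. g \<sigma> / \<sigma> \<le> g \<rho> / \<rho>"
    by (rule continuous_attains_inf) (use r0 r1 gc in \<open>auto intro!: continuous_intros\<close>)
  then obtain \<sigma> where \<sigma>: "r0 \<le> \<sigma>" "\<sigma> \<le> r1" and min: "\<And>\<rho>. r0 \<le> \<rho> \<Longrightarrow> \<rho> \<le> r1 \<Longrightarrow> g \<sigma> / \<sigma> \<le> g \<rho> / \<rho>" by auto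
  have \<sigma>0: "\<sigma> > 0" using \<sigma> r0 by linarith
  have g1: "g \<sigma> / \<sigma> \<le> m" using min[of 1] r0 r1 by (simp add: m_def)
  have all: "g \<sigma> / \<sigma> * \<rho> \<le> g \<rho>" if \<rho>: "\<rho> \<ge> 0" for \<rho>
  proof -
    consider "\<rho> = 0" | "0 < \<rho>" "\<rho> < r0" | "r0 \<le> \<rho>" "\<rho> \<le> r1" | "\<rho> > r1" using \<rho> by linarith
    then show ?thesis
    proof cases
      case 1
      then show ?thesis using \<open>g 0 > 0\<close> by simp
    next
      case 2
      have "g \<sigma> / \<sigma> * \<rho> \<le> m * \<rho>" using g1 \<rho> by (intro mult_right_mono) auto
      also have "\<dots> \<le> m * (g 0 / (2 * m))" using 2 m by (intro mult_left_mono) (auto simp: r0_def)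
      also have "\<dots> = g 0 / 2" using m by simp
      also have "\<dots> \<le> g \<rho>" using d(2)[of \<rho>] 2 by (auto simp: r0_def)
      finally show ?thesis .
    next
      case 3
      then have "\<rho> > 0" using r0 by linarith
      then show ?thesis using min[OF 3] by (simp add: pos_le_divide_eq)
    next
      case 4
      have "g \<sigma> / \<sigma> * \<rho> \<le> m * \<rho>" using g1 \<rho> by (intro mult_right_mono) auto
      also have "\<dots> \<le> (m + 1) * \<rho> - C - l0" using 4 by (simp add: r1_def algebra_simps)
      also have "\<dots> \<le> g \<rho>" using C(2)[OF i, of "- \<rho>"] \<rho> \<delta> by (simp add: g_def)
      finally show ?thesis .
    qed
  qed
  show thesis
  proof (rule that[OF \<sigma>0], rule Ham_minus_le)
    fix q :: real assume q: "q \<le> 0"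
    \<comment> \<open>The slope in the conclusion omits \<delta>, so that it is exactly the extra
      cost per unit of distance of running to the vertex at speed \<sigma> compared with waiting
      there.\<close>
    have "(Lag i (- \<sigma>) - l0) / \<sigma> * (- q) \<le> g \<sigma> / \<sigma> * (- q)"
      using q \<sigma>0 \<delta> by (intro mult_right_mono divide_right_mono) (auto simp: g_def)
    also have "\<dots> \<le> g (- q)" using all[of "- q"] q by simp
    finally have "(Lag i (- \<sigma>) - l0) / \<sigma> * (- q) \<le> g (- q)" .
    moreover have "- x / \<sigma> * q = x / \<sigma> * (- q)" for x by simp
    ultimately show "- (Lag i (- \<sigma>) - l0) / \<sigma> * q - Lag i q \<le> - l0 + \<delta>" by (simp only: g_def) simp
  qed
qed

text \<open>Covering a distance \<open>x \<noteq> 0\<close> in time 0 should cost infinity, while \<open>line_cost i 0 x = 0\<close>. A large finite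
  value there keeps the function real valued, lower semicontinuous and coercive.\<close>

definition line_cost0 :: "nat \<Rightarrow> real \<Rightarrow> real \<Rightarrow> real \<Rightarrow> real" where
  "line_cost0 i M \<tau> x = (if \<tau> > 0 then line_cost i \<tau> x else if x = 0 then 0 else M + (K + 1) * \<bar>x\<bar>)"

text \<open>Only \<tau> = 0 needs an argument. Near (0, 0) the cost is at least -C * \<tau>; near
  (0, x) with x \<noteq> 0 superlinearity with slope P lifts it above the level c.\<close>

lemma line_cost0_lsc:
  assumes i: "i \<in> I" and M: "M \<ge> 0"
  shows "lsc_set ({0..} \<times> UNIV) (\<lambda>z. line_cost0 i M (fst z) (snd z))"
proof (rule lsc_setI)
  fix z :: "real \<times> real" and c
  assume z: "z \<in> {0..} \<times> UNIV" and c: "c < line_cost0 i M (fst z) (snd z)"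
  obtain \<tau> x where zz: "z = (\<tau>, x)" by (cases z)
  show "\<exists>W. open W \<and> z \<in> W \<and> (\<forall>y\<in>W \<inter> {0..} \<times> UNIV. c < line_cost0 i M (fst y) (snd y))"
  proof (cases "\<tau> > 0")
    case True
    have "continuous_on ({0<..} \<times> UNIV) (\<lambda>z. line_cost i (fst z) (snd z))"
      using line_cost_continuous[OF i] by (simp add: case_prod_unfold)
    then have "open (({0<..} \<times> UNIV) \<inter> (\<lambda>z. line_cost i (fst z) (snd z)) -` {c<..})"
      by (rule continuous_open_preimage) (auto intro: open_Times)
    then show ?thesis using c True
      by (intro exI[of _ "({0<..} \<times> UNIV) \<inter> (\<lambda>z. line_cost i (fst z) (snd z)) -` {c<..}"])
        (auto simp: zz line_cost0_def)
  next
    case False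
    then have \<tau>: "\<tau> = 0" using z by (simp add: zz)
    show ?thesis
    proof (cases "x = 0")
      case True
      then have c0: "c < 0" using c by (simp add: zz \<tau> line_cost0_def)
      obtain C where C: "\<And>j q. j \<in> I \<Longrightarrow> Lag j q \<ge> 0 * \<bar>q\<bar> - C" using Lag_superlinear by blast
      show ?thesis
      proof (intro exI[of _ "{y. c < - (C * fst y)}"] conjI ballI)
        show "open {y::real \<times> real. c < - (C * fst y)}" by (intro open_Collect_less continuous_intros)
        show "z \<in> {y. c < - (C * fst y)}" using c0 by (simp add: zz \<tau>)
        fix y assume "y \<in> {y. c < - (C * fst y)} \<inter> {0..} \<times> (UNIV :: real set)"
        then have y: "c < - (C * fst y)" "fst y \<ge> 0" by auto
        show "c < line_cost0 i M (fst y) (snd y)"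
          using y c0 M line_cost_coercive[OF i _ C[OF i], of "fst y" "snd y"] K_nonneg
          by (auto simp: line_cost0_def) (smt (verit) mult_nonneg_nonneg abs_ge_zero)
      qed
    next
      case x: False
      then have cM: "c < M + (K + 1) * \<bar>x\<bar>" using c by (simp add: zz \<tau> line_cost0_def)
      define P where "P = (\<bar>c\<bar> + 1) / \<bar>x\<bar>"
      obtain C where C: "\<And>j q. j \<in> I \<Longrightarrow> Lag j q \<ge> P * \<bar>q\<bar> - C" using Lag_superlinear by blast
      let ?W = "{y::real \<times> real. c < P * \<bar>snd y\<bar> - C * fst y} \<inter> {y. c < M + (K + 1) * \<bar>snd y\<bar>} \<inter> {y. snd y \<noteq> 0}"
      show ?thesis
      proof (intro exI[of _ ?W] conjI ballI)
        show "open ?W" by (intro open_Int open_Collect_less open_Collect_neq continuous_intros)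
        show "z \<in> ?W" using cM x by (auto simp: zz \<tau> P_def)
        fix y assume "y \<in> ?W \<inter> {0..} \<times> UNIV"
        then show "c < line_cost0 i M (fst y) (snd y)"
          using line_cost_coercive[OF i _ C[OF i], of "fst y" "snd y"] by (auto simp: line_cost0_def)
      qed
    qed
  qed
qed

text \<open>The target is the vertex at time t1. The continuation from distance z on branch i at
  time \<tau> runs to the vertex for a duration \<theta> and then waits at the rate
  \<open>l0\<close>; F is minimised jointly over i, \<tau>, z and \<theta>. The right-hand side is
  the value of F at the vertex at time t0 with \<theta> = 0.\<close>

lemma super_vertex_approx:
  assumes v: "visc_super N e Lag T u0 v"
    and growth: "\<And>i t x. i \<in> I \<Longrightarrow> 0 \<le> t \<Longrightarrow> t < T \<Longrightarrow> x \<ge> 0 \<Longrightarrow> v t (x *\<^sub>R e i) \<ge> - C0 - K * x"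
    and t: "0 \<le> t0" "t0 < t1" "t1 < T" and c: "c > 0" and \<kappa>: "\<kappa> > 0"
  shows "U 1 t1 0 \<le> v t0 0 + (t1 - t0) * l0 + c * t0 + \<kappa> / (t1 - t0)"
proof -
  define m where "m = v t0 0 + (t1 - t0) * l0 + c * t0 + \<kappa> / (t1 - t0)"
  \<comment> \<open>The penalty in \<open>line_cost0\<close> is taken so large that a minimiser away
    from the vertex has \<theta> > 0.\<close>
  define M where "M = \<bar>m\<bar> + \<bar>C0\<bar> + \<bar>l0\<bar> * t1 + 1"
  have t1: "t1 > 0" using t by simp
  have M: "M \<ge> 0" using t1 by (simp add: M_def)
  define D :: "(real \<times> real \<times> real) set"
    where "D = {(\<tau>, z, \<theta>). 0 \<le> \<tau> \<and> \<tau> < t1 \<and> 0 \<le> z \<and> 0 \<le> \<theta> \<and> \<theta> \<le> t1 - \<tau>}"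
  define F where "F = (\<lambda>i x. v (fst x) (fst (snd x) *\<^sub>R e i) + (line_cost0 i M (snd (snd x)) (- fst (snd x))
     + ((t1 - fst x - snd (snd x)) * l0 + c * fst x + \<kappa> / (t1 - fst x))))"
  obtain C where C: "C \<ge> 0" "\<And>i q. i \<in> I \<Longrightarrow> Lag i q \<ge> (K + 1) * \<bar>q\<bar> - C" using Lag_superlinear by blast
  have l0_bound: "(t1 - \<tau> - \<theta>) * l0 \<ge> - (\<bar>l0\<bar> * t1)" if "0 \<le> \<tau>" "0 \<le> \<theta>" "\<theta> \<le> t1 - \<tau>" for \<tau> \<theta> :: real
  proof -
    have "\<bar>(t1 - \<tau> - \<theta>) * l0\<bar> \<le> t1 * \<bar>l0\<bar>" unfolding abs_mult using that by (intro mult_right_mono) auto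
    then show ?thesis by (simp add: abs_le_iff mult.commute)
  qed
  have lsc: "lsc_set D (F i)" if i: "i \<in> I" for i
    unfolding F_def
  proof (intro lsc_set_add)
    have "lsc_on N e (JT0 N e T) v" using v by (simp add: visc_super_def)
    from lsc_set_branch[OF this i] have "lsc_set D (\<lambda>x. v (fst (fst x, fst (snd x))) (snd (fst x, fst (snd x)) *\<^sub>R e i))"
      by (rule lsc_set_compose) (use t in \<open>auto simp: D_def intro!: continuous_intros\<close>)
    then show "lsc_set D (\<lambda>x. v (fst x) (fst (snd x) *\<^sub>R e i))" by simp
    have "lsc_set D (\<lambda>x. line_cost0 i M (fst (snd (snd x), - fst (snd x))) (snd (snd (snd x), - fst (snd x))))"
      by (rule lsc_set_compose[OF line_cost0_lsc[OF i M]]) (auto simp: D_def intro!: continuous_intros)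
    then show "lsc_set D (\<lambda>x. line_cost0 i M (snd (snd x)) (- fst (snd x)))" by simp
  qed (auto intro!: lsc_set_continuous continuous_intros simp: D_def)
  have coer: "F i (\<tau>, z, \<theta>) \<ge> z - (C0 + C * t1 + \<bar>l0\<bar> * t1) + \<kappa> / (t1 - \<tau>)"
    if i: "i \<in> I" and x: "(\<tau>, z, \<theta>) \<in> D" for i \<tau> z \<theta>
  proof -
    have h: "0 \<le> \<tau>" "\<tau> < t1" "0 \<le> z" "0 \<le> \<theta>" "\<theta> \<le> t1 - \<tau>" using x by (auto simp: D_def)
    have C\<theta>: "C * \<theta> \<le> C * t1" "0 \<le> C * t1" using C h t1 by (auto intro: mult_left_mono)
    have "line_cost0 i M \<theta> (- z) \<ge> (K + 1) * z - C * t1"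
      using line_cost_coercive[OF i _ C(2)[OF i], of \<theta> "- z"] C\<theta> h M by (auto simp: line_cost0_def)
    moreover have "v \<tau> (z *\<^sub>R e i) \<ge> - C0 - K * z" using growth i h t by simp
    moreover have "c * \<tau> \<ge> 0" using c h by simp
    ultimately show ?thesis using l0_bound[OF h(1,4,5)] by (simp add: F_def algebra_simps)
  qed
  obtain i s y \<theta> where i: "i \<in> I" and x: "(s, y, \<theta>) \<in> D"
    and minF: "\<And>k z. k \<in> I \<Longrightarrow> z \<in> D \<Longrightarrow> F i (s, y, \<theta>) \<le> F k z"
    using blowup_attains_inf[where F = F, OF finite_I I_nonempty t1 \<kappa> D_def lsc coer] by blast
  have h: "0 \<le> s" "s < t1" "0 \<le> y" "0 \<le> \<theta>" "\<theta> \<le> t1 - s" using x by (auto simp: D_def)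
  have "(t0, 0, 0) \<in> D" using t by (simp add: D_def)
  from minF[OF one_in_I this] have Fm: "F i (s, y, \<theta>) \<le> m" by (simp add: F_def m_def line_cost0_def)
  have y\<theta>: "\<theta> > 0" if "y > 0"
  proof (rule ccontr)
    assume "\<not> \<theta> > 0"
    then have "line_cost0 i M \<theta> (- y) = M + (K + 1) * y" using that by (simp add: line_cost0_def)
    moreover have "v s (y *\<^sub>R e i) \<ge> - C0 - K * y" using growth i h t by simp
    moreover have "c * s \<ge> 0" "\<kappa> / (t1 - s) \<ge> 0" using c \<kappa> h by auto
    ultimately have "F i (s, y, \<theta>) \<ge> M - C0 + y - \<bar>l0\<bar> * t1"
      using l0_bound[OF h(1,4,5)] by (simp add: F_def algebra_simps)
    moreover have "M - \<bar>l0\<bar> * t1 - C0 > m" unfolding M_def by linarith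
    ultimately show False using Fm that by linarith
  qed
  show ?thesis
  proof (cases "s = 0")
    case True
    \<comment> \<open>From time 0 the minimising continuation is itself a competitor for
      \<open>U\<close> at the target, so \<open>U\<close> there is at most the minimum of F, hence
      at most m.\<close>
    have v0: "v 0 (y *\<^sub>R e i) \<ge> U i 0 y"
      using v scaleR_in_J[OF i h(3)] U_0[OF i h(3)] by (simp add: visc_super_def)
    have "U i \<theta> 0 \<le> U i 0 y + line_cost0 i M \<theta> (- y)"
    proof (cases "\<theta> > 0")
      case True
      then show ?thesis using U_line[of i 0 \<theta> 0 y] i h by (simp add: line_cost0_def)
    next
      case False
      then have "y = 0" "\<theta> = 0" using y\<theta> h by force+
      then show ?thesis by (simp add: line_cost0_def)
    qed
    moreover have "U i t1 0 \<le> U i \<theta> 0 + (t1 - \<theta>) * l0" using U_wait_at_vertex[OF i, of \<theta> t1] h True by simp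
    moreover have "U i t1 0 = U 1 t1 0" by (rule U_turn[OF i one_in_I])
    moreover have "\<kappa> / t1 \<ge> 0" using \<kappa> t1 by simp
    ultimately show ?thesis using v0 Fm True by (simp add: F_def m_def)
  next
    case False
    then have s: "s > 0" using h by simp
    show ?thesis
    proof (cases "y = 0")
      case False
      then have y: "y > 0" using h by simp
      have False
      proof (rule super_interior_contradiction[OF v s _ i y, of "s + \<theta>" t1 c \<kappa> 1 0])
        fix t x assume tx: "\<bar>t - s\<bar> < 1" "\<bar>x - y\<bar> < 1" "0 < t" "0 \<le> x" "t < s + \<theta>" "t < t1"
        \<comment> \<open>The arrival time s + \<theta> is kept fixed, so the waiting time does not
          change and only the line cost towards a fixed target varies.\<close>
        have "(t, x, s + \<theta> - t) \<in> D" using tx h by (simp add: D_def)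
        from minF[OF i this] show "v s (y *\<^sub>R e i) + line_cost i (s + \<theta> - s) (0 - y) + c * s + \<kappa> / (t1 - s)
          \<le> v t (x *\<^sub>R e i) + line_cost i (s + \<theta> - t) (0 - x) + c * t + \<kappa> / (t1 - t)"
          using y\<theta>[OF y] tx by (simp add: F_def line_cost0_def algebra_simps)
      qed (use t h y\<theta>[OF y] c \<kappa> in auto)
      then show ?thesis ..
    next
      case True
      \<comment> \<open>At y = 0 the run of duration \<theta> has speed 0 and may be exchanged for
        waiting, so \<theta> = 0 is also minimal.\<close>
      have min0: "v s 0 + (t1 - s) * l0 + c * s + \<kappa> / (t1 - s) \<le> F k z" if "k \<in> I" "z \<in> D" for k z
      proof -
        have "\<theta> * l0 \<le> line_cost0 i M \<theta> 0"
          using mult_left_mono[OF l0_le[OF i] h(4)] h(4) by (auto simp: line_cost0_def line_cost_def)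
        then have "v s 0 + (t1 - s) * l0 + c * s + \<kappa> / (t1 - s) \<le> F i (s, y, \<theta>)"
          using True by (simp add: F_def algebra_simps)
        then show ?thesis using minF[OF that] by linarith
      qed
      \<comment> \<open>The tolerance c / 2 leaves half of the margin c for the contradiction at the
        end.\<close>
      have "\<exists>\<sigma>>0. Ham_minus Lag j (- (Lag j (- \<sigma>) - l0) / \<sigma>) \<le> - l0 + c / 2" if "j \<in> I" for j
        using Ham_minus_slope[OF that, of "c / 2"] c by auto
      then obtain \<sigma> where \<sigma>: "\<And>j. j \<in> I \<Longrightarrow> \<sigma> j > 0"
        and H: "\<And>j. j \<in> I \<Longrightarrow> Ham_minus Lag j (- (Lag j (- \<sigma> j) - l0) / \<sigma> j) \<le> - l0 + c / 2" by metis
      define \<sigma>m where "\<sigma>m = Min (\<sigma> ` I)"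
      have \<sigma>m: "\<sigma>m > 0" "\<And>j. j \<in> I \<Longrightarrow> \<sigma>m \<le> \<sigma> j"
        using \<sigma> I_nonempty by (auto simp: \<sigma>m_def)
      obtain \<rho> k where \<rho>: "\<rho> > 0" "k \<ge> 0"
        "\<And>t. \<bar>t - s\<bar> < \<rho> \<Longrightarrow> t < t1 \<and> \<kappa> / (t1 - t) \<le> \<kappa> / (t1 - s) + \<kappa> / (t1 - s)\<^sup>2 * (t - s) + k * (t - s)\<^sup>2"
        using blowup_le_quadratic[OF h(2) \<kappa>] by metis
      \<comment> \<open>Small enough for a run at speed \<open>\<sigma> j\<close> from a
        neighbouring point to reach the vertex before t1: at most half of t1 - s is lost in time and
        at most half is spent on the run.\<close>
      define r where "r = min \<rho> (min ((t1 - s) / 2) (\<sigma>m * (t1 - s) / 2))"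
      have r: "r > 0" using \<rho> h \<sigma>m by (simp add: r_def)
      obtain j where j: "j \<in> I" and "(l0 - c - \<kappa> / (t1 - s)\<^sup>2) + Ham_minus Lag j (- (Lag j (- \<sigma> j) - l0) / \<sigma> j) \<ge> 0"
      proof (rule visc_super_jet_vertex[OF v s _ r, of "l0 - c - \<kappa> / (t1 - s)\<^sup>2" "\<lambda>j. - (Lag j (- \<sigma> j) - l0) / \<sigma> j" k])
        fix j t x assume j: "j \<in> I" and tx: "0 < t" "t < T" "0 \<le> x" "\<bar>t - s\<bar> < r" "x < r"
        \<comment> \<open>With this duration the cost of the competitor is affine in (t, x) up to
          the blow-up term, so it can be read as a jet at the vertex.\<close>
        define \<theta>' where "\<theta>' = x / \<sigma> j"
        have x\<theta>: "x = \<theta>' * \<sigma> j" using \<sigma>[OF j] by (simp add: \<theta>'_def)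
        have \<theta>': "\<theta>' \<ge> 0" using \<sigma>[OF j] tx by (simp add: \<theta>'_def)
        have "\<theta>' * \<sigma>m \<le> x" unfolding x\<theta> using \<sigma>m(2)[OF j] \<theta>' by (intro mult_left_mono)
        also have "x \<le> \<sigma>m * (t1 - s) / 2" using tx by (simp add: r_def)
        finally have "\<theta>' * \<sigma>m \<le> (t1 - s) / 2 * \<sigma>m" by (simp add: mult.commute)
        then have "\<theta>' \<le> (t1 - s) / 2" using \<sigma>m(1) by (rule mult_right_le_imp_le)
        moreover have "\<bar>t - s\<bar> < (t1 - s) / 2" using tx by (simp add: r_def)
        then have "t < s + (t1 - s) / 2" by linarith
        moreover have "s + (t1 - s) / 2 + (t1 - s) / 2 = t1" by (simp add: field_simps)
        ultimately have "t < t1" "\<theta>' \<le> t1 - t" using h by linarith+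
        then have "(t, x, \<theta>') \<in> D" using tx \<theta>' by (simp add: D_def)
        from min0[OF j this] have 1: "v s 0 + (t1 - s) * l0 + c * s + \<kappa> / (t1 - s) \<le>
            v t (x *\<^sub>R e j) + line_cost0 j M \<theta>' (- x) + (t1 - t - \<theta>') * l0 + c * t + \<kappa> / (t1 - t)"
          by (simp add: F_def)
        have 2: "line_cost0 j M \<theta>' (- x) = \<theta>' * Lag j (- \<sigma> j)"
          using line_cost_speed[of \<theta>' j "- \<sigma> j"] \<theta>' x\<theta> by (auto simp: line_cost0_def mult.commute)
        have 3: "- (Lag j (- \<sigma> j) - l0) / \<sigma> j * x = - (\<theta>' * Lag j (- \<sigma> j)) + \<theta>' * l0"
        proof -
          have "- y / \<sigma> j * (\<theta>' * \<sigma> j) = - (\<theta>' * y)" for y using \<sigma>[OF j] by simp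
          then show ?thesis unfolding x\<theta> by (simp only:) (simp add: algebra_simps)
        qed
        have 4: "\<kappa> / (t1 - t) \<le> \<kappa> / (t1 - s) + \<kappa> / (t1 - s)\<^sup>2 * (t - s) + k * (t - s)\<^sup>2"
          using \<rho>(3)[of t] tx by (simp add: r_def)
        have 5: "k * (t - s)\<^sup>2 \<le> k * ((t - s)\<^sup>2 + x\<^sup>2)" using \<rho>(2) by (intro mult_left_mono) auto
        have 6: "(l0 - c - \<kappa> / (t1 - s)\<^sup>2) * (t - s) = l0 * (t - s) - (c * t - c * s) - \<kappa> / (t1 - s)\<^sup>2 * (t - s)"
          by (simp add: algebra_simps)
        have 7: "(t1 - s) * l0 - (t1 - t - \<theta>') * l0 = l0 * (t - s) + \<theta>' * l0" by (simp add: algebra_simps)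
        show "v s 0 + (l0 - c - \<kappa> / (t1 - s)\<^sup>2) * (t - s) + - (Lag j (- \<sigma> j) - l0) / \<sigma> j * x
           - k * ((t - s)\<^sup>2 + x\<^sup>2) \<le> v t (x *\<^sub>R e j)"
          unfolding 3 6 using 1 4 5 7 unfolding 2 by linarith
      qed (use t h in auto)
      moreover have "\<kappa> / (t1 - s)\<^sup>2 \<ge> 0" using \<kappa> by simp
      ultimately show ?thesis using H[OF j] c by linarith
    qed
  qed
qed

text \<open>With t1 = t0 + h the Lipschitz bound in time brings \<open>U\<close> back to t0. Taking
  \<kappa> proportional to h keeps the blow-up term at \<epsilon> / 4 while h is small.\<close>

lemma U_le_limit:
  assumes i: "i \<in> I" and x: "x \<ge> 0" and t: "0 \<le> t0" "t0 < T"
    and approx: "\<And>t1 c \<kappa>. t0 < t1 \<Longrightarrow> t1 < T \<Longrightarrow> c > 0 \<Longrightarrow> \<kappa> > 0 \<Longrightarrow>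
      U i t1 x \<le> m + (t1 - t0) * d + c * t0 + \<kappa> / (t1 - t0)"
  shows "U i t0 x \<le> m"
proof (rule field_le_epsilon)
  fix \<epsilon> :: real assume \<epsilon>: "\<epsilon> > 0"
  define h where "h = min ((T - t0) / 2) (\<epsilon> / (4 * (\<bar>d\<bar> + B + 1)))"
  have E4: "\<epsilon> / (4 * E) * E = \<epsilon> / 4" if "E > 0" for E :: real using that by simp
  have dB: "\<bar>d\<bar> + B + 1 > 0" using B_nonneg by simp
  have h: "h > 0" "t0 + h < T" using t \<epsilon> dB by (auto simp: h_def min_def field_simps)
  define c where "c = \<epsilon> / (4 * (t0 + 1))"
  have c: "c > 0" "c * t0 \<le> \<epsilon> / 4" using t \<epsilon> by (auto simp: c_def field_simps)
  have "U i (t0 + h) x \<le> m + (t0 + h - t0) * d + c * t0 + (\<epsilon> / 4 * h) / (t0 + h - t0)"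
    using h c \<epsilon> by (intro approx) auto
  then have 1: "U i (t0 + h) x \<le> m + h * d + c * t0 + \<epsilon> / 4" using h by simp
  have 2: "U i t0 x \<le> U i (t0 + h) x + B * h" using U_time_lower i t h x by simp
  have "h * d \<le> h * \<bar>d\<bar>" using h by (intro mult_left_mono) auto
  moreover have "h * (\<bar>d\<bar> + B + 1) = h * \<bar>d\<bar> + B * h + h" by (simp add: algebra_simps)
  ultimately have "h * d + B * h \<le> h * (\<bar>d\<bar> + B + 1)" using h by linarith
  also have "\<dots> \<le> \<epsilon> / (4 * (\<bar>d\<bar> + B + 1)) * (\<bar>d\<bar> + B + 1)" using dB by (intro mult_right_mono) (auto simp: h_def)
  also have "\<dots> = \<epsilon> / 4" by (rule E4[OF dB])
  finally show "U i t0 x \<le> m + \<epsilon>" using 1 2 c \<epsilon> by linarith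
qed

text \<open>With the vertex settled, the continuation to x0 > 0 is a single line in the branch. A
  minimum at time 0 or at the vertex lies where v \<ge> \<open>U\<close> is already known, and
  \<open>U_line\<close> carries this to the target; anywhere else it is contradictory.\<close>

lemma super_comparison:
  assumes v: "visc_super N e Lag T u0 v"
    and growth: "\<And>i t x. i \<in> I \<Longrightarrow> 0 \<le> t \<Longrightarrow> t < T \<Longrightarrow> x \<ge> 0 \<Longrightarrow> v t (x *\<^sub>R e i) \<ge> - C0 - K * x"
    and j: "j \<in> I" and t: "0 \<le> t0" "t0 < T" and x0: "x0 \<ge> 0"
  shows "U j t0 x0 \<le> v t0 (x0 *\<^sub>R e j)"
proof -
  have vertex: "U j s 0 \<le> v s 0" if s: "0 \<le> s" "s < T" for s
  proof -
    have "U 1 s 0 \<le> v s 0"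
      using super_vertex_approx[OF v growth s(1)] by (intro U_le_limit[OF one_in_I order_refl s]) auto
    then show ?thesis using U_turn[OF j one_in_I] by simp
  qed
  show ?thesis
  proof (cases "x0 = 0")
    case True
    then show ?thesis using vertex t by simp
  next
    case False
    obtain C where C: "C \<ge> 0" "\<And>i q. i \<in> I \<Longrightarrow> Lag i q \<ge> (K + 1) * \<bar>q\<bar> - C" using Lag_superlinear by blast
    show ?thesis
    proof (rule U_le_limit[OF j x0 t, of _ "Lag j 0"])
      fix t1 c \<kappa> :: real assume t1: "t0 < t1" "t1 < T" and c: "c > 0" and \<kappa>: "\<kappa> > 0"
      have t1': "0 < t1" using t1 t by simp
      define D :: "(real \<times> real \<times> real) set"
    where "D = {(\<tau>, z, \<theta>). 0 \<le> \<tau> \<and> \<tau> < t1 \<and> 0 \<le> z \<and> 0 \<le> \<theta> \<and> \<theta> \<le> t1 - \<tau>}"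
      \<comment> \<open>The branch index and the third variable are dummies, present to share the
        minimisation lemma with the vertex case.\<close>
      define F :: "nat \<Rightarrow> real \<times> real \<times> real \<Rightarrow> real" where "F = (\<lambda>i x. v (fst x) (fst (snd x) *\<^sub>R e j) + (line_cost j (t1 - fst x) (x0 - fst (snd x))
         + (c * fst x + \<kappa> / (t1 - fst x))))"
      have lsc: "lsc_set D (F i)" for i
        unfolding F_def
      proof (intro lsc_set_add)
        have "lsc_on N e (JT0 N e T) v" using v by (simp add: visc_super_def)
        from lsc_set_branch[OF this j] have "lsc_set D (\<lambda>x. v (fst (fst x, fst (snd x))) (snd (fst x, fst (snd x)) *\<^sub>R e j))"
          by (rule lsc_set_compose) (use t1 in \<open>auto simp: D_def intro!: continuous_intros\<close>)
        then show "lsc_set D (\<lambda>x. v (fst x) (fst (snd x) *\<^sub>R e j))" by simp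
        show "lsc_set D (\<lambda>x. line_cost j (t1 - fst x) (x0 - fst (snd x)))"
          by (rule lsc_set_continuous, rule continuous_on_compose2[OF line_cost_continuous[OF j],
            of _ "\<lambda>x. (t1 - fst x, x0 - fst (snd x))", unfolded prod.case])
            (auto simp: D_def intro!: continuous_intros)
      qed (auto intro!: lsc_set_continuous continuous_intros simp: D_def)
      have coer: "F i (\<tau>, z, \<theta>) \<ge> z - (C0 + C * t1 + (K + 1) * x0) + \<kappa> / (t1 - \<tau>)"
        if x: "(\<tau>, z, \<theta>) \<in> D" for i \<tau> z \<theta>
      proof -
        have h: "0 \<le> \<tau>" "\<tau> < t1" "0 \<le> z" using x by (auto simp: D_def)
        have "line_cost j (t1 - \<tau>) (x0 - z) \<ge> (K + 1) * \<bar>x0 - z\<bar> - C * (t1 - \<tau>)"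
          using h j C by (intro line_cost_coercive) auto
        moreover have "(K + 1) * \<bar>x0 - z\<bar> \<ge> (K + 1) * (z - x0)" using K_nonneg by (intro mult_left_mono) auto
        moreover have "C * (t1 - \<tau>) \<le> C * t1" using C h by (intro mult_left_mono) auto
        moreover have "v \<tau> (z *\<^sub>R e j) \<ge> - C0 - K * z" using growth j h t1 by simp
        moreover have "c * \<tau> \<ge> 0" using c h by simp
        ultimately show ?thesis by (simp add: F_def algebra_simps)
      qed
      obtain i s y \<theta> where "i \<in> {j}" and x: "(s, y, \<theta>) \<in> D"
        and min0: "\<And>k z. k \<in> {j} \<Longrightarrow> z \<in> D \<Longrightarrow> F i (s, y, \<theta>) \<le> F k z"
        using blowup_attains_inf[where F = F and A = "{j}", OF _ _ t1' \<kappa> D_def lsc coer] by blast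
      have minF: "F i (s, y, \<theta>) \<le> F k z" if "k = j" "z \<in> D" for k z using min0[OF _ that(2)] that by simp
      have h: "0 \<le> s" "s < t1" "0 \<le> y" using x by (auto simp: D_def)
      have "(t0, x0, 0) \<in> D" using t t1 x0 by (simp add: D_def)
      from minF[OF refl this] have Fm: "F i (s, y, \<theta>) \<le> v t0 (x0 *\<^sub>R e j) + (t1 - t0) * Lag j 0 + c * t0 + \<kappa> / (t1 - t0)"
        by (simp add: F_def line_cost_def)
      show "U j t1 x0 \<le> v t0 (x0 *\<^sub>R e j) + (t1 - t0) * Lag j 0 + c * t0 + \<kappa> / (t1 - t0)"
      proof (cases "s = 0 \<or> y = 0")
        case True
        have "U j s y \<le> v s (y *\<^sub>R e j)"
        proof (cases "y = 0")
          case True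
          then show ?thesis using vertex h t1 by simp
        next
          case False
          then have "s = 0" using True by simp
          then show ?thesis using v scaleR_in_J[OF j h(3)] U_0[OF j h(3)] by (simp add: visc_super_def)
        qed
        moreover have "U j t1 x0 \<le> U j s y + line_cost j (t1 - s) (x0 - y)" using j h x0 by (intro U_line) auto
        moreover have "c * s \<ge> 0" "\<kappa> / (t1 - s) \<ge> 0" using c \<kappa> h by auto
        ultimately show ?thesis using Fm by (simp add: F_def)
      next
        case False
        then have sy: "s > 0" "y > 0" using h by auto
        have False
        proof (rule super_interior_contradiction[OF v sy(1) _ j sy(2) h(2) h(2) c \<kappa>, of 1 x0])
          fix t x :: real assume tx: "0 < t" "0 \<le> x" "t < t1"
          have "(t, x, 0) \<in> D" using tx by (simp add: D_def)
          from minF[OF refl this] show "v s (y *\<^sub>R e j) + line_cost j (t1 - s) (x0 - y) + c * s + \<kappa> / (t1 - s)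
            \<le> v t (x *\<^sub>R e j) + line_cost j (t1 - t) (x0 - x) + c * t + \<kappa> / (t1 - t)"
            by (simp add: F_def)
        qed (use t1 h in auto)
        then show ?thesis ..
      qed
    qed
  qed
qed


subsection \<open>Comparison with subsolutions\<close>

text \<open>Subsolutions satisfy the dynamic programming inequality along a line \<open>X\<close>: on branch \<open>i\<close> the test function
  grows like a steep parabola around \<open>X\<close>, and on the other branches like a steep cone. The viscosity inequality
  excludes interior maxima, so the maximum is at the initial time, near the starting point.\<close>

lemma sub_dpp_core:
  assumes u: "visc_sub N e Lag T w u"
    and growth: "\<And>i t x. i \<in> I \<Longrightarrow> 0 \<le> t \<Longrightarrow> t < T \<Longrightarrow> x \<ge> 0 \<Longrightarrow> u t (x *\<^sub>R e i) \<le> C0 + K * x"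
    and i: "i \<in> I" and t: "0 \<le> s" "s < t" "t < T" and xy: "x \<ge> 0" "y \<ge> 0"
    and xq: "x = y + q * (t - s)" and q: "q \<le> 0 \<or> y > 0"
  shows "u t (x *\<^sub>R e i) \<le> u s (y *\<^sub>R e i) + (t - s) * Lag i q"
proof (rule field_le_epsilon)
  fix \<epsilon> :: real assume \<epsilon>: "\<epsilon> > 0"
  \<comment> \<open>The three shares go to the blow-up term at t, to the strictness \<delta> over
    the duration t - s, and to upper semicontinuity at the starting point.\<close>
  define \<eta> where "\<eta> = \<epsilon> / 3"
  have \<eta>: "\<eta> > 0" using \<epsilon> by (simp add: \<eta>_def)
  define t1 where "t1 = (t + T) / 2"
  have t1: "t < t1" "t1 < T" "s < t1" using t by (auto simp: t1_def)
  define \<kappa> where "\<kappa> = \<eta> * (t1 - t)"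
  define \<delta> where "\<delta> = \<eta> / (t - s)"
  have \<kappa>: "\<kappa> > 0" and \<delta>: "\<delta> > 0" using \<eta> t1 t by (auto simp: \<kappa>_def \<delta>_def)
  define X where "X = (\<lambda>\<tau>. y + q * (\<tau> - s))"
  have usc: "usc_on N e (JT0 N e T) u" using u by (simp add: visc_sub_def)
  have P0: "(s, y *\<^sub>R e i) \<in> JT0 N e T" using t scaleR_in_J[OF i xy(2)] by (simp add: JT0_def)
  obtain \<rho> where \<rho>: "\<rho> > 0" and near: "\<And>Q. Q \<in> JT0 N e T \<Longrightarrow> pdist N e Q (s, y *\<^sub>R e i) < \<rho> \<Longrightarrow>
      u (fst Q) (snd Q) < u s (y *\<^sub>R e i) + \<eta>"
    using usc P0 \<eta> unfolding usc_on_def by (metis fst_conv snd_conv)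
  \<comment> \<open>Dominates the gap between the growth bound and the value of u at the starting
    point.\<close>
  define E where "E = \<bar>C0\<bar> + K * y + \<bar>u s (y *\<^sub>R e i)\<bar> + 1"
  have E: "E > 0" using K_nonneg xy by (simp add: E_def add_nonneg_pos)
  define Xm where "Xm = y + \<bar>q\<bar> * T"
  have Xm: "\<bar>X \<tau>\<bar> \<le> Xm" if "s \<le> \<tau>" "\<tau> < t1" for \<tau>
  proof -
    have "\<bar>q * (\<tau> - s)\<bar> \<le> \<bar>q\<bar> * T" unfolding abs_mult using that t1 t by (intro mult_left_mono) auto
    then show ?thesis using xy unfolding X_def Xm_def by linarith
  qed
  have Xm0: "Xm \<ge> 0" using xy t by (simp add: Xm_def)
  \<comment> \<open>Matters for q > 0 only: as X \<tau> \<ge> y > 0, the time derivative 2 *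
    \<Lambda> * X \<tau> * q of the parabola at the vertex then exceeds |Lag i q - Lag i 0|.\<close>
  define \<mu> where "\<mu> = (if q > 0 then (\<bar>Lag i q - Lag i 0\<bar> + 1) / (2 * y * q) else 0)"
  \<comment> \<open>One summand per use: initial points on branch i farther than \<rho> from y;
    initial points on other branches when y \<ge> \<rho> / 2; the vertex when q > 0;
    coercivity.\<close>
  define \<Lambda> where "\<Lambda> = (K + E / \<rho>) / \<rho> + 4 * E / \<rho>\<^sup>2 + \<mu> + 1"
  have parts: "(K + E / \<rho>) / \<rho> \<ge> 0" "4 * E / \<rho>\<^sup>2 \<ge> 0" "\<mu> \<ge> 0"
    using K_nonneg E \<rho> q by (auto simp: \<mu>_def)
  have \<Lambda>: "\<Lambda> \<ge> 1" "\<Lambda> \<ge> (K + E / \<rho>) / \<rho>" "\<Lambda> \<ge> 4 * E / \<rho>\<^sup>2" "\<Lambda> \<ge> \<mu>"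
    using parts by (auto simp: \<Lambda>_def)
  \<comment> \<open>K + 1 gives coercivity and 2 * E / \<rho> handles initial points with z \<ge>
    \<rho> / 2 on other branches. The rest excludes later minima there by testing with the speed 1,
    whose cost is at most B.\<close>
  define P where "P = K + 1 + 2 * E / \<rho> + \<bar>Lag i q\<bar> + 2 * \<Lambda> * Xm * \<bar>q\<bar> + B"
  have Pparts: "2 * E / \<rho> \<ge> 0" "2 * \<Lambda> * Xm * \<bar>q\<bar> \<ge> 0" using E \<rho> \<Lambda> Xm0 by auto
  have P: "P \<ge> K + 1" "P \<ge> K + 2 * E / \<rho>" using Pparts B_nonneg by (auto simp: P_def)
  define \<psi> where "\<psi> = (\<lambda>j \<tau> z. if j = i then \<Lambda> * (z - X \<tau>)\<^sup>2 else \<Lambda> * (X \<tau>)\<^sup>2 + P * z)"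
  define F :: "nat \<Rightarrow> real \<times> real \<times> real \<Rightarrow> real"
    where "F = (\<lambda>j x. - u (fst x) (fst (snd x) *\<^sub>R e j)
      + ((Lag i q + \<delta>) * (fst x - s) + \<kappa> / (t1 - fst x) + \<psi> j (fst x) (fst (snd x))))"
  define D :: "(real \<times> real \<times> real) set"
    where "D = {(\<tau>, z, \<theta>). s \<le> \<tau> \<and> \<tau> < t1 \<and> 0 \<le> z \<and> 0 \<le> \<theta> \<and> \<theta> \<le> t1 - \<tau>}"
  have lsc: "lsc_set D (F j)" if j: "j \<in> I" for j
    unfolding F_def
  proof (rule lsc_set_add)
    from lsc_set_branch[OF lsc_on_uminus[OF usc] j]
    have "lsc_set D (\<lambda>x. - u (fst (fst x, fst (snd x))) (snd (fst x, fst (snd x)) *\<^sub>R e j))"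
      by (rule lsc_set_compose) (use t t1 in \<open>auto simp: D_def intro!: continuous_intros\<close>)
    then show "lsc_set D (\<lambda>x. - u (fst x) (fst (snd x) *\<^sub>R e j))" by simp
    have "continuous_on D (\<lambda>x. \<psi> j (fst x) (fst (snd x)))"
      unfolding \<psi>_def X_def by (cases "j = i") (auto intro!: continuous_intros)
    then show "lsc_set D (\<lambda>x. (Lag i q + \<delta>) * (fst x - s) + \<kappa> / (t1 - fst x) + \<psi> j (fst x) (fst (snd x)))"
      by (intro lsc_set_continuous continuous_intros) (auto simp: D_def)
  qed
  define C where "C = C0 + \<bar>Lag i q + \<delta>\<bar> * T + (K + 1) * Xm + (K + 1)\<^sup>2"
  have coer: "F j (\<tau>, z, \<theta>) \<ge> z - C + \<kappa> / (t1 - \<tau>)" if j: "j \<in> I" and x: "(\<tau>, z, \<theta>) \<in> D" for j \<tau> z \<theta>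
  proof -
    have h: "s \<le> \<tau>" "\<tau> < t1" "0 \<le> z" using x by (auto simp: D_def)
    have 1: "- u \<tau> (z *\<^sub>R e j) \<ge> - C0 - K * z" using growth[of j \<tau> z] j h t t1 by simp
    have "\<bar>(Lag i q + \<delta>) * (\<tau> - s)\<bar> \<le> \<bar>Lag i q + \<delta>\<bar> * T"
      unfolding abs_mult using h t1 t by (intro mult_left_mono) auto
    then have 2: "(Lag i q + \<delta>) * (\<tau> - s) \<ge> - (\<bar>Lag i q + \<delta>\<bar> * T)" by (simp add: abs_le_iff)
    have 3: "\<psi> j \<tau> z \<ge> (K + 1) * z - (K + 1) * Xm - (K + 1)\<^sup>2"
    proof (cases "j = i")
      case True
      have "1 * (z - X \<tau>)\<^sup>2 \<le> \<Lambda> * (z - X \<tau>)\<^sup>2" using \<Lambda>(1) by (intro mult_right_mono) auto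
      moreover have "(z - X \<tau>)\<^sup>2 - (K + 1) * (z - X \<tau>) + (K + 1)\<^sup>2 \<ge> 0"
      proof -
        have "(z - X \<tau>)\<^sup>2 - (K + 1) * (z - X \<tau>) + (K + 1)\<^sup>2 = ((z - X \<tau>) - (K + 1) / 2)\<^sup>2 + 3 / 4 * (K + 1)\<^sup>2"
          by (simp add: power2_eq_square field_simps)
        then show ?thesis by simp
      qed
      moreover have "(K + 1) * X \<tau> \<le> (K + 1) * Xm" using Xm[OF h(1,2)] K_nonneg by (intro mult_left_mono) auto
      ultimately show ?thesis using True by (simp add: \<psi>_def right_diff_distrib)
    next
      case False
      have "(K + 1) * z \<le> P * z" using P h by (intro mult_right_mono) auto
      moreover have "0 \<le> \<Lambda> * (X \<tau>)\<^sup>2" using \<Lambda> by simp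
      moreover have "0 \<le> (K + 1) * Xm" using K_nonneg Xm0 by simp
      ultimately show ?thesis using False zero_le_power2[of "K + 1"] unfolding \<psi>_def if_not_P[OF False] by linarith
    qed
    show ?thesis using 1 2 3 by (simp add: F_def C_def algebra_simps)
  qed
  obtain j \<tau> z \<theta> where j: "j \<in> I" and x0: "(\<tau>, z, \<theta>) \<in> D"
    and minF: "\<And>k y. k \<in> I \<Longrightarrow> y \<in> D \<Longrightarrow> F j (\<tau>, z, \<theta>) \<le> F k y"
    using blowup_attains_inf[where F = F, OF finite_I I_nonempty t1(3) \<kappa> D_def lsc coer] by blast
  have h: "s \<le> \<tau>" "\<tau> < t1" "0 \<le> z" using x0 by (auto simp: D_def)
  have XX: "X t = x" by (simp add: X_def xq)
  have "(t, x, 0) \<in> D" using t t1 xy by (simp add: D_def)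
  from minF[OF i this] have "F j (\<tau>, z, \<theta>) \<le> - u t (x *\<^sub>R e i) + (Lag i q + \<delta>) * (t - s) + \<kappa> / (t1 - t)"
    by (simp add: F_def \<psi>_def XX)
  moreover have "\<kappa> / (t1 - t) = \<eta>" using t1 by (simp add: \<kappa>_def)
  moreover have "\<delta> * (t - s) = \<eta>" using t by (simp add: \<delta>_def)
  moreover have "(Lag i q + \<delta>) * (t - s) = (t - s) * Lag i q + \<delta> * (t - s)" by (simp add: algebra_simps)
  ultimately have Fle: "F j (\<tau>, z, \<theta>) \<le> - u t (x *\<^sub>R e i) + (t - s) * Lag i q + 2 * \<eta>" by linarith
  show "u t (x *\<^sub>R e i) \<le> u s (y *\<^sub>R e i) + (t - s) * Lag i q + \<epsilon>"
  proof (cases "\<tau> = s")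
    case True
    have Xs: "X s = y" by (simp add: X_def)
    have us: "u s (z *\<^sub>R e j) \<le> C0 + K * z" using growth[of j s z] j h t by simp
    have Ej: "C0 + K * y - E \<le> u s (y *\<^sub>R e i)" "C0 - E \<le> u s (y *\<^sub>R e i)"
    proof -
      have "0 \<le> K * y" using K_nonneg xy by simp
      then show "C0 + K * y - E \<le> u s (y *\<^sub>R e i)" "C0 - E \<le> u s (y *\<^sub>R e i)" unfolding E_def by linarith+
    qed
    have Q: "(s, z *\<^sub>R e j) \<in> JT0 N e T" using t h scaleR_in_J[OF j] by (simp add: JT0_def)
    have \<psi>0: "\<psi> j s z \<ge> 0" using \<Lambda> P K_nonneg h by (simp add: \<psi>_def)
    have "u s (z *\<^sub>R e j) - \<psi> j s z \<le> u s (y *\<^sub>R e i) + \<eta>"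
    proof (cases "pdist N e (s, z *\<^sub>R e j) (s, y *\<^sub>R e i) < \<rho>")
      case True
      then show ?thesis using near[OF Q True] \<psi>0 by simp
    next
      case far: False
      show ?thesis
      proof (cases "j = i")
        case True
        define d where "d = \<bar>z - y\<bar>"
        have d: "d \<ge> \<rho>" using far pdist_same[OF i h(3) xy(2), of s s] True by (simp add: dist_Pair_Pair dist_real_def d_def)
        have "(K + E / \<rho>) / \<rho> * (\<rho> * d) \<le> \<Lambda> * (d * d)"
          using \<Lambda> parts d \<rho> by (intro mult_mono mult_right_mono) auto
        then have 1: "(K + E / \<rho>) * d \<le> \<Lambda> * d\<^sup>2" using \<rho> by (simp add: power2_eq_square)
        have "E / \<rho> * \<rho> \<le> E / \<rho> * d" using d E \<rho> by (intro mult_left_mono) auto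
        then have 2: "K * d + E \<le> \<Lambda> * d\<^sup>2" using 1 \<rho> by (simp add: distrib_right)
        have "K * (z - y) \<le> K * d" using K_nonneg by (intro mult_left_mono) (auto simp: d_def)
        moreover have "\<psi> j s z = \<Lambda> * d\<^sup>2" using True by (simp add: \<psi>_def Xs d_def)
        ultimately have "u s (z *\<^sub>R e j) - \<psi> j s z \<le> C0 + K * y - E" using us 2 by (simp add: right_diff_distrib)
        then show ?thesis using Ej(1) \<eta> by linarith
      next
        case False
        then have \<psi>: "\<psi> j s z = \<Lambda> * y\<^sup>2 + P * z" by (simp add: \<psi>_def Xs)
        have "z + y \<ge> \<rho>" using far pdist_diff[OF j i h(3) xy(2) False, of s s] h xy by simp
        then consider "y \<ge> \<rho> / 2" | "z \<ge> \<rho> / 2" by linarith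
        then have "\<psi> j s z \<ge> K * z + E"
        proof cases
          case 1
          have "4 * E / \<rho>\<^sup>2 * (\<rho> / 2)\<^sup>2 \<le> \<Lambda> * y\<^sup>2" using \<Lambda> parts 1 \<rho> by (intro mult_mono power_mono) auto
          moreover have "4 * E / \<rho>\<^sup>2 * (\<rho> / 2)\<^sup>2 = E" using \<rho> by (simp add: power2_eq_square field_simps)
          moreover have "K * z \<le> P * z" using P h by (intro mult_right_mono) auto
          ultimately show ?thesis using \<psi> by simp
        next
          case 2
          have "2 * E / \<rho> * (\<rho> / 2) \<le> 2 * E / \<rho> * z" using 2 Pparts by (intro mult_left_mono) auto
          moreover have "(K + 2 * E / \<rho>) * z \<le> P * z" using P h by (intro mult_right_mono) auto
          moreover have "0 \<le> \<Lambda> * y\<^sup>2" using \<Lambda> by simp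
          ultimately show ?thesis using \<psi> \<rho> by (simp add: distrib_right)
        qed
        then show ?thesis using us Ej(2) \<eta> by linarith
      qed
    qed
    moreover have "\<kappa> / (t1 - s) \<ge> 0" using \<kappa> t1 by simp
    ultimately show ?thesis using Fle True by (simp add: F_def \<eta>_def)
  next
    case False
    then have \<tau>: "s < \<tau>" "0 < \<tau>" "\<tau> < T" using h t t1 by auto
    obtain \<rho>2 k2 where \<rho>2: "\<rho>2 > 0" "k2 \<ge> 0"
      "\<And>t. \<bar>t - \<tau>\<bar> < \<rho>2 \<Longrightarrow> t < t1 \<and> \<kappa> / (t1 - t) \<le> \<kappa> / (t1 - \<tau>) + \<kappa> / (t1 - \<tau>)\<^sup>2 * (t - \<tau>) + k2 * (t - \<tau>)\<^sup>2"
      using blowup_le_quadratic[OF h(2) \<kappa>] by metis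
    define r where "r = min \<rho>2 (\<tau> - s)"
    have r: "r > 0" using \<rho>2 \<tau> by (simp add: r_def)
    define k where "k = k2 + \<Lambda> * (2 * (1 + q\<^sup>2))"
    define a0 where "a0 = Lag i q + \<delta> + \<kappa> / (t1 - \<tau>)\<^sup>2"
    \<comment> \<open>\<open>\<alpha>\<close> and \<open>\<beta>\<close> are the time and space
      derivatives of \<open>\<psi>\<close> at the minimum.\<close>
    define \<alpha> where "\<alpha> = (\<lambda>j. if j = i then - 2 * \<Lambda> * (z - X \<tau>) * q else 2 * \<Lambda> * X \<tau> * q)"
    define \<beta> where "\<beta> = (\<lambda>j. if j = i then 2 * \<Lambda> * (z - X \<tau>) else P)"
    have expand: "\<psi> l t' z' \<le> \<psi> l \<tau> z + \<alpha> l * (t' - \<tau>) + \<beta> l * (z' - z)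
        + \<Lambda> * (2 * (1 + q\<^sup>2)) * ((t' - \<tau>)\<^sup>2 + (z' - z)\<^sup>2)" for l t' z'
    proof (cases "l = i")
      case True
      have "(q * (t' - \<tau>) - (z' - z))\<^sup>2 \<le> 2 * (1 + q\<^sup>2) * ((t' - \<tau>)\<^sup>2 + (z' - z)\<^sup>2)"
        using square_diff_le[of "q * (t' - \<tau>)" "z' - z"] weighted_squares_le[of q "t' - \<tau>" "z' - z"] by linarith
      then have "\<Lambda> * (q * (t' - \<tau>) - (z' - z))\<^sup>2 \<le> \<Lambda> * (2 * (1 + q\<^sup>2) * ((t' - \<tau>)\<^sup>2 + (z' - z)\<^sup>2))"
        using \<Lambda> by (intro mult_left_mono) auto
      moreover have "\<Lambda> * (z' - X t')\<^sup>2 = \<Lambda> * (z - X \<tau>)\<^sup>2 + (- 2 * \<Lambda> * (z - X \<tau>) * q) * (t' - \<tau>)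
          + 2 * \<Lambda> * (z - X \<tau>) * (z' - z) + \<Lambda> * (q * (t' - \<tau>) - (z' - z))\<^sup>2"
        by (simp add: X_def power2_eq_square algebra_simps)
      ultimately show ?thesis using True by (simp add: \<psi>_def \<alpha>_def \<beta>_def mult.assoc)
    next
      case False
      have "(q * (t' - \<tau>))\<^sup>2 \<le> 2 * (1 + q\<^sup>2) * ((t' - \<tau>)\<^sup>2 + (z' - z)\<^sup>2)"
        by (rule order_trans[OF _ weighted_squares_le]) simp
      then have "\<Lambda> * (q * (t' - \<tau>))\<^sup>2 \<le> \<Lambda> * (2 * (1 + q\<^sup>2) * ((t' - \<tau>)\<^sup>2 + (z' - z)\<^sup>2))"
        using \<Lambda> by (intro mult_left_mono) auto
      moreover have "\<Lambda> * (X t')\<^sup>2 = \<Lambda> * (X \<tau>)\<^sup>2 + 2 * \<Lambda> * X \<tau> * q * (t' - \<tau>) + \<Lambda> * (q * (t' - \<tau>))\<^sup>2"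
        by (simp add: X_def power2_eq_square algebra_simps)
      ultimately show ?thesis using False by (simp add: \<psi>_def \<alpha>_def \<beta>_def algebra_simps)
    qed
    have jet: "u t' (z' *\<^sub>R e l) \<le> u \<tau> (z *\<^sub>R e j) + (a0 + \<alpha> l) * (t' - \<tau>) + \<beta> l * (z' - z) + k * ((t' - \<tau>)\<^sup>2 + (z' - z)\<^sup>2)"
      if l: "l \<in> I" and eq: "\<psi> l \<tau> z = \<psi> j \<tau> z" and t': "\<bar>t' - \<tau>\<bar> < r" and z': "z' \<ge> 0" for l t' z'
    proof -
      have "\<bar>t' - \<tau>\<bar> < \<rho>2" "s < t'" using t' by (auto simp: r_def)
      then have A: "t' < t1" "\<kappa> / (t1 - t') \<le> \<kappa> / (t1 - \<tau>) + \<kappa> / (t1 - \<tau>)\<^sup>2 * (t' - \<tau>) + k2 * (t' - \<tau>)\<^sup>2"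
        using \<rho>2(3)[of t'] by auto
      have "(t', z', 0) \<in> D" using A \<open>s < t'\<close> z' by (simp add: D_def)
      from minF[OF l this] have 1: "u t' (z' *\<^sub>R e l) \<le> u \<tau> (z *\<^sub>R e j) + ((Lag i q + \<delta>) * (t' - s) - (Lag i q + \<delta>) * (\<tau> - s))
          + (\<kappa> / (t1 - t') - \<kappa> / (t1 - \<tau>)) + (\<psi> l t' z' - \<psi> j \<tau> z)"
        by (simp add: F_def)
      have 2: "(Lag i q + \<delta>) * (t' - s) - (Lag i q + \<delta>) * (\<tau> - s) = (Lag i q + \<delta>) * (t' - \<tau>)" by (simp add: algebra_simps)
      have 3: "k2 * (t' - \<tau>)\<^sup>2 \<le> k2 * ((t' - \<tau>)\<^sup>2 + (z' - z)\<^sup>2)" using \<rho>2 by (intro mult_left_mono) auto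
      have 4: "(a0 + \<alpha> l) * (t' - \<tau>) = (Lag i q + \<delta>) * (t' - \<tau>) + \<kappa> / (t1 - \<tau>)\<^sup>2 * (t' - \<tau>) + \<alpha> l * (t' - \<tau>)"
        by (simp add: a0_def algebra_simps)
      have 5: "k * ((t' - \<tau>)\<^sup>2 + (z' - z)\<^sup>2) = k2 * ((t' - \<tau>)\<^sup>2 + (z' - z)\<^sup>2) + \<Lambda> * (2 * (1 + q\<^sup>2)) * ((t' - \<tau>)\<^sup>2 + (z' - z)\<^sup>2)"
        unfolding k_def by (rule distrib_right)
      show ?thesis using 1 A(2) 3 expand[of l t' z'] unfolding 2 4 5 eq by linarith
    qed
    have \<kappa>': "\<kappa> / (t1 - \<tau>)\<^sup>2 \<ge> 0" using \<kappa> by simp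
    \<comment> \<open>The parabola is transported with speed q, so
      \<open>\<alpha> i + \<beta> i * q\<close> vanishes and what remains is \<delta> plus the
      derivative of the blow-up term.\<close>
    have main_i: "a0 + \<alpha> i + (\<beta> i * q - Lag i q) > 0"
      using \<delta> \<kappa>' by (simp add: a0_def \<alpha>_def \<beta>_def)
    have False
    proof (cases "z = 0")
      case False
      then have z: "z > 0" using h by simp
      have "a0 + \<alpha> j + Ham Lag j (\<beta> j) \<le> 0"
        using jet[OF j refl] r by (intro visc_sub_jet[OF u \<tau>(2,3) j z r]) auto
      moreover have "a0 + \<alpha> j + Ham Lag j (\<beta> j) > 0"
      proof (cases "j = i")
        case True
        then show ?thesis using main_i Ham_ge[OF i, of "\<beta> i" q] by simp
      next
        case False
        have "\<bar>2 * \<Lambda> * X \<tau> * q\<bar> \<le> 2 * \<Lambda> * Xm * \<bar>q\<bar>"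
          unfolding abs_mult using Xm[OF h(1,2)] \<Lambda> by (intro mult_right_mono mult_mono) auto
        then have "- (2 * \<Lambda> * Xm * \<bar>q\<bar>) \<le> 2 * \<Lambda> * X \<tau> * q" by linarith
        moreover have "\<beta> j * 1 - Lag j 1 \<le> Ham Lag j (\<beta> j)" by (rule Ham_ge[OF j])
        moreover have "\<alpha> j = 2 * \<Lambda> * X \<tau> * q" "\<beta> j * 1 = P" using False by (simp_all add: \<alpha>_def \<beta>_def)
        ultimately show ?thesis
          using \<delta> \<kappa>' B_ge(2)[OF j] K_nonneg Pparts abs_ge_minus_self[of "Lag i q"]
          unfolding a0_def P_def by linarith
      qed
      ultimately show False by simp
    next
      case True
      \<comment> \<open>At the vertex the parabola and the cones share their value and their time
        derivative, so together they form one jet.\<close>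
      have eq: "\<psi> l \<tau> z = \<psi> j \<tau> z" for l using True by (simp add: \<psi>_def)
      have \<alpha>l: "\<alpha> l = \<alpha> i" for l using True by (simp add: \<alpha>_def)
      have "a0 + \<alpha> i + Ham_minus Lag i (\<beta> i) \<le> 0"
      proof (rule visc_sub_jet_vertex[OF u \<tau>(2,3) r _ i])
        fix l t' z' assume "l \<in> I" "\<bar>t' - \<tau>\<bar> < r" "(0::real) \<le> z'"
        from jet[OF this(1) eq this(2,3)] show "u t' (z' *\<^sub>R e l) \<le> u \<tau> 0 + (a0 + \<alpha> i) * (t' - \<tau>) + \<beta> l * z'
            + k * ((t' - \<tau>)\<^sup>2 + z'\<^sup>2)"
          using \<alpha>l[of l] True by simp
      qed
      moreover have "a0 + \<alpha> i + Ham_minus Lag i (\<beta> i) > 0"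
      proof (cases "q \<le> 0")
        case True
        then show ?thesis using main_i Ham_minus_ge[OF i True, of "\<beta> i"] by linarith
      next
        case False
        then have qy: "q > 0" "y > 0" using q by auto
        have "y \<le> X \<tau>" using qy \<tau> by (simp add: X_def)
        then have "\<Lambda> * (2 * y * q) \<le> \<Lambda> * (2 * X \<tau> * q)" using qy \<Lambda> by (intro mult_left_mono mult_right_mono) auto
        moreover have "\<mu> * (2 * y * q) \<le> \<Lambda> * (2 * y * q)" using qy \<Lambda> by (intro mult_right_mono) auto
        moreover have "\<mu> * (2 * y * q) = \<bar>Lag i q - Lag i 0\<bar> + 1" using qy by (simp add: \<mu>_def)
        moreover have "\<alpha> i = \<Lambda> * (2 * X \<tau> * q)" using True by (simp add: \<alpha>_def)
        moreover have "\<beta> i * 0 - Lag i 0 \<le> Ham_minus Lag i (\<beta> i)" by (rule Ham_minus_ge[OF i order_refl])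
        ultimately show ?thesis using \<delta> \<kappa>' unfolding a0_def by linarith
      qed
      ultimately show False by simp
    qed
    then show ?thesis ..
  qed
qed

text \<open>Lines leaving the vertex are not covered by \<open>sub_dpp_core\<close>. They are
  started a little later, at distance q * h, and upper semicontinuity at the vertex closes the
  gap.\<close>

lemma sub_dpp:
  assumes u: "visc_sub N e Lag T w u"
    and growth: "\<And>i t x. i \<in> I \<Longrightarrow> 0 \<le> t \<Longrightarrow> t < T \<Longrightarrow> x \<ge> 0 \<Longrightarrow> u t (x *\<^sub>R e i) \<le> C0 + K * x"
    and i: "i \<in> I" and t: "0 \<le> s" "s < t" "t < T" and xy: "x \<ge> 0" "y \<ge> 0"
  shows "u t (x *\<^sub>R e i) \<le> u s (y *\<^sub>R e i) + line_cost i (t - s) (x - y)"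
proof -
  define q where "q = (x - y) / (t - s)"
  have xq: "x = y + q * (t - s)" using t by (simp add: q_def)
  have lc: "line_cost i (t - s) (x - y) = (t - s) * Lag i q" by (simp add: line_cost_def q_def)
  show ?thesis
  proof (cases "q \<le> 0 \<or> y > 0")
    case True
    then show ?thesis using sub_dpp_core[OF u growth i t xy xq] lc by simp
  next
    case False
    then have q: "q > 0" "y = 0" using xy by auto
    have "u t (x *\<^sub>R e i) \<le> u s (y *\<^sub>R e i) + (t - s) * Lag i q"
    proof (rule field_le_epsilon)
      fix \<epsilon> :: real assume \<epsilon>: "\<epsilon> > 0"
      have "usc_on N e (JT0 N e T) u" using u by (simp add: visc_sub_def)
      moreover have "(s, 0) \<in> JT0 N e T" using t zero_in_J by (simp add: JT0_def)
      ultimately obtain \<rho> where \<rho>: "\<rho> > 0" and near: "\<And>Q. Q \<in> JT0 N e T \<Longrightarrow> pdist N e Q (s, 0) < \<rho> \<Longrightarrow>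
          u (fst Q) (snd Q) < u s 0 + \<epsilon> / 2"
        using \<epsilon> unfolding usc_on_def by (metis fst_conv snd_conv half_gt_zero)
      define h where "h = min ((t - s) / 2) (min (\<rho> / (2 * (1 + q))) (\<epsilon> / (2 * (\<bar>Lag i q\<bar> + 1))))"
      have h: "h > 0" "s + h < t" using t \<rho> \<epsilon> q by (auto simp: h_def min_def field_simps)
      have y': "q * h > 0" using q h by simp
      have "u t (x *\<^sub>R e i) \<le> u (s + h) ((q * h) *\<^sub>R e i) + (t - (s + h)) * Lag i q"
      proof (rule sub_dpp_core[OF u growth i])
        show "x = q * h + q * (t - (s + h))" using xq q by (simp add: algebra_simps)
      qed (use t h xy y' in auto)
      moreover have "u (s + h) ((q * h) *\<^sub>R e i) < u s 0 + \<epsilon> / 2"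
      proof -
        have "pdist N e (s + h, (q * h) *\<^sub>R e i) (s, 0) = dist (s + h, q * h) (s, 0)"
          using y' i by (intro pdist_zero) auto
        also have "\<dots> \<le> \<bar>h\<bar> + \<bar>q * h\<bar>"
          using sqrt_sum_squares_le_sum_abs[of h "q * h"] by (simp add: dist_Pair_Pair dist_real_def)
        also have "\<dots> = h * (1 + q)" using h q by (simp add: algebra_simps)
        also have "\<dots> \<le> \<rho> / (2 * (1 + q)) * (1 + q)" using q by (intro mult_right_mono) (auto simp: h_def)
        also have "\<dots> = \<rho> / 2" using q by (simp add: field_simps)
        also have "\<dots> < \<rho>" using \<rho> by simp
        finally show ?thesis using near[of "(s + h, (q * h) *\<^sub>R e i)"] t h scaleR_in_J[OF i, of "q * h"] y'
          by (simp add: JT0_def)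
      qed
      moreover have "h * (- Lag i q) \<le> \<epsilon> / 2"
      proof -
        have "h * (- Lag i q) \<le> h * (\<bar>Lag i q\<bar> + 1)" using h by (intro mult_left_mono) auto
        also have "\<dots> \<le> \<epsilon> / (2 * (\<bar>Lag i q\<bar> + 1)) * (\<bar>Lag i q\<bar> + 1)" by (intro mult_right_mono) (auto simp: h_def)
        also have "\<dots> = \<epsilon> / 2"
        proof -
          have "\<epsilon> / (2 * E) * E = \<epsilon> / 2" if "E > 0" for E :: real using that by simp
          from this[of "\<bar>Lag i q\<bar> + 1"] show ?thesis by linarith
        qed
        finally show ?thesis .
      qed
      ultimately show "u t (x *\<^sub>R e i) \<le> u s (y *\<^sub>R e i) + (t - s) * Lag i q + \<epsilon>"
        using q by (simp add: algebra_simps)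
    qed
    then show ?thesis using lc by simp
  qed
qed

lemma sub_comparison:
  assumes u: "visc_sub N e Lag T u0 u"
    and growth: "\<And>i t x. i \<in> I \<Longrightarrow> 0 \<le> t \<Longrightarrow> t < T \<Longrightarrow> x \<ge> 0 \<Longrightarrow> u t (x *\<^sub>R e i) \<le> C0 + K * x"
    and j: "j \<in> I" and t: "0 \<le> t" "t < T" and x: "x \<ge> 0"
  shows "u t (x *\<^sub>R e j) \<le> U j t x"
proof (rule U_ge[OF j t(1) x])
  fix c assume "reach j t x c"
  then show "u t (x *\<^sub>R e j) \<le> c"
  proof (rule reach_ge_dpp[OF _ _ _ t(2), rotated 2])
    fix i x assume "i \<in> I" "(x::real) \<ge> 0"
    then show "u 0 (x *\<^sub>R e i) \<le> u0 (x *\<^sub>R e i)" using u scaleR_in_J by (simp add: visc_sub_def)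
  qed (rule sub_dpp[OF u growth])
qed

subsection \<open>Uniqueness\<close>

text \<open>The comparison results give us \<le> \<open>U\<close> \<le> ls for the two envelopes,
  while always ls \<le> u \<le> us, so all coincide. What has to be shown is the linear growth of
  the envelopes.\<close>

lemma visc_sol_unique:
  assumes sol: "visc_sol N e Lag T u0 u" and C: "\<And>t x. (t, x) \<in> JT N e T \<Longrightarrow> \<bar>u t x - u0 x\<bar> \<le> C"
    and j: "j \<in> I" and t: "0 \<le> t" "t < T" and x: "x \<ge> 0"
  shows "u t (x *\<^sub>R e j) = U j t x"
proof -
  define us where "us = (\<lambda>t x. real_of_ereal (usc_env_e N e (JT0 N e T) u t x))"
  define ls where "ls = (\<lambda>t x. real_of_ereal (lsc_env_e N e (JT0 N e T) u t x))"
  have T: "T > 0" using t by simp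
  have sub: "visc_sub N e Lag T u0 us" and super: "visc_super N e Lag T u0 ls"
    using sol by (auto simp: visc_sol_def us_def ls_def)
  have JT0: "(t, x *\<^sub>R e i) \<in> JT0 N e T" if "i \<in> I" "0 \<le> t" "t < T" "x \<ge> 0" for i t x
    using that scaleR_in_J by (simp add: JT0_def)
  have us: "ereal (us t x) = usc_env_e N e (JT0 N e T) u t x"
    and ls: "ereal (ls t x) = lsc_env_e N e (JT0 N e T) u t x" if "(t, x) \<in> JT0 N e T" for t x
    using sol that by (auto simp: visc_sol_def us_def ls_def ereal_real split: prod.splits)
  have bound: "\<bar>u t (x *\<^sub>R e i)\<bar> \<le> \<bar>u0 0\<bar> + \<bar>C\<bar> + K * x"
    if "i \<in> I" "0 < t" "t < T" "x \<ge> 0" for i t x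
    using C[of t "x *\<^sub>R e i"] u0_growth[of i x] that scaleR_in_J[of i x] unfolding JT_def by simp
  \<comment> \<open>The summand K accounts for points within distance 1. The radius
    \<open>min 1 t\<close> used below also keeps neighbouring times positive, since C bounds u only
    there; at time 0 the initial conditions of the envelopes are used.\<close>
  define C0 where "C0 = \<bar>u0 0\<bar> + \<bar>C\<bar> + K"
  have near: "\<bar>u (fst Q) (snd Q)\<bar> \<le> C0 + K * x"
    if i: "i \<in> I" and tx: "0 < t" "t < T" "x \<ge> 0" and Q: "Q \<in> JT0 N e T" "pdist N e Q (t, x *\<^sub>R e i) < min 1 t" for i t x Q
  proof -
    have "snd Q \<in> J" using Q(1) by (auto simp: JT0_def)
    then obtain l z where l: "l \<in> I" "z \<ge> 0" "snd Q = z *\<^sub>R e l" using J_cases by blast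
    have Qe: "Q = (fst Q, z *\<^sub>R e l)" using l(3) by (metis prod.collapse)
    have p: "pdist N e (fst Q, z *\<^sub>R e l) (t, x *\<^sub>R e i) < min 1 t" using Q(2) Qe by simp
    have "\<bar>fst Q - t\<bar> < t" using pdist_ge_time[of "fst Q" t "z *\<^sub>R e l" "x *\<^sub>R e i"] p by simp
    then have "fst Q > 0" by simp
    moreover have "\<bar>z - x\<bar> < 1"
      using pdist_ge_norm[OF scaleR_in_J[OF l(1,2)] scaleR_in_J[OF i tx(3)], of "fst Q" t] p
        norm_scaleR_e[OF l(1,2)] norm_scaleR_e[OF i tx(3)] by simp
    then have "K * z \<le> K * (x + 1)" using K_nonneg by (intro mult_left_mono) auto
    moreover have "fst Q < T" using Q(1) by (auto simp: JT0_def)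
    ultimately show ?thesis using bound[of l "fst Q" z] l by (simp add: C0_def algebra_simps)
  qed
  have u0b: "\<bar>u0 (x *\<^sub>R e i)\<bar> \<le> C0 + K * x" if "i \<in> I" "x \<ge> 0" for i x
    using u0_growth[OF that] K_nonneg unfolding C0_def by linarith
  have us_growth: "us t (x *\<^sub>R e i) \<le> C0 + K * x" if i: "i \<in> I" and tx: "0 \<le> t" "t < T" "x \<ge> 0" for i t x
  proof (cases "t = 0")
    case True
    then show ?thesis using sub scaleR_in_J[OF i tx(3)] u0b[OF i tx(3)] by (force simp: visc_sub_def)
  next
    case False
    have "usc_env_e N e (JT0 N e T) u t (x *\<^sub>R e i) \<le> ereal (C0 + K * x)"
      unfolding usc_env_e_def
      by (intro INF_lower2[of "min 1 t"] SUP_least) (use False tx near[OF i _ tx(2,3)] in \<open>auto simp: abs_le_iff\<close>)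
    then show ?thesis using us[OF JT0[OF i tx]] by (metis ereal_less_eq(3))
  qed
  have ls_growth: "- C0 - K * x \<le> ls t (x *\<^sub>R e i)" if i: "i \<in> I" and tx: "0 \<le> t" "t < T" "x \<ge> 0" for i t x
  proof (cases "t = 0")
    case True
    then show ?thesis using super scaleR_in_J[OF i tx(3)] u0b[OF i tx(3)] by (force simp: visc_super_def)
  next
    case False
    have "ereal (- C0 - K * x) \<le> lsc_env_e N e (JT0 N e T) u t (x *\<^sub>R e i)"
      unfolding lsc_env_e_def
    proof (intro SUP_upper2[of "min 1 t"] INF_greatest)
      fix Q assume "Q \<in> {Q \<in> JT0 N e T. pdist N e Q (t, x *\<^sub>R e i) < min 1 t}"
      then have "\<bar>u (fst Q) (snd Q)\<bar> \<le> C0 + K * x" using near[OF i _ tx(2,3)] False tx(1) by simp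
      then show "ereal (- C0 - K * x) \<le> ereal (u (fst Q) (snd Q))" by simp
    qed (use False tx in auto)
    then show ?thesis using ls[OF JT0[OF i tx]] by (metis ereal_less_eq(3))
  qed
  have "us t (x *\<^sub>R e j) \<le> U j t x" by (rule sub_comparison[OF sub us_growth j t x])
  moreover have "U j t x \<le> ls t (x *\<^sub>R e j)" by (rule super_comparison[OF super ls_growth j t x])
  moreover have "ereal (u t (x *\<^sub>R e j)) \<le> ereal (us t (x *\<^sub>R e j))"
    unfolding us[OF JT0[OF j t x]] by (rule usc_env_ge[OF JT0[OF j t x] scaleR_in_J[OF j x]])
  moreover have "ereal (ls t (x *\<^sub>R e j)) \<le> ereal (u t (x *\<^sub>R e j))"
    unfolding ls[OF JT0[OF j t x]] by (rule lsc_env_le[OF JT0[OF j t x] scaleR_in_J[OF j x]])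
  ultimately show ?thesis by simp
qed

end

subsection \<open>Integration on intervals\<close>

lemma absolutely_integrable_glue:
  fixes f g :: "real \<Rightarrow> 'a::euclidean_space"
  assumes cd: "c \<le> d" "d \<le> b"
    and f: "f absolutely_integrable_on {c..d}" and g: "g absolutely_integrable_on {d..b}"
  defines "h \<equiv> (\<lambda>\<tau>. if \<tau> \<le> d then f \<tau> else g \<tau>)"
  shows "h absolutely_integrable_on {c..b}"
    and "integral {c..b} h = integral {c..d} f + integral {d..b} g"
proof -
  have 1: "h absolutely_integrable_on {c..d}"
    using f by (rule iffD1[OF set_integrable_cong, rotated -1]) (auto simp: h_def)
  have "g absolutely_integrable_on {d<..b}" by (rule set_integrable_subset[OF g]) auto
  then have 2: "h absolutely_integrable_on {d<..b}"
    by (rule iffD1[OF set_integrable_cong, rotated -1]) (auto simp: h_def)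
  have "{c..b} = {c..d} \<union> {d<..b}" using cd by auto
  then show 3: "h absolutely_integrable_on {c..b}" using set_integrable_Un[OF 1 2] by simp
  have "integral {d..b} h = integral {d..b} g"
    by (rule integral_spike[of "{d}"]) (auto simp: h_def)
  moreover have "integral {c..d} h = integral {c..d} f"
    by (rule integral_cong) (auto simp: h_def)
  moreover have "h integrable_on {c..b}" using 3 by (rule set_lebesgue_integral_eq_integral)
  ultimately show "integral {c..b} h = integral {c..d} f + integral {d..b} g"
    using Henstock_Kurzweil_Integration.integral_combine[OF cd, of h] by simp
qed

lemma AE_lebesgue_neq: "AE \<tau> in lebesgue. \<tau> \<noteq> (a::real)"
  by (rule AE_I'[of "{a}"]) (auto simp: negligible_iff_null_sets[symmetric])

text \<open>An open set in an interval has countably many components, all of them intervals.\<close>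

lemma integral_open_eq_0:
  fixes f :: "real \<Rightarrow> real"
  assumes G: "open G" "G \<subseteq> {a<..<b}" and f: "f absolutely_integrable_on {a..b}"
    and comp: "\<And>c d. c < d \<Longrightarrow> {c<..<d} \<subseteq> G \<Longrightarrow> c \<in> {a..b} - G \<Longrightarrow> d \<in> {a..b} - G \<Longrightarrow> integral {c..d} f = 0"
  shows "integral G f = 0"
proof -
  have Gleb: "G \<in> sets lebesgue" using G(1) by simp
  have fG: "f absolutely_integrable_on G" by (rule set_integrable_subset[OF f Gleb]) (use G in auto)
  have zero: "(LINT x:C|lebesgue. f x) = 0" if C: "C \<in> components G" for C
  proof -
    have Co: "open C" using open_components[OF G(1) C] .
    have CG: "C \<subseteq> G" using in_components_subset[OF C] .
    have Cne: "C \<noteq> {}" using in_components_nonempty[OF C] .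
    have Cconn: "connected C" using in_components_connected[OF C] .
    have bdd: "bdd_below C" "bdd_above C" using CG G(2) by (auto intro!: bdd_belowI[of _ a] bdd_aboveI[of _ b])
    define c where "c = Inf C"
    define d where "d = Sup C"
    have C_le: "c \<le> x" "x \<le> d" if "x \<in> C" for x
      using that bdd by (auto simp: c_def d_def cInf_lower cSup_upper)
    have c_notin: "c \<notin> C"
    proof
      assume "c \<in> C"
      then obtain \<epsilon> where "\<epsilon> > 0" "ball c \<epsilon> \<subseteq> C" using Co open_contains_ball by blast
      then have "c - \<epsilon> / 2 \<in> C" by (auto simp: dist_real_def)
      then show False using C_le(1) \<open>\<epsilon> > 0\<close> by force
    qed
    have d_notin: "d \<notin> C"
    proof
      assume "d \<in> C"
      then obtain \<epsilon> where "\<epsilon> > 0" "ball d \<epsilon> \<subseteq> C" using Co open_contains_ball by blast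
      then have "d + \<epsilon> / 2 \<in> C" by (auto simp: dist_real_def)
      then show False using C_le(2) \<open>\<epsilon> > 0\<close> by force
    qed
    have sub: "{c<..<d} \<subseteq> C"
    proof
      fix x assume x: "x \<in> {c<..<d}"
      obtain y where y: "y \<in> C" "y < x" using x cInf_less_iff[OF Cne bdd(1), of x] by (auto simp: c_def)
      obtain z where z: "z \<in> C" "x < z" using x less_cSup_iff[OF Cne bdd(2), of x] by (auto simp: d_def)
      show "x \<in> C" using connectedD_interval[OF Cconn y(1) z(1)] y z by simp
    qed
    have Ceq: "C = {c<..<d}"
    proof
      show "C \<subseteq> {c<..<d}"
      proof
        fix x assume "x \<in> C"
        then show "x \<in> {c<..<d}" using C_le[of x] c_notin d_notin by (metis greaterThanLessThan_iff less_eq_real_def)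
      qed
    qed (rule sub)
    then have cd: "c < d" using Cne by auto
    have mid: "(c + d) / 2 \<in> C" using cd by (simp add: Ceq field_simps)
    have maxC: "S \<subseteq> C" if "connected S" "S \<subseteq> G" "S \<inter> C \<noteq> {}" for S
      using components_maximal[OF C that(1,2)] that(3) by blast
    have connected_ivl: "connected {c..<d}" "connected {c<..d}" by simp_all
    \<comment> \<open>Otherwise adding c to the component would give a larger connected subset of
      G.\<close>
    have "c \<notin> G"
    proof
      assume "c \<in> G"
      then have "{c..<d} \<subseteq> G" using sub CG by (auto simp: order_le_less)
      moreover have "(c + d) / 2 \<in> {c..<d} \<inter> C" using mid cd by auto
      ultimately have "{c..<d} \<subseteq> C" using maxC[of "{c..<d}"] connected_ivl by blast
      then show False using c_notin cd by auto
    qed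
    moreover have "d \<notin> G"
    proof
      assume "d \<in> G"
      then have "{c<..d} \<subseteq> G" using sub CG by (auto simp: order_le_less)
      moreover have "(c + d) / 2 \<in> {c<..d} \<inter> C" using mid cd by auto
      ultimately have "{c<..d} \<subseteq> C" using maxC[of "{c<..d}"] connected_ivl by blast
      then show False using d_notin cd by auto
    qed
    moreover have "c \<in> {a..b}" "d \<in> {a..b}"
    proof -
      have "{c<..<d} \<subseteq> {a<..<b}" using Ceq CG G(2) by auto
      then have "a \<le> c \<and> d \<le> b" using cd greaterThanLessThan_subseteq_greaterThanLessThan[of c d a b] by auto
      then show "c \<in> {a..b}" "d \<in> {a..b}" using cd by auto
    qed
    ultimately have "integral {c..d} f = 0" using cd CG Ceq by (intro comp) auto
    moreover have "f absolutely_integrable_on C" by (rule set_integrable_subset[OF fG _ CG]) (use Co in auto)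
    then have "(LINT x:C|lebesgue. f x) = integral C f" by (rule set_lebesgue_integral_eq_integral)
    moreover have "integral C f = integral {c..d} f"
      unfolding Ceq using integral_open_interval_real[of c d f] by simp
    ultimately show ?thesis by simp
  qed
  define F where "F = components G"
  have Fc: "countable F" unfolding F_def
    by (rule countable_disjoint_open_subsets) (use open_components[OF G(1)] pairwise_disjoint_components[of G] in \<open>auto simp: pairwise_def disjnt_def\<close>)
  \<comment> \<open>An enumeration of the components by natural numbers, padded with empty sets, so
    that countable additivity applies to finitely many components as well.\<close>
  define A where "A = (\<lambda>n. if n \<in> to_nat_on F ` F then from_nat_into F n else {})"
  have A: "A n \<in> F \<or> A n = {}" for n
    using Fc by (auto simp: A_def)
  have UA: "(\<Union>n. A n) = G"
  proof -
    have "(\<Union>n. A n) = \<Union>F"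
    proof
      show "(\<Union>n. A n) \<subseteq> \<Union>F" using A by blast
      show "\<Union>F \<subseteq> (\<Union>n. A n)"
      proof
        fix x assume "x \<in> \<Union>F"
        then obtain C where C: "C \<in> F" "x \<in> C" by auto
        then have "A (to_nat_on F C) = C" using Fc by (simp add: A_def)
        then show "x \<in> (\<Union>n. A n)" using C by blast
      qed
    qed
    then show ?thesis by (simp add: F_def)
  qed
  have "integral G f = (LINT x:G|lebesgue. f x)" using set_lebesgue_integral_eq_integral(2)[OF fG] by simp
  also have "\<dots> = (\<Sum>n. LINT x:A n|lebesgue. f x)"
    unfolding UA[symmetric]
  proof (rule lebesgue_integral_countable_add)
    show "A n \<in> sets lebesgue" for n using A[of n] open_components[OF G(1)] by (auto simp: F_def)
    show "set_integrable lebesgue (\<Union>n. A n) f" using fG UA by simp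
    fix n m :: nat assume nm: "n \<noteq> m"
    show "A n \<inter> A m = {}"
    proof (rule ccontr)
      assume ne: "A n \<inter> A m \<noteq> {}"
      then have "n \<in> to_nat_on F ` F" "m \<in> to_nat_on F ` F" by (auto simp: A_def split: if_splits)
      then obtain C C' where C: "C \<in> F" "n = to_nat_on F C" "C' \<in> F" "m = to_nat_on F C'" by auto
      then have "A n = C" "A m = C'" using Fc by (auto simp: A_def)
      then have "C = C'" using ne C pairwise_disjoint_components[of G] unfolding F_def pairwise_def by blast
      then show False using nm C by simp
    qed
  qed
  also have "\<dots> = 0"
  proof -
    have "(LINT x:A n|lebesgue. f x) = 0" for n
      using A[of n] zero by (auto simp: F_def set_lebesgue_integral_def)
    then show ?thesis by simp
  qed
  finally show ?thesis .
qed

text \<open>Almost everywhere on the zero set of an indefinite integral, the zeros accumulate from the right and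
  the integrand is the right derivative.\<close>

lemma derivative_zero_on_zeros:
  fixes V X :: "real \<Rightarrow> 'a::euclidean_space"
  assumes V: "V absolutely_integrable_on {s..t}"
    and X: "\<And>\<tau>. \<tau> \<in> {s..t} \<Longrightarrow> X \<tau> = X s + integral {s..\<tau>} V"
  shows "AE \<tau> in lebesgue. \<tau> \<in> {s<..<t} \<longrightarrow> X \<tau> = 0 \<longrightarrow> V \<tau> = 0"
proof -
  define f where "f = (\<lambda>\<tau>. if \<tau> \<in> {s..t} then V \<tau> else 0)"
  have Vint: "V integrable_on {s..t}" using V by (rule set_lebesgue_integral_eq_integral)
  then have "f integrable_on UNIV" unfolding f_def by (rule iffD2[OF integrable_restrict_UNIV])
  then have fi: "f integrable_on cbox a b" for a b by (rule integrable_on_subcbox) auto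
  obtain M where M: "negligible M" and der: "\<And>x \<epsilon>. x \<notin> M \<Longrightarrow> 0 < \<epsilon> \<Longrightarrow>
      \<exists>d>0. \<forall>h. 0 < h \<and> h < d \<longrightarrow> norm (integral (cbox x (x + h *\<^sub>R One)) f /\<^sub>R h ^ DIM(real) - f x) < \<epsilon>"
    using integrable_ccontinuous_explicit[OF fi] by metis
  \<comment> \<open>The zeros that are isolated from the right. Each has a rational number in the
    gap behind it, and no two share one, so there are countably many.\<close>
  define R where "R = {x \<in> {s<..<t}. X x = 0 \<and> (\<exists>d>0. \<forall>h. 0 < h \<and> h < d \<and> x + h < t \<longrightarrow> X (x + h) \<noteq> 0)}"
  have "countable R"
  proof -
    have "\<exists>q::rat. x < of_rat q \<and> of_rat q < t \<and> (\<forall>y. x < y \<and> y \<le> of_rat q \<longrightarrow> X y \<noteq> 0)" if "x \<in> R" for x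
    proof -
      obtain d where d: "d > 0" "\<And>h. 0 < h \<Longrightarrow> h < d \<Longrightarrow> x + h < t \<Longrightarrow> X (x + h) \<noteq> 0" and x: "s < x" "x < t"
        using \<open>x \<in> R\<close> unfolding R_def by auto
      obtain q :: rat where q: "x < of_rat q" "of_rat q < min (x + d) t"
        using of_rat_dense[of x "min (x + d) t"] d x by auto
      have "X y \<noteq> 0" if "x < y" "y \<le> of_rat q" for y
        using d(2)[of "y - x"] that q by auto
      then show ?thesis using q by auto
    qed
    then obtain q :: "real \<Rightarrow> rat" where q: "\<And>x. x \<in> R \<Longrightarrow> x < of_rat (q x)"
      "\<And>x y. x \<in> R \<Longrightarrow> x < y \<Longrightarrow> y \<le> of_rat (q x) \<Longrightarrow> X y \<noteq> 0" by metis
    have "inj_on q R"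
    proof (rule inj_onI)
      fix x y assume xy: "x \<in> R" "y \<in> R" "q x = q y"
      have R0: "X x = 0" "X y = 0" using xy by (auto simp: R_def)
      show "x = y"
      proof (rule ccontr)
        assume "x \<noteq> y"
        then consider "x < y" | "y < x" by linarith
        then show False
        proof cases
          case 1
          then show False using q(2)[OF xy(1) 1] q(1)[OF xy(2)] xy(3) R0 by simp
        next
          case 2
          then show False using q(2)[OF xy(2) 2] q(1)[OF xy(1)] xy(3) R0 by simp
        qed
      qed
    qed
    then show ?thesis by (rule countableI')
  qed
  then have R: "negligible R" using negligible_iff_null_sets countable_imp_null_set_lborel null_sets_completionI by blast
  have main: "V \<tau> = 0" if \<tau>: "\<tau> \<notin> M \<union> R" "\<tau> \<in> {s<..<t}" "X \<tau> = 0" for \<tau>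
  proof (rule ccontr)
    assume "V \<tau> \<noteq> 0"
    then have "norm (V \<tau>) > 0" by simp
    then obtain d where d: "d > 0" "\<And>h. 0 < h \<Longrightarrow> h < d \<Longrightarrow> norm (integral {\<tau>..\<tau> + h} f /\<^sub>R h - f \<tau>) < norm (V \<tau>)"
      using der[of \<tau> "norm (V \<tau>)"] \<tau>(1) by (auto simp: cbox_interval)
    \<comment> \<open>Outside R some zero follows within distance d, and the difference quotient up
      to it is exactly 0.\<close>
    obtain h where h: "0 < h" "h < d" "\<tau> + h < t" "X (\<tau> + h) = 0"
      using \<tau> d(1) unfolding R_def by blast
    have "integral {\<tau>..\<tau> + h} f = integral {\<tau>..\<tau> + h} V"
      using \<tau>(2) h by (intro integral_cong) (auto simp: f_def)
    also have "\<dots> = X (\<tau> + h) - X \<tau>"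
    proof -
      have "V integrable_on {s..\<tau> + h}" by (rule integrable_on_subinterval[OF Vint]) (use \<tau>(2) h in auto)
      then have I: "integral {s..\<tau>} V + integral {\<tau>..\<tau> + h} V = integral {s..\<tau> + h} V"
        using \<tau>(2) h by (intro Henstock_Kurzweil_Integration.integral_combine) auto
      have e1: "X \<tau> = X s + integral {s..\<tau>} V" by (rule X) (use \<tau>(2) in auto)
      have e2: "X (\<tau> + h) = X s + integral {s..\<tau> + h} V" by (rule X) (use \<tau>(2) h in auto)
      show ?thesis unfolding e2 by (subst e1) (simp add: I[symmetric])
    qed
    also have "\<dots> = 0" using h \<tau> by simp
    finally show False using d(2)[OF h(1,2)] \<tau>(2) by (simp add: f_def)
  qed
  have "negligible (M \<union> R)" using M R by (rule negligible_Un)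
  then show ?thesis
    using main by (intro AE_I'[of "M \<union> R"]) (auto simp: negligible_iff_null_sets)
qed

section \<open>The action and one-sided integrable bounds\<close>

lemma nn_integral_lborel_lebesgue:
  "set_nn_integral lborel A f = (\<integral>\<^sup>+\<tau>. f \<tau> * indicator A \<tau> \<partial>lebesgue)"
  by (simp add: nn_integral_completion)

lemma integral_eq_pos_neg:
  fixes g :: "real \<Rightarrow> real"
  assumes g: "g absolutely_integrable_on A"
  shows "ereal (integral A g) = enn2ereal (set_nn_integral lborel A (\<lambda>\<tau>. ennreal (g \<tau>)))
      - enn2ereal (set_nn_integral lborel A (\<lambda>\<tau>. ennreal (- g \<tau>)))"
proof -
  let ?f = "\<lambda>\<tau>. indicator A \<tau> *\<^sub>R g \<tau>"
  have f: "integrable lebesgue ?f" using g by (simp add: set_integrable_def)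
  have e: "set_nn_integral lborel A (\<lambda>\<tau>. ennreal (g \<tau>)) = (\<integral>\<^sup>+\<tau>. ennreal (?f \<tau>) \<partial>lebesgue)"
    "set_nn_integral lborel A (\<lambda>\<tau>. ennreal (- g \<tau>)) = (\<integral>\<^sup>+\<tau>. ennreal (- ?f \<tau>) \<partial>lebesgue)"
    unfolding nn_integral_lborel_lebesgue by (auto intro!: nn_integral_cong simp: indicator_def)
  have fin: "(\<integral>\<^sup>+\<tau>. ennreal (?f \<tau>) \<partial>lebesgue) < \<infinity>" "(\<integral>\<^sup>+\<tau>. ennreal (- ?f \<tau>) \<partial>lebesgue) < \<infinity>"
    using f unfolding real_integrable_def by (auto simp: top.not_eq_extremum)
  have "integral A g = (LINT \<tau>|lebesgue. ?f \<tau>)"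
    using set_lebesgue_integral_eq_integral(2)[OF g] by (simp add: set_lebesgue_integral_def)
  also have "\<dots> = enn2real (\<integral>\<^sup>+\<tau>. ennreal (?f \<tau>) \<partial>lebesgue) - enn2real (\<integral>\<^sup>+\<tau>. ennreal (- ?f \<tau>) \<partial>lebesgue)"
    by (rule real_lebesgue_integral_def[OF f])
  finally show "ereal (integral A g) = enn2ereal (set_nn_integral lborel A (\<lambda>\<tau>. ennreal (g \<tau>)))
      - enn2ereal (set_nn_integral lborel A (\<lambda>\<tau>. ennreal (- g \<tau>)))"
    unfolding e using fin by (cases "\<integral>\<^sup>+\<tau>. ennreal (?f \<tau>) \<partial>lebesgue" rule: ennreal_cases;
      cases "\<integral>\<^sup>+\<tau>. ennreal (- ?f \<tau>) \<partial>lebesgue" rule: ennreal_cases) auto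
qed

lemma set_nn_integral_mono_AE:
  assumes "AE \<tau> in lebesgue. \<tau> \<in> A \<longrightarrow> f \<tau> \<le> (g \<tau> :: real)"
  shows "set_nn_integral lborel A (\<lambda>\<tau>. ennreal (f \<tau>)) \<le> set_nn_integral lborel A (\<lambda>\<tau>. ennreal (g \<tau>))"
  unfolding nn_integral_lborel_lebesgue
  by (rule nn_integral_mono_AE) (use assms in \<open>auto simp: indicator_def ennreal_leI elim!: eventually_mono\<close>)

text \<open>Only one-sided bounds by integrable functions are used, so the measurability of the running cost is irrelevant.\<close>

lemma action_ge:
  assumes g: "g absolutely_integrable_on {s..t}"
    and le: "AE \<tau> in lebesgue. \<tau> \<in> {s..t} \<longrightarrow> g \<tau> \<le> Lcost N e Lag (X \<tau>) (V \<tau>)"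
  shows "ereal (integral {s..t} g) \<le> action N e Lag s t X V"
  unfolding action_def integral_eq_pos_neg[OF g]
proof (rule ereal_minus_mono)
  show "enn2ereal (set_nn_integral lborel {s..t} (\<lambda>\<tau>. ennreal (g \<tau>)))
    \<le> enn2ereal (set_nn_integral lborel {s..t} (\<lambda>\<tau>. ennreal (Lcost N e Lag (X \<tau>) (V \<tau>))))"
    using set_nn_integral_mono_AE[OF le] by (simp add: less_eq_ennreal.rep_eq)
  have "AE \<tau> in lebesgue. \<tau> \<in> {s..t} \<longrightarrow> - Lcost N e Lag (X \<tau>) (V \<tau>) \<le> - g \<tau>" using le by auto
  from set_nn_integral_mono_AE[OF this]
  show "enn2ereal (set_nn_integral lborel {s..t} (\<lambda>\<tau>. ennreal (- Lcost N e Lag (X \<tau>) (V \<tau>))))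
    \<le> enn2ereal (set_nn_integral lborel {s..t} (\<lambda>\<tau>. ennreal (- g \<tau>)))"
    by (simp add: less_eq_ennreal.rep_eq)
qed

lemma action_le:
  assumes g: "g absolutely_integrable_on {s..t}"
    and le: "AE \<tau> in lebesgue. \<tau> \<in> {s..t} \<longrightarrow> Lcost N e Lag (X \<tau>) (V \<tau>) \<le> g \<tau>"
  shows "action N e Lag s t X V \<le> ereal (integral {s..t} g)"
  unfolding action_def integral_eq_pos_neg[OF g]
proof (rule ereal_minus_mono)
  show "enn2ereal (set_nn_integral lborel {s..t} (\<lambda>\<tau>. ennreal (Lcost N e Lag (X \<tau>) (V \<tau>))))
    \<le> enn2ereal (set_nn_integral lborel {s..t} (\<lambda>\<tau>. ennreal (g \<tau>)))"
    using set_nn_integral_mono_AE[OF le] by (simp add: less_eq_ennreal.rep_eq)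
  have "AE \<tau> in lebesgue. \<tau> \<in> {s..t} \<longrightarrow> - g \<tau> \<le> - Lcost N e Lag (X \<tau>) (V \<tau>)" using le by auto
  from set_nn_integral_mono_AE[OF this]
  show "enn2ereal (set_nn_integral lborel {s..t} (\<lambda>\<tau>. ennreal (- g \<tau>)))
    \<le> enn2ereal (set_nn_integral lborel {s..t} (\<lambda>\<tau>. ennreal (- Lcost N e Lag (X \<tau>) (V \<tau>))))"
    by (simp add: less_eq_ennreal.rep_eq)
qed

context junction_hj
begin

subsection \<open>Running costs along admissible trajectories\<close>

lemma Lcost_branch:
  assumes i: "i \<in> I" and x: "x \<in> branch_star e i"
  shows "Lcost N e Lag x P = Lag i (P \<bullet> e i)"
proof -
  obtain s where s: "s > 0" "x = s *\<^sub>R e i" using x by (auto simp: branch_star_def)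
  have "(THE k. k \<in> {1..N} \<and> x \<in> branch_star e k) = i"
  proof (rule the_equality)
    show "i \<in> {1..N} \<and> x \<in> branch_star e i" using i x by (simp add: I_eq)
    fix k assume "k \<in> {1..N} \<and> x \<in> branch_star e k"
    then show "k = i" using scaleR_in_branch_star_iff[OF i, of k s] s by (simp add: I_eq)
  qed
  moreover have "x \<noteq> 0" using s unit[OF i] by auto
  ultimately show ?thesis by (simp add: Lcost_def)
qed

lemma Lcost_vertex: "Lcost N e Lag 0 0 = l0"
  by (simp add: Lcost_def)

lemma coord_inner: "i \<in> I \<Longrightarrow> s \<ge> 0 \<Longrightarrow> (s *\<^sub>R e i) \<bullet> e i = s"
  using unit[of i] by (simp add: norm_eq_1)

lemma coord_pos_iff:
  assumes "x \<in> J" "k \<in> I" shows "coord k x > 0 \<longleftrightarrow> x \<in> branch_star e k"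
proof -
  obtain i s where i: "i \<in> I" "s \<ge> 0" "x = s *\<^sub>R e i" using J_cases[OF assms(1)] .
  then show ?thesis using coord_scaleR[OF i(1) assms(2) i(2)] scaleR_in_branch_star_iff[OF i(1) assms(2) i(2)] by auto
qed

text \<open>A lower bound witnessed by an integrable minorant. Minorants can be glued at
  intermediate times, whereas \<open>action\<close> is a difference of two possibly infinite
  integrals.\<close>

definition cost_bounded_below :: "(real \<Rightarrow> real^2) \<Rightarrow> (real \<Rightarrow> real^2) \<Rightarrow> real \<Rightarrow> real \<Rightarrow> real \<Rightarrow> bool" where
  "cost_bounded_below X V c d m \<longleftrightarrow> (\<exists>g. g absolutely_integrable_on {c..d} \<and>
     (AE \<tau> in lebesgue. \<tau> \<in> {c..d} \<longrightarrow> g \<tau> \<le> Lcost N e Lag (X \<tau>) (V \<tau>)) \<and> integral {c..d} g = m)"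

lemma cost_bounded_below_trivial: "cost_bounded_below X V c c 0"
  unfolding cost_bounded_below_def
proof (intro exI[of _ "\<lambda>_. 0"] conjI)
  show "AE \<tau> in lebesgue. \<tau> \<in> {c..c} \<longrightarrow> 0 \<le> Lcost N e Lag (X \<tau>) (V \<tau>)"
    by (rule eventually_mono[OF AE_lebesgue_neq[of c]]) auto
qed auto

lemma cost_bounded_below_glue:
  assumes "c \<le> d" "d \<le> b" "cost_bounded_below X V c d m" "cost_bounded_below X V d b m'"
  shows "cost_bounded_below X V c b (m + m')"
proof -
  obtain g where g: "g absolutely_integrable_on {c..d}" "integral {c..d} g = m"
      "AE \<tau> in lebesgue. \<tau> \<in> {c..d} \<longrightarrow> g \<tau> \<le> Lcost N e Lag (X \<tau>) (V \<tau>)"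
    using assms(3) unfolding cost_bounded_below_def by blast
  obtain g' where g': "g' absolutely_integrable_on {d..b}" "integral {d..b} g' = m'"
      "AE \<tau> in lebesgue. \<tau> \<in> {d..b} \<longrightarrow> g' \<tau> \<le> Lcost N e Lag (X \<tau>) (V \<tau>)"
    using assms(4) unfolding cost_bounded_below_def by blast
  show ?thesis unfolding cost_bounded_below_def
  proof (intro exI[of _ "\<lambda>\<tau>. if \<tau> \<le> d then g \<tau> else g' \<tau>"] conjI)
    show "AE \<tau> in lebesgue. \<tau> \<in> {c..b} \<longrightarrow> (if \<tau> \<le> d then g \<tau> else g' \<tau>) \<le> Lcost N e Lag (X \<tau>) (V \<tau>)"
      using g(3) g'(3) by eventually_elim auto
  qed (use absolutely_integrable_glue[OF assms(1,2) g(1) g'(1)] g(2) g'(2) in auto)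
qed

text \<open>Jensen's inequality, by integrating the tangent at the mean speed.\<close>

lemma cost_bounded_below_branch:
  assumes i: "i \<in> I" and cd: "c < d" and V: "V absolutely_integrable_on {c..d}"
    and X: "X d = X c + integral {c..d} V"
    and branch: "\<And>\<tau>. c < \<tau> \<Longrightarrow> \<tau> < d \<Longrightarrow> X \<tau> \<in> branch_star e i"
  shows "cost_bounded_below X V c d (line_cost i (d - c) (X d \<bullet> e i - X c \<bullet> e i))"
proof -
  define q where "q = (X d \<bullet> e i - X c \<bullet> e i) / (d - c)"
  define g where "g = (\<lambda>\<tau>. (Lag i q - dLag i q * q) + dLag i q * (V \<tau> \<bullet> e i))"
  have Vi: "(\<lambda>\<tau>. V \<tau> \<bullet> e i) absolutely_integrable_on {c..d}"
    using absolutely_integrable_linear[OF V bounded_linear_inner_left[of "e i"]] by (simp add: o_def)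
  have cVi: "(\<lambda>\<tau>. dLag i q * (V \<tau> \<bullet> e i)) absolutely_integrable_on {c..d}"
    using absolutely_integrable_linear[OF Vi bounded_linear_mult_right[of "dLag i q"]] by (simp add: o_def)
  have "(\<lambda>\<tau>::real. Lag i q - dLag i q * q) absolutely_integrable_on {c..d}" by simp
  then have g: "g absolutely_integrable_on {c..d}" unfolding g_def by (intro set_integral_add cVi)
  have "integral {c..d} (\<lambda>\<tau>. V \<tau> \<bullet> e i) = integral {c..d} V \<bullet> e i"
    using integral_linear[OF set_lebesgue_integral_eq_integral(1)[OF V] bounded_linear_inner_left[of "e i"]]
    by (simp add: o_def)
  also have "\<dots> = q * (d - c)" using X cd by (simp add: q_def inner_diff_left[symmetric])
  finally have "integral {c..d} g = (d - c) * (Lag i q - dLag i q * q) + dLag i q * (q * (d - c))"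
    using cd set_lebesgue_integral_eq_integral(1)[OF cVi] unfolding g_def
    by (subst integral_add) auto
  also have "\<dots> = line_cost i (d - c) (X d \<bullet> e i - X c \<bullet> e i)"
    by (simp add: line_cost_def q_def algebra_simps)
  finally have int: "integral {c..d} g = line_cost i (d - c) (X d \<bullet> e i - X c \<bullet> e i)" .
  have "AE \<tau> in lebesgue. \<tau> \<in> {c..d} \<longrightarrow> g \<tau> \<le> Lcost N e Lag (X \<tau>) (V \<tau>)"
    using AE_lebesgue_neq[of c] AE_lebesgue_neq[of d]
  proof eventually_elim
    case (elim \<tau>)
    show ?case
    proof
      assume "\<tau> \<in> {c..d}"
      then have "X \<tau> \<in> branch_star e i" using elim branch by auto
      then have "Lcost N e Lag (X \<tau>) (V \<tau>) = Lag i (V \<tau> \<bullet> e i)" by (rule Lcost_branch[OF i])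
      then show "g \<tau> \<le> Lcost N e Lag (X \<tau>) (V \<tau>)"
        using Lag_ge_tangent[OF i, of q "V \<tau> \<bullet> e i"] by (simp add: g_def algebra_simps)
    qed
  qed
  then show ?thesis unfolding cost_bounded_below_def using g int by blast
qed

text \<open>Between two visits of the vertex, waiting there is optimal: every excursion into a branch has mean velocity 0,
  so the tangents at speed 0 integrate to the value of the Lagrangian at 0.\<close>

lemma cost_bounded_below_loop:
  assumes cd: "c < d" and V: "V absolutely_integrable_on {c..d}"
    and X: "\<And>\<tau>. \<tau> \<in> {c..d} \<Longrightarrow> X \<tau> = X c + integral {c..\<tau>} V"
    and XJ: "\<And>\<tau>. \<tau> \<in> {c..d} \<Longrightarrow> X \<tau> \<in> J" and ends: "X c = 0" "X d = 0"
  shows "cost_bounded_below X V c d ((d - c) * l0)"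
proof -
  have Vint: "V integrable_on {c..d}" using V by (rule set_lebesgue_integral_eq_integral)
  have Xcont: "continuous_on {c..d} X"
  proof -
    have "continuous_on {c..d} (\<lambda>\<tau>. X c + integral {c..\<tau>} V)"
      by (intro continuous_intros indefinite_integral_continuous_1 Vint)
    then show ?thesis by (rule continuous_on_eq) (rule X[symmetric])
  qed
  have Vzero: "AE \<tau> in lebesgue. \<tau> \<in> {c<..<d} \<longrightarrow> X \<tau> = 0 \<longrightarrow> V \<tau> = 0"
    by (rule derivative_zero_on_zeros[OF V X])
  \<comment> \<open>The times spent inside branch k. The components of this open set are the
    excursions.\<close>
  define G where "G = (\<lambda>k. {\<tau> \<in> {c<..<d}. X \<tau> \<in> branch_star e k})"
  have Gopen: "open (G k)" if k: "k \<in> I" for k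
  proof -
    have "continuous_on {c<..<d} (\<lambda>\<tau>. coord k (X \<tau>))"
      by (rule continuous_on_compose2[OF continuous_coord[OF k] continuous_on_subset[OF Xcont]])
        (use XJ in auto)
    then have "open ({c<..<d} \<inter> (\<lambda>\<tau>. coord k (X \<tau>)) -` {0<..})"
      by (rule continuous_open_preimage) auto
    also have "{c<..<d} \<inter> (\<lambda>\<tau>. coord k (X \<tau>)) -` {0<..} = G k"
      using coord_pos_iff[OF XJ k] by (auto simp: G_def)
    finally show ?thesis .
  qed
  have Vk: "(\<lambda>\<tau>. V \<tau> \<bullet> e k) absolutely_integrable_on {c..d}" for k
    using absolutely_integrable_linear[OF V bounded_linear_inner_left[of "e k"]] by (simp add: o_def)
  have G0: "integral (G k) (\<lambda>\<tau>. V \<tau> \<bullet> e k) = 0" if k: "k \<in> I" for k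
  proof (rule integral_open_eq_0[OF Gopen[OF k] _ Vk])
    show "G k \<subseteq> {c<..<d}" by (auto simp: G_def)
    fix c' d' assume cd': "c' < d'" and sub: "{c'<..<d'} \<subseteq> G k" and c': "c' \<in> {c..d} - G k" and d': "d' \<in> {c..d} - G k"
    have br: "X \<tau> \<in> branch e k" if "\<tau> \<in> {c'..d'}" for \<tau>
    proof -
      have cl: "closed ({c'..d'} \<inter> X -` branch e k)"
        using c' d' by (intro continuous_closed_preimage[OF continuous_on_subset[OF Xcont]] closed_branch[OF k]) auto
      have "{c'<..<d'} \<subseteq> {c'..d'} \<inter> X -` branch e k"
        using sub by (force simp: G_def branch_star_def branch_def)
      from closure_minimal[OF this cl] show ?thesis using that cd' by auto
    qed
    have zero: "X \<tau> = 0" if \<tau>: "\<tau> \<in> {c'..d'}" "\<tau> \<in> {c..d} - G k" for \<tau>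
    proof (cases "\<tau> = c \<or> \<tau> = d")
      case False
      then have "X \<tau> \<notin> branch_star e k" using \<tau> by (auto simp: G_def)
      moreover obtain s where "s \<ge> 0" "X \<tau> = s *\<^sub>R e k" using br[OF \<tau>(1)] by (auto simp: branch_def)
      ultimately show ?thesis using scaleR_in_branch_star_iff[OF k k, of s] by force
    qed (use ends in auto)
    have "X c' = 0" "X d' = 0" using zero c' d' cd' by auto
    moreover have "integral {c..c'} V + integral {c'..d'} V = integral {c..d'} V"
      using c' d' cd' by (intro Henstock_Kurzweil_Integration.integral_combine integrable_on_subinterval[OF Vint]) auto
    moreover have "X c' = X c + integral {c..c'} V" by (rule X) (use c' in auto)
    moreover have "X d' = X c + integral {c..d'} V" by (rule X) (use d' in auto)
    ultimately have "integral {c'..d'} V = 0" using ends(1) by simp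
    moreover have "V integrable_on {c'..d'}" using c' d' by (intro integrable_on_subinterval[OF Vint]) auto
    ultimately show "integral {c'..d'} (\<lambda>\<tau>. V \<tau> \<bullet> e k) = 0"
      using integral_linear[OF _ bounded_linear_inner_left[of "e k"], of V "{c'..d'}"] by (simp add: o_def)
  qed
  define f where "f = (\<lambda>k \<tau>. if \<tau> \<in> G k then V \<tau> \<bullet> e k else 0)"
  \<comment> \<open>On each excursion this is the tangent at speed 0 with \<open>Lag k 0\<close>
    lowered to \<open>l0\<close>; the velocity terms integrate to 0 over every
    \<open>G k\<close>.\<close>
  define g where "g = (\<lambda>\<tau>. l0 + (\<Sum>k\<in>I. dLag k 0 * f k \<tau>))"
  have fk: "f k absolutely_integrable_on {c..d}" "integral {c..d} (f k) = 0" if k: "k \<in> I" for k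
  proof -
    have Gsub: "G k \<subseteq> {c..d}" by (auto simp: G_def)
    have "(\<lambda>\<tau>. V \<tau> \<bullet> e k) absolutely_integrable_on G k"
      by (rule set_integrable_subset[OF Vk _ Gsub]) (use Gopen[OF k] in simp)
    then have "f k absolutely_integrable_on UNIV"
      unfolding f_def by (rule iffD2[OF absolutely_integrable_restrict_UNIV])
    then show "f k absolutely_integrable_on {c..d}" by (rule set_integrable_subset) auto
    have "integral {c..d} (f k) = integral (G k) (\<lambda>\<tau>. V \<tau> \<bullet> e k)"
      unfolding f_def using Gsub by (simp add: integral_restrict_Int Int_absorb2)
    then show "integral {c..d} (f k) = 0" using G0[OF k] by simp
  qed
  have fk': "(\<lambda>\<tau>. dLag k 0 * f k \<tau>) absolutely_integrable_on {c..d}" "integral {c..d} (\<lambda>\<tau>. dLag k 0 * f k \<tau>) = 0"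
    if k: "k \<in> I" for k
    using absolutely_integrable_linear[OF fk(1)[OF k] bounded_linear_mult_right[of "dLag k 0"]] fk(2)[OF k]
    by (auto simp: o_def)
  have sum: "(\<lambda>\<tau>. \<Sum>k\<in>I. dLag k 0 * f k \<tau>) absolutely_integrable_on {c..d}"
    by (rule absolutely_integrable_sum) (use fk' in auto)
  then have g: "g absolutely_integrable_on {c..d}"
    unfolding g_def by (intro set_integral_add) simp_all
  have "integral {c..d} (\<lambda>\<tau>. \<Sum>k\<in>I. dLag k 0 * f k \<tau>) = (\<Sum>k\<in>I. integral {c..d} (\<lambda>\<tau>. dLag k 0 * f k \<tau>))"
    by (rule integral_sum) (use fk'(1) set_lebesgue_integral_eq_integral(1) in auto)
  also have "\<dots> = 0" by (rule sum.neutral) (use fk'(2) in blast)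
  finally have "integral {c..d} g = (d - c) * l0"
    unfolding g_def using cd set_lebesgue_integral_eq_integral(1)[OF sum]
    by (subst integral_add) auto
  moreover have "AE \<tau> in lebesgue. \<tau> \<in> {c..d} \<longrightarrow> g \<tau> \<le> Lcost N e Lag (X \<tau>) (V \<tau>)"
    using Vzero AE_lebesgue_neq[of c] AE_lebesgue_neq[of d]
  proof eventually_elim
    case (elim \<tau>)
    show ?case
    proof
      assume \<tau>: "\<tau> \<in> {c..d}"
      obtain i s where i: "i \<in> I" "s \<ge> 0" "X \<tau> = s *\<^sub>R e i" using J_cases[OF XJ[OF \<tau>]] .
      have G: "\<tau> \<in> G k \<longleftrightarrow> s > 0 \<and> k = i" if "k \<in> I" for k
        using scaleR_in_branch_star_iff[OF i(1) that i(2)] i(3) \<tau> elim by (auto simp: G_def)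
      show "g \<tau> \<le> Lcost N e Lag (X \<tau>) (V \<tau>)"
      proof (cases "s = 0")
        case True
        then have "V \<tau> = 0" "X \<tau> = 0" using elim \<tau> i by auto
        moreover have "(\<Sum>k\<in>I. dLag k 0 * f k \<tau>) = 0" using G True by (intro sum.neutral) (auto simp: f_def)
        ultimately show ?thesis by (simp add: g_def Lcost_vertex)
      next
        case False
        then have s: "s > 0" using i by simp
        have "(\<Sum>k\<in>I. dLag k 0 * f k \<tau>) = (\<Sum>k\<in>I. if i = k then dLag k 0 * (V \<tau> \<bullet> e k) else 0)"
          using G s by (intro sum.cong) (auto simp: f_def)
        also have "\<dots> = dLag i 0 * (V \<tau> \<bullet> e i)" using i by (simp add: sum.delta')
        finally have "g \<tau> = l0 + dLag i 0 * (V \<tau> \<bullet> e i)" by (simp add: g_def)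
        also have "\<dots> \<le> Lag i (V \<tau> \<bullet> e i)"
          using l0_le[OF i(1)] Lag_ge_tangent[OF i(1), of 0 "V \<tau> \<bullet> e i"] by simp
        also have "\<dots> = Lcost N e Lag (X \<tau>) (V \<tau>)"
        proof (rule Lcost_branch[OF i(1), symmetric])
          show "X \<tau> \<in> branch_star e i" unfolding i(3) branch_star_def using s by blast
        qed
        finally show ?thesis .
      qed
    qed
  qed
  ultimately show ?thesis unfolding cost_bounded_below_def using g by blast
qed

text \<open>Away from the vertex the direction X / |X| is continuous with values in a finite set,
  hence constant on an interval.\<close>

lemma constant_branch:
  fixes X :: "real \<Rightarrow> real^2"
  assumes X: "continuous_on {c<..<d} X" and XJ: "\<And>\<tau>. \<tau> \<in> {c<..<d} \<Longrightarrow> X \<tau> \<in> J - {0}"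
  obtains i where "i \<in> I" "\<And>\<tau>. \<tau> \<in> {c<..<d} \<Longrightarrow> X \<tau> \<in> branch_star e i"
proof -
  define D where "D = (\<lambda>\<tau>. X \<tau> /\<^sub>R norm (X \<tau>))"
  have D: "\<exists>i\<in>I. D \<tau> = e i \<and> X \<tau> \<in> branch_star e i" if \<tau>: "\<tau> \<in> {c<..<d}" for \<tau>
  proof -
    have "X \<tau> \<in> J" "X \<tau> \<noteq> 0" using XJ[OF \<tau>] by auto
    then obtain i s where i: "i \<in> I" "s \<ge> 0" "X \<tau> = s *\<^sub>R e i" using J_cases by blast
    then have "s > 0" using \<open>X \<tau> \<noteq> 0\<close> by (cases "s = 0") auto
    then show ?thesis using i unit[OF i(1)] by (intro bexI[of _ i]) (auto simp: D_def branch_star_def)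
  qed
  have Dcont: "continuous_on {c<..<d} D" unfolding D_def using XJ by (intro continuous_intros X) auto
  have "D ` {c<..<d} \<subseteq> e ` I"
  proof
    fix y assume "y \<in> D ` {c<..<d}"
    then obtain \<tau> where "\<tau> \<in> {c<..<d}" "y = D \<tau>" by blast
    then show "y \<in> e ` I" using D[of \<tau>] by auto
  qed
  then have "finite (D ` {c<..<d})" by (rule finite_subset) simp
  moreover have "connected (D ` {c<..<d})"
    by (rule connected_continuous_image[OF Dcont]) simp
  ultimately have "D ` {c<..<d} = {} \<or> (\<exists>y. D ` {c<..<d} = {y})"
    using connected_finite_iff_sing by blast
  then obtain y where y: "\<And>\<tau>. \<tau> \<in> {c<..<d} \<Longrightarrow> D \<tau> = y" by (metis empty_iff imageI singletonD)
  show thesis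
  proof (cases "c < d")
    case True
    then obtain \<tau>0 where \<tau>0: "\<tau>0 \<in> {c<..<d}" using dense by auto
    obtain i where i: "i \<in> I" "D \<tau>0 = e i" using D[OF \<tau>0] by auto
    show thesis
    proof (rule that[OF i(1)])
      fix \<tau> assume \<tau>: "\<tau> \<in> {c<..<d}"
      then obtain k where k: "k \<in> I" "D \<tau> = e k" "X \<tau> \<in> branch_star e k" using D by blast
      then have "e k = e i" using y[OF \<tau>] y[OF \<tau>0] i by simp
      then show "X \<tau> \<in> branch_star e i" using k i distinct by (auto dest: inj_onD)
    qed
  next
    case False
    then show thesis using that[OF one_in_I] by simp
  qed
qed

subsection \<open>The value function is the optimal control value\<close>

lemma closure_branch_coord:
  fixes X :: "real \<Rightarrow> real^2"
  assumes i: "i \<in> I" and cd: "c < d" and X: "continuous_on {c..d} X"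
    and br: "\<And>\<tau>. \<tau> \<in> {c<..<d} \<Longrightarrow> X \<tau> \<in> branch_star e i" and \<tau>: "\<tau> \<in> {c..d}"
  shows "X \<tau> \<bullet> e i \<ge> 0 \<and> X \<tau> = (X \<tau> \<bullet> e i) *\<^sub>R e i"
proof -
  have cl: "closed ({c..d} \<inter> X -` branch e i)"
    by (rule continuous_closed_preimage[OF X closed_real_atLeastAtMost closed_branch[OF i]])
  have "{c<..<d} \<subseteq> {c..d} \<inter> X -` branch e i" using br by (force simp: branch_star_def branch_def)
  from closure_minimal[OF this cl] have "X \<tau> \<in> branch e i" using \<tau> cd by auto
  then obtain s where "s \<ge> 0" "X \<tau> = s *\<^sub>R e i" by (auto simp: branch_def)
  then show ?thesis using coord_inner[OF i] by auto
qed

lemma uval_le_line: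
  fixes X :: "real \<Rightarrow> real^2"
  assumes i: "i \<in> I" and cd: "0 \<le> c" "c < d" and X: "continuous_on {c..d} X"
    and br: "\<And>\<tau>. \<tau> \<in> {c<..<d} \<Longrightarrow> X \<tau> \<in> branch_star e i"
  shows "uval d (X d) \<le> uval c (X c) + line_cost i (d - c) (X d \<bullet> e i - X c \<bullet> e i)"
proof -
  have c: "X c \<bullet> e i \<ge> 0" "X c = (X c \<bullet> e i) *\<^sub>R e i" and d: "X d \<bullet> e i \<ge> 0" "X d = (X d \<bullet> e i) *\<^sub>R e i"
    using closure_branch_coord[OF i cd(2) X br, of c] closure_branch_coord[OF i cd(2) X br, of d] cd(2) by auto
  have "uval c (X c) = U i c (X c \<bullet> e i)" "uval d (X d) = U i d (X d \<bullet> e i)"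
    using uval_scaleR[OF i c(1)] uval_scaleR[OF i d(1)] c(2) d(2) by metis+
  then show ?thesis using U_line[OF i cd d(1) c(1)] by simp
qed

lemma adm_pathsD:
  assumes "(X, V) \<in> adm_paths N e s y t x"
  shows "V absolutely_integrable_on {s..t}" "\<And>\<tau>. \<tau> \<in> {s..t} \<Longrightarrow> X \<tau> = X s + integral {s..\<tau>} V"
    "\<And>\<tau>. \<tau> \<in> {s..t} \<Longrightarrow> X \<tau> \<in> J" "AE \<tau> in lebesgue. \<tau> \<in> {s..t} \<longrightarrow> adm_dir N e (X \<tau>) (V \<tau>)"
    "X s = y" "X t = x"
  using assms unfolding adm_paths_def mem_Collect_eq prod.case by blast+

lemma uval_le_cost:
  assumes path: "(X, V) \<in> adm_paths N e 0 y t x" and t: "t > 0"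
  shows "ereal (uval t x) \<le> ereal (u0 y) + action N e Lag 0 t X V"
proof -
  have V: "V absolutely_integrable_on {0..t}" and X: "\<And>\<tau>. \<tau> \<in> {0..t} \<Longrightarrow> X \<tau> = X 0 + integral {0..\<tau>} V"
    and XJ: "\<And>\<tau>. \<tau> \<in> {0..t} \<Longrightarrow> X \<tau> \<in> J" and ends: "X 0 = y" "X t = x"
    by (fact adm_pathsD[OF path])+
  have Vint: "V integrable_on {0..t}" using V by (rule set_lebesgue_integral_eq_integral)
  have Xcont: "continuous_on {0..t} X"
  proof -
    have "continuous_on {0..t} (\<lambda>\<tau>. X 0 + integral {0..\<tau>} V)"
      by (intro continuous_intros indefinite_integral_continuous_1 Vint)
    then show ?thesis by (rule continuous_on_eq) (rule X[symmetric])
  qed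
  have incr: "X d = X c + integral {c..d} V" if "0 \<le> c" "c \<le> d" "d \<le> t" for c d
  proof -
    have "integral {0..c} V + integral {c..d} V = integral {0..d} V"
      using that by (intro Henstock_Kurzweil_Integration.integral_combine integrable_on_subinterval[OF Vint]) auto
    then show ?thesis using X[of c] X[of d] that by (simp add: add.assoc)
  qed
  have Vsub: "V absolutely_integrable_on {c..d}" if "0 \<le> c" "d \<le> t" for c d
    by (rule set_integrable_subset[OF V]) (use that in auto)
  have segment: "\<exists>m. cost_bounded_below X V c d m \<and> uval d (X d) \<le> uval c (X c) + m"
    if cd: "0 \<le> c" "c \<le> d" "d \<le> t" and nz: "\<And>\<tau>. c < \<tau> \<Longrightarrow> \<tau> < d \<Longrightarrow> X \<tau> \<noteq> 0" for c d
  proof (cases "c = d")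
    case True
    then show ?thesis using cost_bounded_below_trivial by (intro exI[of _ 0]) auto
  next
    case False
    then have cd': "c < d" using cd by simp
    have Xc: "continuous_on {c..d} X" by (rule continuous_on_subset[OF Xcont]) (use cd in auto)
    obtain i where i: "i \<in> I" "\<And>\<tau>. \<tau> \<in> {c<..<d} \<Longrightarrow> X \<tau> \<in> branch_star e i"
      using constant_branch[OF continuous_on_subset[OF Xc], of c d] XJ nz cd by (auto simp: subset_eq)
    have "cost_bounded_below X V c d (line_cost i (d - c) (X d \<bullet> e i - X c \<bullet> e i))"
      by (rule cost_bounded_below_branch[OF i(1) cd' Vsub[OF cd(1,3)] incr[OF cd]]) (rule i(2), simp)
    then show ?thesis using uval_le_line[OF i(1) cd(1) cd' Xc i(2)] by blast
  qed
  have "\<exists>m. cost_bounded_below X V 0 t m \<and> uval t (X t) \<le> uval 0 (X 0) + m"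
  proof (cases "\<exists>\<tau>\<in>{0..t}. X \<tau> = 0")
    case False
    then show ?thesis using segment[of 0 t] t by auto
  next
    case True
    \<comment> \<open>The visits of the vertex form a compact set, which provides the first visit a
      and the last visit b.\<close>
    define Z where "Z = {0..t} \<inter> X -` {0}"
    have Zne: "Z \<noteq> {}" using True by (auto simp: Z_def)
    have "closed Z" unfolding Z_def by (intro continuous_closed_preimage[OF Xcont]) auto
    moreover have "bounded Z" by (rule bounded_subset[of "{0..t}"]) (auto simp: Z_def)
    ultimately have Zc: "compact Z" by (simp add: compact_eq_bounded_closed)
    obtain a where a: "a \<in> Z" "\<And>\<tau>. \<tau> \<in> Z \<Longrightarrow> a \<le> \<tau>" using compact_attains_inf[OF Zc Zne] by blast
    obtain b where b: "b \<in> Z" "\<And>\<tau>. \<tau> \<in> Z \<Longrightarrow> \<tau> \<le> b" using compact_attains_sup[OF Zc Zne] by blast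
    have ab: "0 \<le> a" "a \<le> b" "b \<le> t" "X a = 0" "X b = 0" using a b by (auto simp: Z_def)
    obtain m1 where m1: "cost_bounded_below X V 0 a m1" "uval a (X a) \<le> uval 0 (X 0) + m1"
    proof -
      have "X \<tau> \<noteq> 0" if "0 < \<tau>" "\<tau> < a" for \<tau> using a(2)[of \<tau>] that ab by (auto simp: Z_def)
      then show ?thesis using segment[of 0 a] ab that by auto
    qed
    obtain m3 where m3: "cost_bounded_below X V b t m3" "uval t (X t) \<le> uval b (X b) + m3"
    proof -
      have "X \<tau> \<noteq> 0" if "b < \<tau>" "\<tau> < t" for \<tau> using b(2)[of \<tau>] that ab by (auto simp: Z_def)
      then show ?thesis using segment[of b t] ab that by auto
    qed
    have m2: "cost_bounded_below X V a b ((b - a) * l0)"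
    proof (cases "a = b")
      case True
      then show ?thesis using cost_bounded_below_trivial by simp
    next
      case False
      then have "a < b" using ab by simp
      then show ?thesis
      proof (rule cost_bounded_below_loop[OF _ Vsub[OF ab(1,3)] _ _ ab(4,5)])
        fix \<tau> assume \<tau>: "\<tau> \<in> {a..b}"
        show "X \<tau> = X a + integral {a..\<tau>} V" by (rule incr) (use \<tau> ab in auto)
        show "X \<tau> \<in> J" by (rule XJ) (use \<tau> ab in auto)
      qed
    qed
    have "uval b (X b) \<le> uval a (X a) + (b - a) * l0"
      using U_wait_at_vertex[OF one_in_I ab(1,2)] ab uval_0[OF one_in_I] by simp
    moreover have "cost_bounded_below X V 0 t (m1 + ((b - a) * l0 + m3))"
      using ab m1 m2 m3 by (intro cost_bounded_below_glue[of 0 a t] cost_bounded_below_glue[of a b t]) auto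
    ultimately show ?thesis using m1 m3 by (intro exI[of _ "m1 + ((b - a) * l0 + m3)"]) simp
  qed
  then obtain g where g: "g absolutely_integrable_on {0..t}"
      "AE \<tau> in lebesgue. \<tau> \<in> {0..t} \<longrightarrow> g \<tau> \<le> Lcost N e Lag (X \<tau>) (V \<tau>)"
      "uval t (X t) \<le> uval 0 (X 0) + integral {0..t} g"
    unfolding cost_bounded_below_def by auto
  have "uval 0 (X 0) = u0 y"
  proof -
    have "y \<in> J" using XJ[of 0] t ends by simp
    then show ?thesis using J_cases uval_scaleR U_0 ends(1) by metis
  qed
  then have "ereal (uval t x) \<le> ereal (u0 y) + ereal (integral {0..t} g)" using g(3) ends(2) by simp
  also have "\<dots> \<le> ereal (u0 y) + action N e Lag 0 t X V"
    by (intro add_left_mono action_ge[OF g(1,2)])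
  finally show ?thesis .
qed

text \<open>The counterpart of \<open>cost_bounded_below\<close> for upper bounds: the cost of an
  admissible trajectory is witnessed by an integrable majorant.\<close>

definition realized :: "real \<Rightarrow> real^2 \<Rightarrow> real \<Rightarrow> bool" where
  "realized t x c \<longleftrightarrow> (\<exists>y X V g. y \<in> J \<and> (X, V) \<in> adm_paths N e 0 y t x \<and> g absolutely_integrable_on {0..t} \<and>
     (AE \<tau> in lebesgue. \<tau> \<in> {0..t} \<longrightarrow> Lcost N e Lag (X \<tau>) (V \<tau>) \<le> g \<tau>) \<and> u0 y + integral {0..t} g \<le> c)"

lemma realized_line:
  assumes r: "realized s (z *\<^sub>R e i) c" and i: "i \<in> I" and s: "0 \<le> s" "s < t" and z: "z \<ge> 0" and x: "x \<ge> 0"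
  shows "realized t (x *\<^sub>R e i) (c + line_cost i (t - s) (x - z))"
proof -
  obtain y X V g where y: "y \<in> J" and path: "(X, V) \<in> adm_paths N e 0 y s (z *\<^sub>R e i)"
    and g: "g absolutely_integrable_on {0..s}" "u0 y + integral {0..s} g \<le> c"
      "AE \<tau> in lebesgue. \<tau> \<in> {0..s} \<longrightarrow> Lcost N e Lag (X \<tau>) (V \<tau>) \<le> g \<tau>"
    using r unfolding realized_def by blast
  have V: "V absolutely_integrable_on {0..s}" and X: "\<And>\<tau>. \<tau> \<in> {0..s} \<Longrightarrow> X \<tau> = X 0 + integral {0..\<tau>} V"
    and XJ: "\<And>\<tau>. \<tau> \<in> {0..s} \<Longrightarrow> X \<tau> \<in> J" and ends: "X 0 = y" "X s = z *\<^sub>R e i"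
    and adm: "AE \<tau> in lebesgue. \<tau> \<in> {0..s} \<longrightarrow> adm_dir N e (X \<tau>) (V \<tau>)"
    by (fact adm_pathsD[OF path])+
  define q where "q = (x - z) / (t - s)"
  define r where "r = (\<lambda>\<tau>. z + q * (\<tau> - s))"
  define X' where "X' = (\<lambda>\<tau>. if \<tau> \<le> s then X \<tau> else r \<tau> *\<^sub>R e i)"
  define V' where "V' = (\<lambda>\<tau>. if \<tau> \<le> s then V \<tau> else q *\<^sub>R e i)"
  define g' where "g' = (\<lambda>\<tau>. if \<tau> \<le> s then g \<tau> else Lag i q)"
  have rt: "r t = x" using s by (simp add: r_def q_def)
  have r_comb: "(t - s) * r \<tau> = z * (t - \<tau>) + x * (\<tau> - s)" for \<tau>
  proof -
    have "(t - s) * q = x - z" using s by (simp add: q_def)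
    then have "(t - s) * r \<tau> = (t - s) * z + (x - z) * (\<tau> - s)" unfolding r_def
      by (simp add: distrib_left mult.assoc[symmetric])
    then show ?thesis by (simp add: algebra_simps)
  qed
  have r_nonneg: "r \<tau> \<ge> 0" if "s < \<tau>" "\<tau> \<le> t" for \<tau>
  proof -
    have "0 \<le> (t - s) * r \<tau>" unfolding r_comb using that z x by (intro add_nonneg_nonneg mult_nonneg_nonneg) auto
    then show ?thesis using s by (simp add: zero_le_mult_iff)
  qed
  have r_pos: "r \<tau> > 0" if "s < \<tau>" "\<tau> < t" "\<not> (z = 0 \<and> x = 0)" for \<tau>
  proof -
    have "z * (t - \<tau>) \<ge> 0" "x * (\<tau> - s) \<ge> 0" "z * (t - \<tau>) > 0 \<or> x * (\<tau> - s) > 0"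
      using that z x by (auto simp: zero_less_mult_iff)
    then have "0 < (t - s) * r \<tau>" unfolding r_comb by linarith
    then show ?thesis using s by (simp add: zero_less_mult_iff)
  qed
  have V': "V' absolutely_integrable_on {0..t}"
    unfolding V'_def using s V by (intro absolutely_integrable_glue) auto
  have g'_int: "g' absolutely_integrable_on {0..t}" "integral {0..t} g' = integral {0..s} g + (t - s) * Lag i q"
    unfolding g'_def using s g(1) absolutely_integrable_glue[of 0 s t g "\<lambda>_. Lag i q"] by auto
  have X'0: "X' 0 = y" using s ends by (simp add: X'_def)
  have X'int: "X' \<tau> = X' 0 + integral {0..\<tau>} V'" if \<tau>: "\<tau> \<in> {0..t}" for \<tau>
  proof (cases "\<tau> \<le> s")
    case True
    have "integral {0..\<tau>} V' = integral {0..\<tau>} V" using True by (intro integral_cong) (auto simp: V'_def)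
    then show ?thesis using X[of \<tau>] True \<tau> X'0 ends by (simp add: X'_def)
  next
    case False
    then have "integral {0..\<tau>} V' = integral {0..s} V + integral {s..\<tau>} (\<lambda>_. q *\<^sub>R e i)"
      unfolding V'_def using s V by (intro absolutely_integrable_glue) auto
    also have "integral {s..\<tau>} (\<lambda>_. q *\<^sub>R e i) = (q * (\<tau> - s)) *\<^sub>R e i" using False by simp
    finally show ?thesis using X[of s] s False X'0 ends by (simp add: X'_def r_def scaleR_add_left)
  qed
  \<comment> \<open>If both ends are at the vertex the trajectory stays there and pays
    \<open>l0\<close>, at most the \<open>Lag i 0\<close> charged by the line. Otherwise the open
    line lies inside the branch, by \<open>r_pos\<close>.\<close>
  have line_adm: "adm_dir N e (r \<tau> *\<^sub>R e i) (q *\<^sub>R e i) \<and> Lcost N e Lag (r \<tau> *\<^sub>R e i) (q *\<^sub>R e i) \<le> Lag i q"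
    if \<tau>: "s < \<tau>" "\<tau> < t" for \<tau>
  proof (cases "z = 0 \<and> x = 0")
    case True
    then have "q = 0" "r \<tau> = 0" by (auto simp: q_def r_def)
    moreover have "adm_dir N e 0 0" unfolding adm_dir_def I_eq[symmetric] using i by (auto intro!: bexI[of _ i] exI[of _ 0])
    ultimately show ?thesis using l0_le[OF i] by (simp add: Lcost_vertex)
  next
    case False
    then have b: "r \<tau> *\<^sub>R e i \<in> branch_star e i" using r_pos[OF \<tau>] by (auto simp: branch_star_def)
    have "e i \<bullet> e i = 1" using unit[OF i] by (simp add: norm_eq_1)
    then show ?thesis using Lcost_branch[OF i b] b i unfolding adm_dir_def I_eq[symmetric] by auto
  qed
  have "(X', V') \<in> adm_paths N e 0 y t (x *\<^sub>R e i)"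
    unfolding adm_paths_def
  proof (clarify, intro conjI ballI)
    show "V' absolutely_integrable_on {0..t}" by (rule V')
    show "X' \<tau> = X' 0 + integral {0..\<tau>} V'" if "\<tau> \<in> {0..t}" for \<tau> by (rule X'int[OF that])
    show "X' \<tau> \<in> J" if "\<tau> \<in> {0..t}" for \<tau>
      using XJ[of \<tau>] that r_nonneg[of \<tau>] scaleR_in_J[OF i] by (auto simp: X'_def)
    show "AE \<tau> in lebesgue. \<tau> \<in> {0..t} \<longrightarrow> adm_dir N e (X' \<tau>) (V' \<tau>)"
      using adm AE_lebesgue_neq[of t] by eventually_elim (use line_adm in \<open>auto simp: X'_def V'_def\<close>)
    show "X' 0 = y" by (rule X'0)
    show "X' t = x *\<^sub>R e i" using s rt by (simp add: X'_def)
  qed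
  moreover have "AE \<tau> in lebesgue. \<tau> \<in> {0..t} \<longrightarrow> Lcost N e Lag (X' \<tau>) (V' \<tau>) \<le> g' \<tau>"
    using g(3) AE_lebesgue_neq[of t] by eventually_elim (use line_adm in \<open>auto simp: X'_def V'_def g'_def\<close>)
  moreover have "u0 y + integral {0..t} g' \<le> c + line_cost i (t - s) (x - z)"
    using g(2) unfolding g'_int by (simp add: line_cost_def q_def)
  ultimately show ?thesis unfolding realized_def using y g'_int(1) by blast
qed

lemma reach_realized: "reach j t x c \<Longrightarrow> realized t (x *\<^sub>R e j) c"
proof (induction rule: reach.induct)
  case (init i x)
  have "(\<lambda>_. x *\<^sub>R e i, \<lambda>_. 0) \<in> adm_paths N e 0 (x *\<^sub>R e i) 0 (x *\<^sub>R e i)"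
    unfolding adm_paths_def
  proof (clarify, intro conjI ballI)
    show "AE \<tau> in lebesgue. \<tau> \<in> {0..0::real} \<longrightarrow> adm_dir N e (x *\<^sub>R e i) 0"
      by (rule eventually_mono[OF AE_lebesgue_neq[of 0]]) auto
  qed (use scaleR_in_J[OF init] in auto)
  moreover have "AE \<tau> in lebesgue. \<tau> \<in> {0..0::real} \<longrightarrow> Lcost N e Lag (x *\<^sub>R e i) 0 \<le> 0"
    by (rule eventually_mono[OF AE_lebesgue_neq[of 0]]) auto
  ultimately show ?case unfolding realized_def using scaleR_in_J[OF init]
    by (intro exI[of _ "x *\<^sub>R e i"] exI[of _ "\<lambda>_. x *\<^sub>R e i"] exI[of _ "\<lambda>_. 0"]) auto
next
  case (line i s y c t x)
  then show ?case using reach_dom[OF line.hyps(1)] by (intro realized_line) auto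
qed simp

lemma u_oc_eq_uval:
  assumes x: "x \<in> J" and t: "t \<ge> 0"
  shows "u_oc N e Lag u0 t x = ereal (uval t x)"
proof (cases "t = 0")
  case True
  obtain i s where i: "i \<in> I" "s \<ge> 0" "x = s *\<^sub>R e i" using J_cases[OF x] .
  then show ?thesis using True by (simp add: u_oc_def uval_scaleR U_0)
next
  case False
  then have t: "t > 0" using t by simp
  obtain j s where j: "j \<in> I" "s \<ge> 0" "x = s *\<^sub>R e j" using J_cases[OF x] .
  let ?S = "{(y, XV). y \<in> J \<and> XV \<in> adm_paths N e 0 y t x}"
  have eq: "u_oc N e Lag u0 t x = (INF p\<in>?S. ereal (u0 (fst p)) + action N e Lag 0 t (fst (snd p)) (snd (snd p)))"
    using t by (simp add: u_oc_def)
  have ge: "ereal (uval t x) \<le> u_oc N e Lag u0 t x"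
    unfolding eq by (rule INF_greatest) (use uval_le_cost[OF _ t] in auto)
  have le: "u_oc N e Lag u0 t x \<le> ereal c" if c: "reach j t s c" for c
  proof -
    obtain y X V g where y: "y \<in> J" and path: "(X, V) \<in> adm_paths N e 0 y t x"
      and g: "g absolutely_integrable_on {0..t}" "u0 y + integral {0..t} g \<le> c"
        "AE \<tau> in lebesgue. \<tau> \<in> {0..t} \<longrightarrow> Lcost N e Lag (X \<tau>) (V \<tau>) \<le> g \<tau>"
      using reach_realized[OF c] unfolding realized_def j(3)[symmetric] by blast
    have "u_oc N e Lag u0 t x \<le> ereal (u0 y) + action N e Lag 0 t X V"
      unfolding eq by (rule INF_lower2[of "(y, (X, V))"]) (use y path in auto)
    also have "\<dots> \<le> ereal (u0 y) + ereal (integral {0..t} g)"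
      by (intro add_left_mono action_le[OF g(1,3)])
    also have "\<dots> \<le> ereal c" using g(2) by simp
    finally show ?thesis .
  qed
  obtain c0 where "reach j t s c0" using reach_exists[OF j(1) _ j(2), of t] t by auto
  then have "u_oc N e Lag u0 t x \<le> ereal c0" by (rule le)
  then obtain v where v: "u_oc N e Lag u0 t x = ereal v" using ge by (cases "u_oc N e Lag u0 t x") auto
  have "v \<le> U j t s" using le v t j by (intro U_ge) auto
  then have "v \<le> uval t x" using j by (simp add: uval_scaleR)
  then show ?thesis using ge v by simp
qed

text \<open>The infimum over all trajectories is regrouped by starting points.
  \<open>uval_le_cost\<close> keeps every action above a real number, so that the finite
  \<open>u0 y\<close> can be moved across the infimum.\<close>

lemma hopf_lax:
  assumes x: "x \<in> J" and t: "t > 0"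
  shows "u_oc N e Lag u0 t x = (INF y\<in>J. ereal (u0 y) + min_action N e Lag 0 y t x)"
proof (rule antisym)
  show "u_oc N e Lag u0 t x \<le> (INF y\<in>J. ereal (u0 y) + min_action N e Lag 0 y t x)"
  proof (rule INF_greatest)
    fix y assume y: "y \<in> J"
    have "ereal (uval t x - u0 y) \<le> min_action N e Lag 0 y t x"
      unfolding min_action_def using t
    proof (simp, intro INF_greatest)
      fix XV assume "XV \<in> adm_paths N e 0 y t x"
      then have "ereal (uval t x) \<le> ereal (u0 y) + action N e Lag 0 t (fst XV) (snd XV)"
        by (intro uval_le_cost[OF _ t]) simp
      then show "ereal (uval t x - u0 y) \<le> action N e Lag 0 t (fst XV) (snd XV)"
        by (cases "action N e Lag 0 t (fst XV) (snd XV)") auto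
    qed
    then show "u_oc N e Lag u0 t x \<le> ereal (u0 y) + min_action N e Lag 0 y t x"
      using u_oc_eq_uval[OF x, of t] t by (cases "min_action N e Lag 0 y t x") auto
  qed
  show "(INF y\<in>J. ereal (u0 y) + min_action N e Lag 0 y t x) \<le> u_oc N e Lag u0 t x"
    unfolding u_oc_def using t
  proof (simp, intro INF_greatest)
    fix p assume p: "p \<in> {(y, XV). y \<in> J \<and> XV \<in> adm_paths N e 0 y t x}"
    have "min_action N e Lag 0 (fst p) t x \<le> action N e Lag 0 t (fst (snd p)) (snd (snd p))"
      unfolding min_action_def using t p by (auto intro!: INF_lower2[of "snd p"])
    then show "(INF y\<in>J. ereal (u0 y) + min_action N e Lag 0 y t x)
        \<le> ereal (u0 (fst p)) + action N e Lag 0 t (fst (snd p)) (snd (snd p))"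
      using p by (intro INF_lower2[of "fst p"] add_left_mono) auto
  qed
qed

lemma uval_bound: "x \<in> J \<Longrightarrow> 0 \<le> t \<Longrightarrow> t \<le> T \<Longrightarrow> \<bar>uval t x - u0 x\<bar> \<le> B * T"
proof -
  assume x: "x \<in> J" and t: "0 \<le> t" "t \<le> T"
  obtain i s where i: "i \<in> I" "s \<ge> 0" "x = s *\<^sub>R e i" using J_cases[OF x] .
  have "B * t \<le> B * T" using B_nonneg t by (intro mult_left_mono)
  then show ?thesis using U_bounds[OF i(1) t(1) i(2)] i by (simp add: uval_scaleR)
qed

end

theorem mainTheorem3:
  fixes N :: nat and e :: "nat \<Rightarrow> real^2" and Lag :: "nat \<Rightarrow> real \<Rightarrow> real"
    and u0 :: "real^2 \<Rightarrow> real" and T :: real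
  assumes N: "N \<ge> 1"
    and unit: "\<forall>i\<in>{1..N}. norm (e i) = 1"
    and distinct: "inj_on e {1..N}"
    and A0: "d_lipschitz N e u0"
    and A1: "hyp_A1 N Lag"
    and T: "T > 0"
  shows
    "(\<forall>t x. 0 \<le> t \<and> t < T \<and> x \<in> junction N e \<longrightarrow> \<bar>u_oc N e Lag u0 t x\<bar> \<noteq> \<infinity>)
     \<and> visc_sol N e Lag T u0 (\<lambda>t x. real_of_ereal (u_oc N e Lag u0 t x))
     \<and> (\<exists>C. \<forall>(t, x)\<in>JT N e T. \<bar>real_of_ereal (u_oc N e Lag u0 t x) - u0 x\<bar> \<le> C)
     \<and> (\<forall>u. visc_sol N e Lag T u0 u \<and> (\<exists>C. \<forall>(t, x)\<in>JT N e T. \<bar>u t x - u0 x\<bar> \<le> C) \<longrightarrow>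
          (\<forall>t x. 0 \<le> t \<and> t < T \<and> x \<in> junction N e \<longrightarrow> ereal (u t x) = u_oc N e Lag u0 t x))
     \<and> (\<forall>(t, x)\<in>JT N e T.
          u_oc N e Lag u0 t x = (INF y\<in>junction N e. ereal (u0 y) + min_action N e Lag 0 y t x))"
proof -
  obtain \<gamma> where \<gamma>: "\<gamma> > 0" and L: "\<forall>i\<in>{1..N}. \<exists>L1 L2.
      (\<forall>q. (Lag i has_real_derivative L1 q) (at q) \<and> (L1 has_real_derivative L2 q) (at q)
           \<and> L2 q \<ge> \<gamma>) \<and> continuous_on UNIV L2"
    using A1 unfolding hyp_A1_def by blast
  from bchoice[OF L] obtain L1 where "\<forall>i\<in>{1..N}. \<exists>L2.
      (\<forall>q. (Lag i has_real_derivative L1 i q) (at q) \<and> (L1 i has_real_derivative L2 q) (at q)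
           \<and> L2 q \<ge> \<gamma>) \<and> continuous_on UNIV L2" by blast
  from bchoice[OF this] obtain L2 where L12: "\<forall>i\<in>{1..N}.
      (\<forall>q. (Lag i has_real_derivative L1 i q) (at q) \<and> (L1 i has_real_derivative L2 i q) (at q)
           \<and> L2 i q \<ge> \<gamma>) \<and> continuous_on UNIV (L2 i)" by blast
  obtain K where K: "\<forall>x\<in>junction N e. \<forall>y\<in>junction N e. \<bar>u0 x - u0 y\<bar> \<le> K * jdist N e x y"
    using A0 unfolding d_lipschitz_def by blast
  \<comment> \<open>The constant in \<open>d_lipschitz\<close> carries no sign condition, while the
    locale asks for a nonnegative one.\<close>
  have "junction_hj N e Lag L1 L2 u0 \<gamma> \<bar>K\<bar>"
  proof
    fix x y assume "x \<in> junction N e" "y \<in> junction N e"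
    then have "\<bar>u0 x - u0 y\<bar> \<le> K * jdist N e x y" using K by blast
    also have "\<dots> \<le> \<bar>K\<bar> * jdist N e x y" by (intro mult_right_mono) (auto simp: jdist_def)
    finally show "\<bar>u0 x - u0 y\<bar> \<le> \<bar>K\<bar> * jdist N e x y" .
  qed (use N unit distinct \<gamma> L12 in auto)
  then interpret junction_hj N e Lag L1 L2 u0 \<gamma> "\<bar>K\<bar>" .
  show ?thesis
  proof (intro conjI allI impI)
    fix t x assume "0 \<le> t \<and> t < T \<and> x \<in> J"
    then show "\<bar>u_oc N e Lag u0 t x\<bar> \<noteq> \<infinity>" by (simp add: u_oc_eq_uval)
  next
    show "visc_sol N e Lag T u0 (\<lambda>t x. real_of_ereal (u_oc N e Lag u0 t x))"
      by (rule visc_sol_uval[OF T]) (auto simp: JT0_def u_oc_eq_uval)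
  next
    show "\<exists>C. \<forall>(t, x)\<in>JT N e T. \<bar>real_of_ereal (u_oc N e Lag u0 t x) - u0 x\<bar> \<le> C"
      by (rule exI[of _ "B * T"]) (auto simp: JT_def u_oc_eq_uval uval_bound)
  next
    fix u t x
    assume u: "visc_sol N e Lag T u0 u \<and> (\<exists>C. \<forall>(t, x)\<in>JT N e T. \<bar>u t x - u0 x\<bar> \<le> C)"
      and tx: "0 \<le> t \<and> t < T \<and> x \<in> J"
    obtain C where C: "\<And>t x. (t, x) \<in> JT N e T \<Longrightarrow> \<bar>u t x - u0 x\<bar> \<le> C" using u by blast
    have "x \<in> J" using tx by simp
    then obtain i s where i: "i \<in> I" "s \<ge> 0" "x = s *\<^sub>R e i" using J_cases by blast
    have "u t x = uval t x"
      using visc_sol_unique[OF conjunct1[OF u] C i(1) _ _ i(2), of t] tx i by (simp add: uval_scaleR)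
    then show "ereal (u t x) = u_oc N e Lag u0 t x" using tx by (simp add: u_oc_eq_uval)
  next
    show "\<forall>(t, x)\<in>JT N e T.
            u_oc N e Lag u0 t x = (INF y\<in>J. ereal (u0 y) + min_action N e Lag 0 y t x)"
      by (auto simp: JT_def hopf_lax)
  qed
qed

end
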